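(* There is a randomized LOCAL algorithm that computes a maximal independent set of any $n$-vertex graph with maximum degree $\Delta$ in $O(\log\Delta\cdot\sqrt{\log n})$ rounds with high probability. Moreover, if $\Delta = (\log n)^{O(1)}$, a maximal independent set can be computed in $\exp(O(\sqrt{\log\log n}))$ rounds with high probability.
   Context: LOCAL model: each vertex hosts a processor with a distinct ID, knows its neighbors and an upper bound on $n$ (and $\Delta$); synchronous rounds, unbounded messages per edge per round, free local computation; time = number of rounds. A maximal independent set (MIS) is an independent set not properly contained in any other independent set. "With high probability" means with probability at least $1-1/n^c$ for an arbitrarily large fixed constant $c$. *)

theory Defs
  imports "HOL-Probability.Probability"
begin

text \<open>A finite simple graph: vertex set V of natural numbers (the vertex names
  double as the distinct processor IDs) and a symmetric irreflexive edge relation on V.\<close>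

definition simple_graph :: "nat set \<Rightarrow> (nat \<Rightarrow> nat \<Rightarrow> bool) \<Rightarrow> bool" where
  "simple_graph V E \<longleftrightarrow> finite V \<and> (\<forall>u v. E u v \<longrightarrow> u \<in> V \<and> v \<in> V)
     \<and> (\<forall>u v. E u v \<longrightarrow> E v u) \<and> (\<forall>v. \<not> E v v)"

definition neighbors :: "(nat \<Rightarrow> nat \<Rightarrow> bool) \<Rightarrow> nat \<Rightarrow> nat set" where
  "neighbors E v = {u. E v u}"

definition independent_set :: "nat set \<Rightarrow> (nat \<Rightarrow> nat \<Rightarrow> bool) \<Rightarrow> nat set \<Rightarrow> bool" where
  "independent_set V E I \<longleftrightarrow> I \<subseteq> V \<and> (\<forall>u\<in>I. \<forall>v\<in>I. \<not> E u v)"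

definition maximal_independent_set :: "nat set \<Rightarrow> (nat \<Rightarrow> nat \<Rightarrow> bool) \<Rightarrow> nat set \<Rightarrow> bool" where
  "maximal_independent_set V E I \<longleftrightarrow> independent_set V E I
     \<and> (\<forall>J. independent_set V E J \<and> I \<subseteq> J \<longrightarrow> J = I)"

text \<open>Local states and messages are finite bit strings (unbounded size).
  Each vertex has a private infinite random tape of fair coins (type nat \<Rightarrow> bool).
  Local computation is an arbitrary function.
  l_init N D id nbrs tape: initial state, given the known upper bounds N (on n) and
    D (on the maximum degree), the own ID and the IDs of the neighbours.
  l_send tape state u: message sent to neighbour with ID u.
  l_recv tape state msgs: new state, msgs u is the message received from neighbour u.
  l_out state: whether the vertex joins the output set.\<close>

record local_alg =
  l_init :: "nat \<Rightarrow> nat \<Rightarrow> nat \<Rightarrow> nat set \<Rightarrow> (nat \<Rightarrow> bool) \<Rightarrow> bool list"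
  l_send :: "(nat \<Rightarrow> bool) \<Rightarrow> bool list \<Rightarrow> nat \<Rightarrow> bool list"
  l_recv :: "(nat \<Rightarrow> bool) \<Rightarrow> bool list \<Rightarrow> (nat \<Rightarrow> bool list) \<Rightarrow> bool list"
  l_out  :: "bool list \<Rightarrow> bool"

primrec run_state ::
  "local_alg \<Rightarrow> nat \<Rightarrow> nat \<Rightarrow> (nat \<Rightarrow> nat \<Rightarrow> bool) \<Rightarrow> (nat \<Rightarrow> nat \<Rightarrow> bool) \<Rightarrow> nat \<Rightarrow> nat \<Rightarrow> bool list"
where
  "run_state A N D E \<omega> 0 = (\<lambda>v. l_init A N D v (neighbors E v) (\<omega> v))"
| "run_state A N D E \<omega> (Suc t) = (\<lambda>v. l_recv A (\<omega> v) (run_state A N D E \<omega> t v)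
      (\<lambda>u. if E v u then l_send A (\<omega> u) (run_state A N D E \<omega> t u) v else []))"

definition alg_output ::
  "local_alg \<Rightarrow> nat \<Rightarrow> nat \<Rightarrow> nat set \<Rightarrow> (nat \<Rightarrow> nat \<Rightarrow> bool) \<Rightarrow> nat \<Rightarrow> (nat \<Rightarrow> nat \<Rightarrow> bool) \<Rightarrow> nat set"
where
  "alg_output A N D V E t \<omega> = {v \<in> V. l_out A (run_state A N D E \<omega> t v)}"

definition coin_tape :: "(nat \<Rightarrow> bool) measure" where
  "coin_tape = PiM UNIV (\<lambda>_::nat. measure_pmf (bernoulli_pmf (1/2)))"

definition random_tapes :: "nat set \<Rightarrow> (nat \<Rightarrow> nat \<Rightarrow> bool) measure" where
  "random_tapes V = PiM V (\<lambda>_. coin_tape)"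

definition success_prob ::
  "local_alg \<Rightarrow> nat \<Rightarrow> nat \<Rightarrow> nat \<Rightarrow> nat set \<Rightarrow> (nat \<Rightarrow> nat \<Rightarrow> bool) \<Rightarrow> real" where
  "success_prob A N D t V E = measure (random_tapes V)
     {\<omega> \<in> space (random_tapes V). maximal_independent_set V E (alg_output A N D V E t \<omega>)}"

definition admissible :: "nat \<Rightarrow> nat \<Rightarrow> nat set \<Rightarrow> (nat \<Rightarrow> nat \<Rightarrow> bool) \<Rightarrow> bool" where
  "admissible N D V E \<longleftrightarrow> simple_graph V E \<and> card V \<le> N \<and> (\<forall>v\<in>V. card (neighbors E v) \<le> D)"

end

theory Submission
  imports Defs
begin

text \<open>Every undecided vertex \<open>v\<close> holds a desire level \<open>p = 1/2^j\<close>, is marked with probability \<open>p\<close>, and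
  joins the output if it is marked and no neighbour is; \<open>p\<close> is halved if the desire levels of the
  neighbours sum up to \<open>d \<ge> 2\<close>, and doubled (up to 1/2) otherwise (Ghaffari's algorithm). In
  expectation, the potential \<open>max(1, d)^\<alpha> * p^(-\<beta>)\<close> of an undecided vertex decays by a constant factor per
  round: \<open>p\<close> doubles, or \<open>d\<close> drops because most of it comes from neighbours with large \<open>d\<close>, or the round
  is ``golden'' and \<open>v\<close> is decided with constant probability. The events of one round at vertices of
  pairwise distance at least 5 are independent, so the decay multiplies over such sets of vertices.
  A union bound over lists of \<open>t\<close> such vertices, each at distance 5 from another one, shows that after
  \<open>T\<close> rounds the undecided components have weak radius at most \<open>5 t\<close> and at most \<open>t (\<Delta> + 1)^4\<close> vertices.

  For the first bound, \<open>T = O(log \<Delta> + sqrt(log n))\<close> and \<open>t = O(sqrt(log n))\<close> suffice, and each vertex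
  inspects its whole component. For the second bound, \<open>T = O(log log n)\<close> and \<open>t = O(log n)\<close> leave
  components of polylogarithmic size. There, random identifiers are turned into colours of
  \<open>O(log log n)\<close> bits by a code whose words agree in few positions, and a deterministic clustering by
  the bits of the colours (Rozhon and Ghaffari) keeps half of the vertices in pairwise non-adjacent
  clusters whose radius is polynomial in \<open>log log n\<close>. The clusters are solved by inspection, and
  \<open>O(log log n)\<close> repetitions decide every vertex.\<close>

subsection \<open>Balls\<close>

text \<open>The vertices of \<open>V\<close> are arbitrary naturals with no bound in terms of
  \<open>N\<close>, so their names are useless for a colour reduction; fresh identifiers of
  logarithmic length are drawn instead, and a collision among them becomes a second way to fail.
  Since messages are unbounded, an algorithm of \<open>r\<close> rounds amounts to a function of the
  radius-\<open>r\<close> ball. Rounds are therefore counted as radii of local functions, and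
  message passing and coin tapes have to be faced only once. The potential enters through its
  product over a separated set: such expectations compose over rounds as well as over vertices, so
  no concentration bound for the number of golden rounds is needed. The union bound fails with
  probability about \<open>N * q ^ t\<close>, where \<open>- ln q\<close> grows linearly in
  \<open>T\<close>; beyond what the degree costs, \<open>T\<close> and \<open>t\<close> can be
  traded against each other, and the balanced choice makes both of order sqrt(log N). In the second
  bound the deterministic part costs a fixed power of log log N, which exp(O(sqrt(log log N)))
  absorbs.\<close>

primrec nball :: "(nat \<Rightarrow> nat \<Rightarrow> bool) \<Rightarrow> nat \<Rightarrow> nat \<Rightarrow> nat set" where
  "nball E 0 v = {v}"
| "nball E (Suc r) v = insert v (\<Union>u\<in>{u. E v u}. nball E r u)"

lemma nball_self [simp, intro]: "v \<in> nball E r v"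
  by (cases r) auto

lemma nball_trans:
  "u \<in> nball E r v \<Longrightarrow> w \<in> nball E s u \<Longrightarrow> w \<in> nball E (r + s) v"
proof (induction r arbitrary: v)
  case 0
  then show ?case by simp
next
  case (Suc r)
  have aux: "w \<in> nball E s v \<Longrightarrow> w \<in> nball E (Suc (r + s)) v" for s v w
  proof (induction s arbitrary: v)
    case 0
    then show ?case by auto
  next
    case (Suc s)
    then show ?case by auto
  qed
  from Suc.prems(1) consider "u = v" | y where "E v y" "u \<in> nball E r y" by auto
  then show ?case
  proof cases
    case 1
    then show ?thesis using aux Suc.prems(2) by simp
  next
    case 2
    then show ?thesis using Suc.IH Suc.prems(2) by auto
  qed
qed

lemma nball_mono: "r \<le> s \<Longrightarrow> nball E r v \<subseteq> nball E s v"
  using nball_trans[of _ E r v _ "s - r"] by auto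

lemma nball_adj: "E v u \<Longrightarrow> u \<in> nball E (Suc 0) v"
  by simp

lemma nball_step: "u \<in> nball E r v \<Longrightarrow> E u w \<Longrightarrow> w \<in> nball E (Suc r) v"
  using nball_trans[of u E r v w 1] by simp

lemma nball_sym:
  assumes "\<And>u v. E u v \<Longrightarrow> E v u"
  shows "u \<in> nball E r v \<Longrightarrow> v \<in> nball E r u"
proof (induction r arbitrary: v)
  case 0
  then show ?case by simp
next
  case (Suc r)
  from Suc.prems consider "u = v" | y where "E v y" "u \<in> nball E r y" by auto
  then show ?case
  proof cases
    case 1
    then show ?thesis by simp
  next
    case 2
    then have "y \<in> nball E r u" "E y v" using Suc.IH assms by auto
    then show ?thesis by (rule nball_step)
  qed
qed

lemma nball_graph_mono:
  assumes "\<And>u v. E u v \<Longrightarrow> E' u v"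
  shows "nball E r v \<subseteq> nball E' r v"
proof (induction r arbitrary: v)
  case (Suc r)
  have "nball E (Suc r) v \<subseteq> insert v (\<Union>u\<in>{u. E v u}. nball E' r u)"
    using Suc.IH by fastforce
  also have "\<dots> \<subseteq> nball E' (Suc r) v" using assms by auto
  finally show ?case .
qed simp

text \<open>Exploring a ball reads only the adjacency rows of its own vertices; this is what makes
  definitions that mention balls local.\<close>

lemma nball_cong:
  "(\<And>u. u \<in> nball E r v \<Longrightarrow> E u = E' u) \<Longrightarrow> nball E r v = nball E' r v"
proof (induction r arbitrary: v)
  case 0
  then show ?case by simp
next
  case (Suc r)
  have "E v = E' v" using Suc.prems by blast
  moreover have "nball E r u = nball E' r u" if "E v u" for u
    using that by (intro Suc.IH Suc.prems) auto
  ultimately show ?case by auto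
qed

lemma finite_card_nball:
  assumes "\<And>v. finite {u. E v u}" "\<And>v. card {u. E v u} \<le> D"
  shows "finite (nball E r v) \<and> card (nball E r v) \<le> (D + 1) ^ r"
proof (induction r arbitrary: v)
  case 0
  then show ?case by simp
next
  case (Suc r)
  have "finite (nball E (Suc r) v)" using Suc assms by auto
  moreover have "card (nball E (Suc r) v) \<le> Suc (card (\<Union>u\<in>{u. E v u}. nball E r u))"
    by (simp add: card_insert_le_m1 card_insert_if Suc assms)
  moreover have "card (\<Union>u\<in>{u. E v u}. nball E r u) \<le> (\<Sum>u\<in>{u. E v u}. card (nball E r u))"
    by (rule card_UN_le) (use assms in auto)
  moreover have "\<dots> \<le> (\<Sum>u\<in>{u. E v u}. (D + 1) ^ r)" by (rule sum_mono) (use Suc in auto)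
  moreover have "\<dots> \<le> D * (D + 1) ^ r" using assms(2)[of v] by simp
  moreover have "Suc (D * (D + 1) ^ r) \<le> (D + 1) ^ Suc r" by simp
  ultimately show ?case by linarith
qed

lemma nball_subset_closed:
  assumes "\<And>u w. u \<in> C \<Longrightarrow> E u w \<Longrightarrow> w \<in> C"
  shows "v \<in> C \<Longrightarrow> nball E r v \<subseteq> C"
  by (induction r arbitrary: v) (use assms in auto)

subsection \<open>Induced subgraphs and partial solutions\<close>

definition induced :: "(nat \<Rightarrow> nat \<Rightarrow> bool) \<Rightarrow> nat set \<Rightarrow> nat \<Rightarrow> nat \<Rightarrow> bool" where
  "induced E U = (\<lambda>u v. E u v \<and> u \<in> U \<and> v \<in> U)"

text \<open>Maximality in the form of domination, which can be checked vertex by vertex and makes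
  sense on every subset \<open>U\<close>.\<close>

definition mis_on :: "(nat \<Rightarrow> nat \<Rightarrow> bool) \<Rightarrow> nat set \<Rightarrow> nat set \<Rightarrow> bool" where
  "mis_on E U I \<longleftrightarrow> I \<subseteq> U \<and> (\<forall>u\<in>I. \<forall>v\<in>I. \<not> E u v) \<and> (\<forall>v\<in>U - I. \<exists>u\<in>I. E v u)"

lemma mis_on_maximal:
  assumes "mis_on E V I"
  shows "maximal_independent_set V E I"
proof -
  have I: "I \<subseteq> V" "\<forall>u\<in>I. \<forall>v\<in>I. \<not> E u v" "\<And>v. v \<in> V - I \<Longrightarrow> \<exists>u\<in>I. E v u"
    using assms by (auto simp: mis_on_def)
  have "J = I" if J: "J \<subseteq> V" "\<forall>u\<in>J. \<forall>v\<in>J. \<not> E u v" "I \<subseteq> J" for J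
  proof -
    have "v \<in> I" if "v \<in> J" for v
      using I(3)[of v] that J by auto
    then show ?thesis using J(3) by auto
  qed
  then show ?thesis
    using I unfolding maximal_independent_set_def independent_set_def by auto
qed

lemma mis_on_exists:
  assumes "finite C" "\<And>u v. E u v \<Longrightarrow> E v u" "\<And>v. \<not> E v v"
  shows "\<exists>I. mis_on E C I"
  using assms(1)
proof (induction rule: finite_induct)
  case empty
  then show ?case by (auto simp: mis_on_def)
next
  case (insert x C)
  then obtain I where I: "mis_on E C I" by blast
  show ?case
  proof (cases "\<exists>u\<in>I. E x u")
    case True
    then show ?thesis using I by (intro exI[of _ I]) (auto simp: mis_on_def)
  next
    case False
    then show ?thesis using I assms(2,3)
      by (intro exI[of _ "insert x I"]) (auto simp: mis_on_def)
  qed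
qed

text \<open>The vertices of \<open>U\<close> are undecided, \<open>I\<close> is the part of the output computed so far.\<close>

definition partial_mis ::
  "nat set \<Rightarrow> (nat \<Rightarrow> nat \<Rightarrow> bool) \<Rightarrow> nat set \<Rightarrow> nat set \<Rightarrow> bool" where
  "partial_mis V E U I \<longleftrightarrow> U \<subseteq> V \<and> I \<subseteq> V - U \<and> (\<forall>u\<in>I. \<forall>v\<in>I \<union> U. \<not> E u v)
     \<and> (\<forall>v\<in>V - U - I. \<exists>u\<in>I. E v u)"

lemma partial_mis_init: "partial_mis V E V {}"
  by (auto simp: partial_mis_def)

lemma partial_mis_empty: "partial_mis V E {} I \<Longrightarrow> mis_on E V I"
  by (auto simp: partial_mis_def mis_on_def)

text \<open>The one way in which a partial output grows: marking rounds and clustering rounds both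
  add an independent set of undecided vertices and discard its neighbours.\<close>

lemma partial_mis_extend:
  assumes "partial_mis V E U I" "\<And>u v. E u v \<Longrightarrow> E v u"
    and "J \<subseteq> U" "\<forall>u\<in>J. \<forall>v\<in>J. \<not> E u v"
    and "U' = U - J - {v. \<exists>u\<in>J. E v u}"
  shows "partial_mis V E U' (I \<union> J)"
proof -
  have p: "U \<subseteq> V" "I \<subseteq> V - U" "\<And>u v. u \<in> I \<Longrightarrow> v \<in> I \<union> U \<Longrightarrow> \<not> E u v"
    "\<And>v. v \<in> V - U - I \<Longrightarrow> \<exists>u\<in>I. E v u"
    using assms(1) unfolding partial_mis_def by auto
  show ?thesis
    unfolding partial_mis_def
  proof (intro conjI ballI)
    show "U' \<subseteq> V" "I \<union> J \<subseteq> V - U'" using p(1,2) assms(3,5) by auto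
  next
    fix u v assume "u \<in> I \<union> J" "v \<in> I \<union> J \<union> U'"
    moreover have "\<not> E u v" if "u \<in> J" "v \<in> I" using p(3)[of v u] that assms(2,3) by auto
    moreover have "\<not> E u v" if "u \<in> J" "v \<in> U'" using that assms(2,5) by auto
    moreover have "\<not> E u v" if "u \<in> I" "v \<in> I \<union> J \<union> U'" using p(3)[of u v] that assms(3,5) by auto
    ultimately show "\<not> E u v" using assms(4) by blast
  next
    fix v assume v: "v \<in> V - U' - (I \<union> J)"
    show "\<exists>u\<in>I \<union> J. E v u"
    proof (cases "v \<in> U")
      case True
      then show ?thesis using v assms(2,5) by auto
    next
      case False
      then show ?thesis using v p(4)[of v] by auto
    qed
  qed
qed

lemma partial_mis_complete:
  assumes "partial_mis V E U I" "\<And>u v. E u v \<Longrightarrow> E v u" "mis_on E U J"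
  shows "mis_on E V (I \<union> J)"
proof -
  have p: "U \<subseteq> V" "I \<subseteq> V - U" "\<And>u v. u \<in> I \<Longrightarrow> v \<in> I \<union> U \<Longrightarrow> \<not> E u v"
    "\<And>v. v \<in> V - U - I \<Longrightarrow> \<exists>u\<in>I. E v u"
    using assms(1) unfolding partial_mis_def by auto
  have J: "J \<subseteq> U" "\<And>u v. u \<in> J \<Longrightarrow> v \<in> J \<Longrightarrow> \<not> E u v" "\<And>v. v \<in> U - J \<Longrightarrow> \<exists>u\<in>J. E v u"
    using assms(3) unfolding mis_on_def by auto
  show ?thesis
    unfolding mis_on_def
  proof (intro conjI ballI)
    show "I \<union> J \<subseteq> V" using p J by auto
  next
    fix u v assume "u \<in> I \<union> J" "v \<in> I \<union> J"
    then show "\<not> E u v" using p(3)[of u v] p(3)[of v u] J(1) J(2)[of u v] assms(2)[of u v] by auto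
  next
    fix v assume "v \<in> V - (I \<union> J)"
    then show "\<exists>u\<in>I \<union> J. E v u" using p(4)[of v] J(3)[of v] by auto
  qed
qed

subsection \<open>Solving components by inspection\<close>

text \<open>What \<open>v\<close> can see of its component of \<open>U\<close>; this is the whole
  component as soon as that fits into the ball.\<close>

definition local_comp :: "nat \<Rightarrow> (nat \<Rightarrow> nat \<Rightarrow> bool) \<Rightarrow> nat set \<Rightarrow> nat \<Rightarrow> nat set" where
  "local_comp R E U v = {w. (induced E (U \<inter> nball E R v))\<^sup>*\<^sup>* v w}"

text \<open>The choice is a function of the induced graph and its vertex set, so all vertices of a
  component pick the same set without any agreement protocol.\<close>

definition choose_mis :: "(nat \<Rightarrow> nat \<Rightarrow> bool) \<Rightarrow> nat set \<Rightarrow> nat set" where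
  "choose_mis E C = (SOME I. mis_on (induced E C) C I)"

definition solve_comps :: "nat \<Rightarrow> (nat \<Rightarrow> nat \<Rightarrow> bool) \<Rightarrow> nat set \<Rightarrow> nat \<Rightarrow> bool" where
  "solve_comps R E U v \<longleftrightarrow> v \<in> U \<and> v \<in> choose_mis E (local_comp R E U v)"

lemma induced_rtranclp_in: "(induced E U)\<^sup>*\<^sup>* v w \<Longrightarrow> v \<in> U \<Longrightarrow> w \<in> U"
  by (induction rule: rtranclp_induct) (auto simp: induced_def)

lemma solve_comps_correct:
  assumes sym: "\<And>u v. E u v \<Longrightarrow> E v u" and irr: "\<And>v. \<not> E v v"
    and fin: "finite U"
    and rad: "\<And>v w. v \<in> U \<Longrightarrow> (induced E U)\<^sup>*\<^sup>* v w \<Longrightarrow> w \<in> nball E R v"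
  shows "mis_on E U {v. solve_comps R E U v}"
proof -
  define G where "G = induced E U"
  define C where "C = (\<lambda>v. {w. G\<^sup>*\<^sup>* v w})"
  have Gsym: "G u v \<Longrightarrow> G v u" for u v using sym by (auto simp: G_def induced_def)
  have Gsym': "symp (G\<^sup>*\<^sup>*)" by (meson Gsym symp_rtranclp sympI)
  have lc: "local_comp R E U v = C v" if v: "v \<in> U" for v
  proof -
    have "(induced E (U \<inter> nball E R v))\<^sup>*\<^sup>* v w" if "G\<^sup>*\<^sup>* v w" for w
      using that
    proof (induction rule: rtranclp_induct)
      case base
      then show ?case by simp
    next
      case (step y z)
      have "y \<in> nball E R v" "z \<in> nball E R v"
        using rad[OF v] step(1,2) by (auto simp: G_def intro: rtranclp.rtrancl_into_rtrancl)
      then show ?case using step by (auto simp: G_def induced_def intro: rtranclp.rtrancl_into_rtrancl)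
    qed
    moreover have "G\<^sup>*\<^sup>* v w" if "(induced E (U \<inter> nball E R v))\<^sup>*\<^sup>* v w" for w
      using that by (rule rtranclp_mono[THEN predicate2D, rotated]) (auto simp: G_def induced_def)
    ultimately show ?thesis by (auto simp: local_comp_def C_def)
  qed
  have CU: "v \<in> U \<Longrightarrow> C v \<subseteq> U" for v
    using induced_rtranclp_in by (auto simp: C_def G_def)
  have Ceq: "C w = C v" if "w \<in> C v" for v w
    using that Gsym' unfolding C_def by (auto dest: sympD intro: rtranclp_trans)
  have ch: "mis_on (induced E (C v)) (C v) (choose_mis E (C v))" if "v \<in> U" for v
    unfolding choose_mis_def
    by (rule someI_ex, rule mis_on_exists)
       (use CU[OF that] fin sym irr in \<open>auto simp: induced_def intro: finite_subset\<close>)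
  have I: "solve_comps R E U v \<longleftrightarrow> v \<in> U \<and> v \<in> choose_mis E (C v)" for v
    using lc by (auto simp: solve_comps_def)
  show ?thesis
    unfolding mis_on_def
  proof (intro conjI ballI)
    show "{v. solve_comps R E U v} \<subseteq> U" using I by auto
  next
    fix u v assume "u \<in> {v. solve_comps R E U v}" "v \<in> {v. solve_comps R E U v}"
    then have u: "u \<in> U" "u \<in> choose_mis E (C u)" and v: "v \<in> U" "v \<in> choose_mis E (C v)"
      using I by auto
    show "\<not> E u v"
    proof
      assume "E u v"
      then have "v \<in> C u" using u v by (auto simp: C_def G_def induced_def)
      then have "C v = C u" by (rule Ceq)
      then have "\<not> induced E (C u) u v" using ch[OF u(1)] u v by (auto simp: mis_on_def)
      moreover have "u \<in> C u" by (simp add: C_def)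
      ultimately show False using \<open>E u v\<close> \<open>v \<in> C u\<close> by (auto simp: induced_def)
    qed
  next
    fix v assume "v \<in> U - {v. solve_comps R E U v}"
    then have v: "v \<in> U" "v \<notin> choose_mis E (C v)" using I by auto
    have "v \<in> C v" by (simp add: C_def)
    moreover have "\<forall>w\<in>C v - choose_mis E (C v). \<exists>u\<in>choose_mis E (C v). induced E (C v) w u"
      using ch[OF v(1)] by (simp add: mis_on_def)
    ultimately obtain u where u: "u \<in> choose_mis E (C v)" "induced E (C v) v u"
      using v(2) by blast
    then have "u \<in> C v" by (auto simp: induced_def)
    then have "C u = C v" by (rule Ceq)
    then have "solve_comps R E U u" using I u \<open>u \<in> C v\<close> CU[OF v(1)] by auto
    then show "\<exists>u\<in>{v. solve_comps R E U v}. E v u" using u by (auto simp: induced_def)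
  qed
qed

subsection \<open>Locality\<close>

text \<open>An algorithm of \<open>r\<close> rounds without its message passing. Comparing two
  instances on a ball, instead of describing a computation, lets composition of algorithms become
  addition of radii.\<close>

definition is_local ::
  "nat \<Rightarrow> ((nat \<Rightarrow> nat \<Rightarrow> bool) \<Rightarrow> (nat \<Rightarrow> 'i) \<Rightarrow> nat \<Rightarrow> 'o) \<Rightarrow> bool" where
  "is_local r F \<longleftrightarrow> (\<forall>E E' x x' v. (\<forall>u\<in>nball E r v. E u = E' u \<and> x u = x' u)
      \<longrightarrow> F E x v = F E' x' v)"

lemma is_localI:
  "(\<And>E E' x x' v. (\<And>u. u \<in> nball E r v \<Longrightarrow> E u = E' u) \<Longrightarrow>
      (\<And>u. u \<in> nball E r v \<Longrightarrow> x u = x' u) \<Longrightarrow> F E x v = F E' x' v) \<Longrightarrow> is_local r F"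
  unfolding is_local_def by blast

lemma is_localD:
  "is_local r F \<Longrightarrow> (\<And>u. u \<in> nball E r v \<Longrightarrow> E u = E' u) \<Longrightarrow>
      (\<And>u. u \<in> nball E r v \<Longrightarrow> x u = x' u) \<Longrightarrow> F E x v = F E' x' v"
  unfolding is_local_def by blast

lemma is_local_mono: "is_local r F \<Longrightarrow> r \<le> s \<Longrightarrow> is_local s F"
  by (rule is_localI, erule is_localD) (meson nball_mono subsetD)+

lemma is_local_pointwise: "is_local 0 (\<lambda>E x v. f v (x v))"
  by (rule is_localI) auto

lemma is_local_comp:
  assumes "is_local r F" "is_local s G"
  shows "is_local (r + s) (\<lambda>E x. G E (F E x))"
proof (rule is_localI)
  fix E E' :: "nat \<Rightarrow> nat \<Rightarrow> bool" and x x' :: "nat \<Rightarrow> 'a" and v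
  assume *: "\<And>u. u \<in> nball E (r + s) v \<Longrightarrow> E u = E' u" "\<And>u. u \<in> nball E (r + s) v \<Longrightarrow> x u = x' u"
  have sub: "w \<in> nball E (r + s) v" if "u \<in> nball E s v" "w \<in> nball E r u" for u w
    using nball_trans[OF that] by (simp add: add.commute)
  have "F E x u = F E' x' u" if "u \<in> nball E s v" for u
    by (rule is_localD[OF assms(1)]) (use * sub that in auto)
  moreover have "E u = E' u" if "u \<in> nball E s v" for u
    using * sub that by auto
  ultimately show "G E (F E x) v = G E' (F E' x') v"
    by (intro is_localD[OF assms(2)])
qed

lemma is_local_app:
  assumes "is_local r F" "is_local r G"
  shows "is_local r (\<lambda>E x v. h (F E x v) (G E x v))"
proof (rule is_localI)
  fix E E' :: "nat \<Rightarrow> nat \<Rightarrow> bool" and x x' :: "nat \<Rightarrow> 'a" and v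
  assume *: "\<And>u. u \<in> nball E r v \<Longrightarrow> E u = E' u" "\<And>u. u \<in> nball E r v \<Longrightarrow> x u = x' u"
  have "F E x v = F E' x' v" "G E x v = G E' x' v"
    by (rule is_localD[OF assms(1)] is_localD[OF assms(2)]; fact *)+
  then show "h (F E x v) (G E x v) = h (F E' x' v) (G E' x' v)" by simp
qed

lemma is_local_funpow:
  fixes F :: "(nat \<Rightarrow> nat \<Rightarrow> bool) \<Rightarrow> (nat \<Rightarrow> 'i) \<Rightarrow> nat \<Rightarrow> 'i"
  assumes "is_local r F"
  shows "is_local (n * r) (\<lambda>E x. (F E ^^ n) x)"
proof (induction n)
  case 0
  show ?case by (rule is_localI) simp
next
  case (Suc n)
  have "is_local (n * r + r) (\<lambda>E x. F E ((F E ^^ n) x))"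
    by (rule is_local_comp[OF Suc assms])
  then show ?case by (simp add: add.commute)
qed

text \<open>Balls of the induced graph are no larger than those of \<open>E\<close>, but its rows
  also ask whether the neighbours satisfy \<open>P\<close>; this accounts for the one extra
  step.\<close>

lemma is_local_induced:
  assumes "is_local r F"
  shows "is_local (Suc r) (\<lambda>E x. F (induced E {u. P (x u)}) x)"
proof (rule is_localI)
  fix E E' :: "nat \<Rightarrow> nat \<Rightarrow> bool" and x x' :: "nat \<Rightarrow> 'a" and v
  assume *: "\<And>u. u \<in> nball E (Suc r) v \<Longrightarrow> E u = E' u" "\<And>u. u \<in> nball E (Suc r) v \<Longrightarrow> x u = x' u"
  have sub: "nball (induced E {u. P (x u)}) r v \<subseteq> nball E r v"
    by (rule nball_graph_mono) (auto simp: induced_def)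
  have m: "nball E r v \<subseteq> nball E (Suc r) v" by (rule nball_mono) simp
  show "F (induced E {u. P (x u)}) x v = F (induced E' {u. P (x' u)}) x' v"
  proof (rule is_localD[OF assms])
    fix u assume "u \<in> nball (induced E {u. P (x u)}) r v"
    then have u: "u \<in> nball E r v" using sub by auto
    then show "x u = x' u" using * m by blast
    have "E u = E' u" using u * m by blast
    moreover have "x w = x' w" if "E u w" for w using nball_step[OF u that] * by auto
    ultimately show "induced E {u. P (x u)} u = induced E' {u. P (x' u)} u"
      using \<open>x u = x' u\<close> by (auto simp: induced_def fun_eq_iff)
  qed
qed

text \<open>No extra step is needed here: edges inside the visible component only involve rows and
  inputs of vertices of the ball.\<close>

lemma is_local_solve_comps: "is_local R (\<lambda>E x. solve_comps R E {u. P (x u)})"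
proof (rule is_localI)
  fix E E' :: "nat \<Rightarrow> nat \<Rightarrow> bool" and x x' :: "nat \<Rightarrow> 'a" and v
  assume *: "\<And>u. u \<in> nball E R v \<Longrightarrow> E u = E' u" "\<And>u. u \<in> nball E R v \<Longrightarrow> x u = x' u"
  define B where "B = nball E R v"
  have B': "nball E' R v = B" using nball_cong[of E R v E'] * by (simp add: B_def)
  have "{u. P (x u)} \<inter> B = {u. P (x' u)} \<inter> B" using * by (auto simp: B_def)
  moreover have "induced E ({u. P (x u)} \<inter> B) = induced E' ({u. P (x u)} \<inter> B)"
    using * by (auto simp: B_def induced_def fun_eq_iff)
  ultimately have lc: "local_comp R E {u. P (x u)} v = local_comp R E' {u. P (x' u)} v"
    unfolding local_comp_def B' B_def[symmetric] by simp
  let ?C = "local_comp R E {u. P (x u)} v"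
  show "solve_comps R E {u. P (x u)} v = solve_comps R E' {u. P (x' u)} v"
  proof (cases "P (x v)")
    case False
    then show ?thesis using *(2)[of v] by (auto simp: solve_comps_def)
  next
    case True
    have "w \<in> B" if "w \<in> ?C" for w
      using that[unfolded local_comp_def, simplified] induced_rtranclp_in[of E _ v w] True
      by (fastforce simp: B_def)
    then have "induced E ?C = induced E' ?C" using * by (auto simp: B_def induced_def fun_eq_iff)
    then have "choose_mis E ?C = choose_mis E' ?C" by (simp add: choose_mis_def)
    then show ?thesis using lc *(2)[of v] by (auto simp: solve_comps_def)
  qed
qed

subsection \<open>Local functions are computed by message passing\<close>

text \<open>States must be bit strings; their length is unrestricted, so a unary code suffices and
  decoding is \<open>length\<close>.\<close>

definition enc_state :: "'a::countable \<Rightarrow> bool list" where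
  "enc_state x = replicate (to_nat x) True"

definition dec_state :: "bool list \<Rightarrow> 'a::countable" where
  "dec_state bs = from_nat (length bs)"

lemma dec_enc [simp]: "dec_state (enc_state x) = x"
  by (simp add: enc_state_def dec_state_def)

text \<open>Each entry records a vertex, its neighbour list and its random input. The full state
  adds the two bounds, the own identifier and the own neighbours.\<close>

type_synonym 'i knowledge = "(nat \<times> nat list \<times> 'i) list"
type_synonym 'i lstate = "nat \<times> nat \<times> nat \<times> nat list \<times> 'i knowledge"

definition know :: "bool list \<Rightarrow> ('i::countable) knowledge" where
  "know bs = (case (dec_state bs :: 'i lstate) of (N, D, v, nb, K) \<Rightarrow> K)"

definition known_graph :: "'i knowledge \<Rightarrow> nat \<Rightarrow> nat \<Rightarrow> bool" where
  "known_graph K u w \<longleftrightarrow> (\<exists>nb y. (u, nb, y) \<in> set K \<and> w \<in> set nb)"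

definition known_input :: "'i knowledge \<Rightarrow> nat \<Rightarrow> 'i" where
  "known_input K u = (SOME y. \<exists>nb. (u, nb, y) \<in> set K)"

text \<open>Flooding: every round, each vertex forwards all it knows. The tape is read only in
  \<open>l_init\<close>, where \<open>\<sigma>\<close> turns it into the random input; the local
  function is evaluated at the very end.\<close>

definition gather_alg ::
  "(nat \<Rightarrow> nat \<Rightarrow> (nat \<Rightarrow> bool) \<Rightarrow> 'i::countable) \<Rightarrow>
   (nat \<Rightarrow> nat \<Rightarrow> (nat \<Rightarrow> nat \<Rightarrow> bool) \<Rightarrow> (nat \<Rightarrow> 'i) \<Rightarrow> nat \<Rightarrow> bool) \<Rightarrow> local_alg" where
  "gather_alg \<sigma> F = \<lparr>
     l_init = (\<lambda>N D v nb \<tau>. enc_state ((N, D, v, sorted_list_of_set nb,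
                 [(v, sorted_list_of_set nb, \<sigma> N D \<tau>)]) :: 'i lstate)),
     l_send = (\<lambda>\<tau> st u. st),
     l_recv = (\<lambda>\<tau> st m. case (dec_state st :: 'i lstate) of (N, D, v, nb, K) \<Rightarrow>
                 enc_state ((N, D, v, nb, K @ concat (map (\<lambda>u. know (m u)) nb)) :: 'i lstate)),
     l_out = (\<lambda>st. case (dec_state st :: 'i lstate) of (N, D, v, nb, K) \<Rightarrow>
                 F N D (known_graph K) (known_input K) v) \<rparr>"

lemma gather_alg_simps:
  fixes \<sigma> :: "nat \<Rightarrow> nat \<Rightarrow> (nat \<Rightarrow> bool) \<Rightarrow> 'i::countable"
  shows "l_init (gather_alg \<sigma> F) N D v nb \<tau> = enc_state (N, D, v, sorted_list_of_set nb,
                 [(v, sorted_list_of_set nb, \<sigma> N D \<tau>)])"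
    and "l_send (gather_alg \<sigma> F) \<tau> st u = st"
    and "l_recv (gather_alg \<sigma> F) \<tau> (enc_state ((N, D, v, ns, K) :: 'i lstate)) m =
           enc_state (N, D, v, ns, K @ concat (map (\<lambda>u. know (m u)) ns))"
    and "l_out (gather_alg \<sigma> F) (enc_state ((N, D, v, ns, K) :: 'i lstate)) =
           F N D (known_graph K) (known_input K) v"
  by (simp_all add: gather_alg_def)

lemma know_enc [simp]: "know (enc_state ((N, D, v, nb, K) :: ('i::countable) lstate)) = K"
  by (simp add: know_def)

text \<open>The ball of radius \<open>t + 1\<close> is the union of the balls of radius
  \<open>t\<close> around \<open>v\<close> and its neighbours. The list may hold duplicates, so only
  its set is tracked.\<close>

lemma run_gather_alg:
  fixes \<sigma> :: "nat \<Rightarrow> nat \<Rightarrow> (nat \<Rightarrow> bool) \<Rightarrow> 'i::countable"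
  assumes fin: "\<And>v. finite (neighbors E v)"
  shows "\<exists>K :: 'i knowledge.
    run_state (gather_alg \<sigma> F) N D E \<omega> t v
      = enc_state (N, D, v, sorted_list_of_set (neighbors E v), K)
    \<and> set K = (\<lambda>u. (u, sorted_list_of_set (neighbors E u), \<sigma> N D (\<omega> u))) ` nball E t v"
proof (induction t arbitrary: v)
  case 0
  show ?case
    by (intro exI[of _ "[(v, sorted_list_of_set (neighbors E v), \<sigma> N D (\<omega> v))]"])
       (simp add: gather_alg_simps)
next
  case (Suc t)
  let ?info = "\<lambda>u. (u, sorted_list_of_set (neighbors E u), \<sigma> N D (\<omega> u))"
  obtain K :: "nat \<Rightarrow> 'i knowledge" where K:
    "\<And>v. run_state (gather_alg \<sigma> F) N D E \<omega> t v
        = enc_state (N, D, v, sorted_list_of_set (neighbors E v), K v)"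
    "\<And>v. set (K v) = ?info ` nball E t v"
  proof -
    have "\<exists>K :: nat \<Rightarrow> 'i knowledge. \<forall>v. run_state (gather_alg \<sigma> F) N D E \<omega> t v
        = enc_state (N, D, v, sorted_list_of_set (neighbors E v), K v) \<and>
        set (K v) = ?info ` nball E t v"
      by (rule choice) (rule allI, rule Suc.IH)
    then show ?thesis using that by blast
  qed
  let ?K = "K v @ concat (map K (sorted_list_of_set (neighbors E v)))"
  have "run_state (gather_alg \<sigma> F) N D E \<omega> (Suc t) v
      = enc_state (N, D, v, sorted_list_of_set (neighbors E v), ?K)"
  proof -
    have "map (\<lambda>u. know (if E v u then run_state (gather_alg \<sigma> F) N D E \<omega> t u else []))
            (sorted_list_of_set (neighbors E v))
        = map K (sorted_list_of_set (neighbors E v))"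
    proof (rule map_cong[OF refl])
      fix u assume "u \<in> set (sorted_list_of_set (neighbors E v))"
      then have "E v u" using fin[of v] by (simp add: neighbors_def)
      then show "know (if E v u then run_state (gather_alg \<sigma> F) N D E \<omega> t u else []) = K u"
        by (simp add: K(1))
    qed
    then show ?thesis
      by (simp only: run_state.simps K(1)[of v] gather_alg_simps)
  qed
  moreover have "set ?K = ?info ` nball E (Suc t) v"
  proof -
    have "set ?K = ?info ` (nball E t v \<union> (\<Union>u\<in>neighbors E v. nball E t u))"
      using fin[of v] by (simp add: K(2) image_Un image_UN)
    also have "nball E t v \<union> (\<Union>u\<in>neighbors E v. nball E t u) = nball E (Suc t) v"
      using nball_mono[of t "Suc t" E v] by (auto simp: neighbors_def)
    finally show ?thesis .
  qed
  ultimately show ?case by blast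
qed

text \<open>The graph rebuilt from the collected entries has the rows of \<open>E\<close> at all
  vertices of the ball, and a local function reads nothing else.\<close>

lemma alg_output_gather:
  fixes \<sigma> :: "nat \<Rightarrow> nat \<Rightarrow> (nat \<Rightarrow> bool) \<Rightarrow> 'i::countable"
  assumes fin: "\<And>v. finite (neighbors E v)" and loc: "is_local t (F N D)"
  shows "alg_output (gather_alg \<sigma> F) N D V E t \<omega> = {v \<in> V. F N D E (\<lambda>u. \<sigma> N D (\<omega> u)) v}"
proof -
  have "l_out (gather_alg \<sigma> F) (run_state (gather_alg \<sigma> F) N D E \<omega> t v)
      = F N D E (\<lambda>u. \<sigma> N D (\<omega> u)) v" for v
  proof -
    obtain K :: "'i knowledge" where K:
      "run_state (gather_alg \<sigma> F) N D E \<omega> t v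
        = enc_state (N, D, v, sorted_list_of_set (neighbors E v), K)"
      "set K = (\<lambda>u. (u, sorted_list_of_set (neighbors E u), \<sigma> N D (\<omega> u))) ` nball E t v"
      using run_gather_alg[OF fin] by blast
    have "F N D E (\<lambda>u. \<sigma> N D (\<omega> u)) v = F N D (known_graph K) (known_input K) v"
    proof (rule is_localD[OF loc])
      fix u assume u: "u \<in> nball E t v"
      have "known_graph K u w = E u w" for w
      proof -
        have "w \<in> set (sorted_list_of_set (neighbors E u)) \<longleftrightarrow> E u w"
          using fin[of u] by (simp add: neighbors_def)
        then show ?thesis using u unfolding known_graph_def K(2) by fastforce
      qed
      then show "E u = known_graph K u" by auto
      have "(\<exists>nb. (u, nb, y) \<in> set K) \<longleftrightarrow> y = \<sigma> N D (\<omega> u)" for y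
        using u unfolding K(2) by auto
      then show "\<sigma> N D (\<omega> u) = known_input K u" by (simp add: known_input_def)
    qed
    then show ?thesis using K(1) by (simp add: gather_alg_simps)
  qed
  then show ?thesis by (simp add: alg_output_def)
qed

subsection \<open>Random inputs generated from coin tapes\<close>

abbreviation coin :: "bool pmf" where "coin \<equiv> bernoulli_pmf (1/2)"

definition coin_prefix :: "nat \<Rightarrow> (nat \<Rightarrow> bool) \<Rightarrow> bool list" where
  "coin_prefix n \<tau> = map \<tau> [0..<n]"

lemma coin_prefix_eq_iff: "coin_prefix n \<tau> = xs \<longleftrightarrow> length xs = n \<and> (\<forall>i\<in>{..<n}. \<tau> i \<in> {xs ! i})"
  by (auto simp: coin_prefix_def list_eq_iff_nth_eq)

lemma replicate_pmf_Suc_pair: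
  "replicate_pmf (Suc n) p = map_pmf (\<lambda>(x, xs). x # xs) (pair_pmf p (replicate_pmf n p))"
  by (simp add: pair_pmf_def map_pmf_def bind_assoc_pmf bind_return_pmf)

lemma pmf_replicate_coin: "length xs = n \<Longrightarrow> pmf (replicate_pmf n coin) xs = (1/2) ^ n"
proof (induction n arbitrary: xs)
  case 0
  then show ?case by simp
next
  case (Suc n)
  then obtain y ys where xs: "xs = y # ys" "length ys = n" by (cases xs) auto
  have "pmf (replicate_pmf (Suc n) coin) xs
      = pmf (map_pmf (\<lambda>(x, xs). x # xs) (pair_pmf coin (replicate_pmf n coin)))
          ((\<lambda>(x, xs). x # xs) (y, ys))"
    by (simp only: replicate_pmf_Suc_pair xs prod.case)
  also have "\<dots> = pmf (pair_pmf coin (replicate_pmf n coin)) (y, ys)"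
    by (rule pmf_map_inj') (auto simp: inj_def)
  also have "\<dots> = (1/2) ^ Suc n" using Suc.IH[OF xs(2)] by (cases y) (simp_all add: pmf_pair)
  finally show ?case .
qed

lemma prob_space_coin_tape: "prob_space coin_tape"
  unfolding coin_tape_def by (intro prob_space_PiM) (simp add: prob_space_measure_pmf)

lemma prefix_cylinder:
  assumes "length xs = n"
  shows "{\<tau> \<in> space coin_tape. coin_prefix n \<tau> = xs} \<in> sets coin_tape"
    and "measure coin_tape {\<tau> \<in> space coin_tape. coin_prefix n \<tau> = xs} = (1/2) ^ n"
proof -
  interpret product_prob_space "\<lambda>_::nat. measure_pmf coin" UNIV
    by standard
  let ?A = "{\<tau> \<in> space coin_tape. \<forall>i\<in>{..<n}. \<tau> i \<in> {xs ! i}}"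
  have eq: "{\<tau> \<in> space coin_tape. coin_prefix n \<tau> = xs} = ?A"
    using assms by (auto simp: coin_prefix_eq_iff)
  have "?A = prod_emb UNIV (\<lambda>_. measure_pmf coin) {..<n} (\<Pi>\<^sub>E i\<in>{..<n}. {xs ! i})"
    unfolding coin_tape_def 
    by (subst prod_emb_PiE) (auto simp: space_PiM PiE_iff, (metis (full_types) singletonD)+)
  moreover have "prod_emb UNIV (\<lambda>_. measure_pmf coin) {..<n} (\<Pi>\<^sub>E i\<in>{..<n}. {xs ! i}) \<in> sets coin_tape"
    unfolding coin_tape_def by (intro sets_PiM_I) auto
  ultimately show "{\<tau> \<in> space coin_tape. coin_prefix n \<tau> = xs} \<in> sets coin_tape" using eq by simp
  have "emeasure coin_tape ?A = (\<Prod>i\<in>{..<n}. emeasure (measure_pmf coin) {xs ! i})"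
    unfolding coin_tape_def by (rule emeasure_PiM_Collect) auto
  also have "\<dots> = (\<Prod>i\<in>{..<n}. ennreal (1/2))"
  proof (intro prod.cong refl)
    fix i show "emeasure (measure_pmf coin) {xs ! i} = ennreal (1/2)"
      by (cases "xs ! i") (simp_all add: emeasure_pmf_single)
  qed
  also have "\<dots> = ennreal ((1/2) ^ n)" by (subst prod_ennreal) simp_all
  finally show "measure coin_tape {\<tau> \<in> space coin_tape. coin_prefix n \<tau> = xs} = (1/2) ^ n"
    unfolding eq by (simp add: measure_def)
qed

text \<open>The value outside \<open>V\<close> is the default value of the \<open>Pi_pmf\<close> to
  which these prefixes are compared.\<close>

definition prefixes :: "nat set \<Rightarrow> nat \<Rightarrow> (nat \<Rightarrow> nat \<Rightarrow> bool) \<Rightarrow> nat \<Rightarrow> bool list" where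
  "prefixes V n \<omega> = (\<lambda>v. if v \<in> V then coin_prefix n (\<omega> v) else replicate n False)"

text \<open>Passage from the infinite tapes to discrete distributions: an event that reads
  \<open>n\<close> coins per vertex is a finite disjoint union of cylinders, whose measures are the
  point masses of the finite product.\<close>

lemma measure_random_tapes_prefixes:
  assumes V: "finite V"
  shows "measure (random_tapes V) {\<omega> \<in> space (random_tapes V). Q (prefixes V n \<omega>)}
      = measure_pmf.prob (Pi_pmf V (replicate n False) (\<lambda>_. replicate_pmf n coin)) {x. Q x}"
proof -
  define d where "d = replicate n False"
  define p where "p = Pi_pmf V d (\<lambda>_. replicate_pmf n coin)"
  define S where "S = PiE_dflt V d (\<lambda>_. {xs :: bool list. length xs = n})"
  define A where "A = (\<lambda>x. {\<omega> \<in> space (random_tapes V). \<forall>v\<in>V. \<omega> v \<in> {\<tau> \<in> space coin_tape. coin_prefix n \<tau> = x v}})"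
  interpret T: prob_space coin_tape by (rule prob_space_coin_tape)
  interpret P: product_prob_space "\<lambda>_::nat. coin_tape" V by standard
  interpret R: prob_space "random_tapes V" unfolding random_tapes_def
    by (rule prob_space_PiM) (rule prob_space_coin_tape)
  have finL: "finite {xs :: bool list. length xs = n}"
    using finite_lists_length_eq[of "UNIV :: bool set" n] by simp
  have finS: "finite S" unfolding S_def using V finL by blast
  have space: "\<omega> \<in> space (random_tapes V) \<Longrightarrow> v \<in> V \<Longrightarrow> \<omega> v \<in> space coin_tape" for \<omega> v
    by (auto simp: random_tapes_def space_PiM PiE_def)
  have A: "A x \<in> sets (random_tapes V)" "measure (random_tapes V) (A x) = pmf p x" if "x \<in> S" for x
  proof -
    have len: "length (x v) = n" if "v \<in> V" for v using \<open>x \<in> S\<close> that by (auto simp: S_def PiE_dflt_def)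
    have "A x = (\<Pi>\<^sub>E v\<in>V. {\<tau> \<in> space coin_tape. coin_prefix n \<tau> = x v})"
      unfolding A_def random_tapes_def by (auto simp: space_PiM PiE_iff extensional_def)
    moreover have "\<dots> \<in> sets (random_tapes V)"
      unfolding random_tapes_def by (intro sets_PiM_I_finite V prefix_cylinder(1) len)
    ultimately show "A x \<in> sets (random_tapes V)" by simp
    have "emeasure (random_tapes V) (A x)
        = (\<Prod>v\<in>V. emeasure coin_tape {\<tau> \<in> space coin_tape. coin_prefix n \<tau> = x v})"
      unfolding A_def random_tapes_def
      by (rule P.emeasure_PiM_Collect) (use V prefix_cylinder(1) len in auto)
    also have "\<dots> = (\<Prod>v\<in>V. ennreal ((1/2) ^ n))"
      by (intro prod.cong refl) (simp add: T.emeasure_eq_measure prefix_cylinder(2) len)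
    also have "\<dots> = ennreal ((\<Prod>v\<in>V. (1/2) ^ n))" by (rule prod_ennreal) simp
    also have "(\<Prod>v\<in>V. (1/2) ^ n) = (\<Prod>v\<in>V. pmf (replicate_pmf n coin) (x v))"
      by (intro prod.cong refl) (simp add: pmf_replicate_coin len)
    also have "\<dots> = pmf p x"
      unfolding p_def by (subst pmf_Pi'[OF V]) (use \<open>x \<in> S\<close> in \<open>auto simp: S_def PiE_dflt_def\<close>)
    finally show "measure (random_tapes V) (A x) = pmf p x" by (simp add: measure_def)
  qed
  have inA: "\<omega> \<in> A x \<longleftrightarrow> \<omega> \<in> space (random_tapes V) \<and> prefixes V n \<omega> = x" if "x \<in> S" for \<omega> x
    using that space unfolding A_def prefixes_def S_def PiE_dflt_def d_def by (auto simp: fun_eq_iff)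
  have pS: "prefixes V n \<omega> \<in> S" for \<omega>
    by (auto simp: prefixes_def S_def PiE_dflt_def d_def coin_prefix_def)
  have "{\<omega> \<in> space (random_tapes V). Q (prefixes V n \<omega>)} = (\<Union>x\<in>{x\<in>S. Q x}. A x)"
    using inA pS by auto
  moreover have "measure (random_tapes V) (\<Union>x\<in>{x\<in>S. Q x}. A x)
      = (\<Sum>x\<in>{x\<in>S. Q x}. measure (random_tapes V) (A x))"
    by (rule R.finite_measure_finite_Union)
       (use finS A(1) inA in \<open>auto simp: disjoint_family_on_def\<close>)
  moreover have "\<dots> = (\<Sum>x\<in>{x\<in>S. Q x}. pmf p x)" using A(2) by (intro sum.cong) auto
  moreover have "\<dots> = measure_pmf.prob p {x\<in>S. Q x}"
    by (rule measure_measure_pmf_finite[symmetric]) (use finS in auto)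
  moreover have "\<dots> = measure_pmf.prob p {x. Q x}"
  proof (rule measure_prob_cong_0)
    have "pmf p x = 0" if "x \<notin> S" for x
    proof -
      have "set_pmf p \<subseteq> S" unfolding p_def S_def
        by (subst set_Pi_pmf[OF V]) (auto simp: PiE_dflt_def set_replicate_pmf)
      then show ?thesis using that by (auto simp: set_pmf_iff)
    qed
    then show "\<And>x. x \<in> {x\<in>S. Q x} - {x. Q x} \<Longrightarrow> pmf p x = 0"
      "\<And>x. x \<in> {x. Q x} - {x\<in>S. Q x} \<Longrightarrow> pmf p x = 0" by auto
  qed
  ultimately show ?thesis by (simp add: p_def d_def)
qed

text \<open>\<open>P\<close> is sampled from \<open>n\<close> fair coins. The condition on the
  all-\<open>False\<close> string makes \<open>g\<close> respect the default values outside
  \<open>V\<close>, as the mapping rule for \<open>Pi_pmf\<close> demands.\<close>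

definition coin_gen :: "'i \<Rightarrow> 'i pmf \<Rightarrow> bool" where
  "coin_gen d P \<longleftrightarrow> (\<exists>n g. g (replicate n False) = d \<and> P = map_pmf g (replicate_pmf n coin))"

lemma coin_gen_map: "coin_gen d P \<Longrightarrow> coin_gen (f d) (map_pmf f P)"
  unfolding coin_gen_def by (metis map_pmf_comp)

lemma coin_gen_pair:
  assumes "coin_gen d P" "coin_gen e Q"
  shows "coin_gen (d, e) (pair_pmf P Q)"
proof -
  obtain n g where g: "g (replicate n False) = d" "P = map_pmf g (replicate_pmf n coin)"
    using assms(1) by (auto simp: coin_gen_def)
  obtain m h where h: "h (replicate m False) = e" "Q = map_pmf h (replicate_pmf m coin)"
    using assms(2) by (auto simp: coin_gen_def)
  let ?f = "\<lambda>xs. (g (take n xs), h (drop n xs))"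
  have "map_pmf ?f (replicate_pmf (n + m) coin)
      = replicate_pmf n coin \<bind> (\<lambda>xs. replicate_pmf m coin \<bind> (\<lambda>ys. return_pmf (?f (xs @ ys))))"
    by (simp add: replicate_pmf_distrib map_bind_pmf)
  also have "\<dots> = replicate_pmf n coin \<bind> (\<lambda>xs. replicate_pmf m coin \<bind> (\<lambda>ys. return_pmf (g xs, h ys)))"
    by (intro bind_pmf_cong refl) (auto simp: set_replicate_pmf)
  also have "\<dots> = pair_pmf P Q"
    by (simp add: g h pair_pmf_def map_pmf_def bind_assoc_pmf bind_return_pmf)
  finally show ?thesis
    unfolding coin_gen_def using g(1) h(1)
    by (intro exI[of _ "n + m"] exI[of _ ?f]) (simp add: replicate_add)
qed

lemma coin_gen_replicate:
  assumes "coin_gen d P"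
  shows "coin_gen (replicate n d) (replicate_pmf n P)"
proof (induction n)
  case 0
  show ?case unfolding coin_gen_def by (intro exI[of _ 0] exI[of _ "\<lambda>_. []"]) simp
next
  case (Suc n)
  show ?case
    using coin_gen_map[OF coin_gen_pair[OF assms Suc], of "\<lambda>(x, xs). x # xs"]
    by (simp only: replicate_pmf_Suc_pair prod.case replicate_Suc)
qed

lemma coin_gen_bits: "coin_gen (replicate n False) (replicate_pmf n coin)"
  unfolding coin_gen_def by (intro exI[of _ n] exI[of _ id]) (simp add: map_pmf_id)

text \<open>The interface between the model and the rest: it remains to exhibit a local function of
  independent random inputs and to bound its success probability. One \<open>local_alg\<close>
  serves all \<open>N\<close> and \<open>D\<close>, since they are arguments of its
  initialisation.\<close>

theorem local_computable:
  fixes P :: "nat \<Rightarrow> nat \<Rightarrow> ('i::countable) pmf"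
  assumes "\<And>N D. coin_gen (d N D) (P N D)" "\<And>N D. is_local (R N D) (F N D)"
  shows "\<exists>A. \<forall>N D V E. simple_graph V E \<longrightarrow> success_prob A N D (R N D) V E =
     measure_pmf.prob (Pi_pmf V (d N D) (\<lambda>_. P N D))
       {x. maximal_independent_set V E {v \<in> V. F N D E x v}}"
proof -
  have "\<exists>n g. \<forall>N D. g N D (replicate (n N D) False) = d N D \<and>
      P N D = map_pmf (g N D) (replicate_pmf (n N D) coin)"
    using assms(1) unfolding coin_gen_def by metis
  then obtain n g where ng: "\<And>N D. g N D (replicate (n N D) False) = d N D"
      "\<And>N D. P N D = map_pmf (g N D) (replicate_pmf (n N D) coin)" by blast
  let ?A = "gather_alg (\<lambda>N D \<tau>. g N D (coin_prefix (n N D) \<tau>)) F"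
  show ?thesis
  proof (rule exI[of _ ?A], intro allI impI)
    fix N D V E assume G: "simple_graph V E"
    have fin: "finite V" using G by (simp add: simple_graph_def)
    have nbr: "finite (neighbors E v)" for v
      by (rule finite_subset[OF _ fin]) (use G in \<open>auto simp: neighbors_def simple_graph_def\<close>)
    have "alg_output ?A N D V E (R N D) \<omega> = {v \<in> V. F N D E (\<lambda>u. g N D (prefixes V (n N D) \<omega> u)) v}" for \<omega>
    proof -
      have "F N D E (\<lambda>u. g N D (coin_prefix (n N D) (\<omega> u))) v
          = F N D E (\<lambda>u. g N D (prefixes V (n N D) \<omega> u)) v" if "v \<in> V" for v
      \<comment> \<open>Balls around vertices of \<open>V\<close> stay inside \<open>V\<close>, so
        default values are never read.\<close>
      proof (rule is_localD[OF assms(2)])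
        fix u assume "u \<in> nball E (R N D) v"
        then have "u \<in> V" using nball_subset_closed[of V E v] that G
          by (auto simp: simple_graph_def)
        then show "g N D (coin_prefix (n N D) (\<omega> u)) = g N D (prefixes V (n N D) \<omega> u)"
          by (simp add: prefixes_def)
      qed simp
      then show ?thesis by (subst alg_output_gather[OF nbr assms(2)]) auto
    qed
    then have "success_prob ?A N D (R N D) V E = measure (random_tapes V) {\<omega> \<in> space (random_tapes V).
        maximal_independent_set V E {v \<in> V. F N D E (\<lambda>u. g N D (prefixes V (n N D) \<omega> u)) v}}"
      by (simp add: success_prob_def)
    also have "\<dots> = measure_pmf.prob (Pi_pmf V (replicate (n N D) False) (\<lambda>_. replicate_pmf (n N D) coin))
        {x. maximal_independent_set V E {v \<in> V. F N D E (\<lambda>u. g N D (x u)) v}}"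
      by (rule measure_random_tapes_prefixes[OF fin])
    also have "\<dots> = measure_pmf.prob (Pi_pmf V (d N D) (\<lambda>_. P N D))
       {x. maximal_independent_set V E {v \<in> V. F N D E x v}}"
      by (subst ng(2), subst Pi_pmf_map[OF fin, where dflt = "replicate (n N D) False"])
         (simp_all add: ng(1) o_def vimage_def)
    finally show "success_prob ?A N D (R N D) V E = \<dots>" .
  qed
qed

subsection \<open>The geometric marking variable\<close>

definition lead :: "bool list \<Rightarrow> nat" where
  "lead xs = length (takeWhile id xs)"

text \<open>A truncated geometric variable. A vertex of level \<open>j\<close> is marked if its draw
  is at least \<open>j\<close>, which has probability exactly \<open>(1/2) ^ j\<close>; thus the
  distribution of the inputs does not depend on the state of the process.\<close>

definition geo :: "nat \<Rightarrow> nat pmf" where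
  "geo n = map_pmf lead (replicate_pmf n coin)"

lemma coin_gen_geo: "coin_gen 0 (geo n)"
proof -
  have "lead (replicate n False) = 0" by (cases n) (auto simp: lead_def)
  then show ?thesis unfolding geo_def using coin_gen_map[OF coin_gen_bits, of lead n] by simp
qed

lemma prob_geo: "j \<le> n \<Longrightarrow> measure_pmf.prob (geo n) {j..} = (1/2) ^ j"
proof (induction n arbitrary: j)
  case 0
  then show ?case by simp
next
  case (Suc n)
  show ?case
  proof (cases j)
    case 0
    then show ?thesis by simp
  next
    case (Suc i)
    have "geo (Suc n) = bind_pmf coin (\<lambda>x. map_pmf (\<lambda>xs. lead (x # xs)) (replicate_pmf n coin))"
      by (simp add: geo_def map_bind_pmf map_pmf_def bind_assoc_pmf bind_return_pmf)
    also have "\<dots> = bind_pmf coin (\<lambda>x. if x then map_pmf Suc (geo n) else return_pmf 0)"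
      by (intro bind_pmf_cong refl) (simp add: lead_def geo_def map_pmf_comp o_def map_pmf_const)
    finally have "emeasure (measure_pmf (geo (Suc n))) {j..}
        = ennreal (1/2) * emeasure (map_pmf Suc (geo n)) {j..} + ennreal (1/2) * emeasure (return_pmf 0) {j..}"
      by (simp add: emeasure_bind_pmf mult.commute)
    also have "emeasure (return_pmf (0::nat)) {j..} = 0" using Suc by simp
    also have "emeasure (map_pmf Suc (geo n)) {j..} = emeasure (geo n) {i..}"
      using Suc by (simp add: vimage_def atLeast_def)
    also have "\<dots> = ennreal ((1/2) ^ i)"
      using Suc.IH[of i] Suc.prems Suc by (simp add: measure_pmf.emeasure_eq_measure)
    also have "ennreal (1/2) * ennreal ((1/2) ^ i) + ennreal (1/2) * 0 = ennreal ((1/2) ^ j)"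
      using ennreal_mult[of "1/2" "(1/2) ^ i"] Suc by simp
    finally have "emeasure (measure_pmf (geo (Suc n))) {j..} = ennreal ((1/2) ^ j)" .
    then show ?thesis by (simp add: measure_def)
  qed
qed

subsection \<open>Independence for functions of disjoint coordinate sets\<close>

lemma nn_integral_Pi_pmf_indep:
  fixes f h :: "('a \<Rightarrow> 'b) \<Rightarrow> ennreal"
  assumes V: "finite V" and X: "X \<subseteq> V"
    and f: "\<And>g g'. (\<And>x. x \<in> X \<Longrightarrow> g x = g' x) \<Longrightarrow> f g = f g'"
    and h: "\<And>g g'. (\<And>x. x \<in> V - X \<Longrightarrow> g x = g' x) \<Longrightarrow> h g = h g'"
  shows "(\<integral>\<^sup>+g. f g * h g \<partial>Pi_pmf V d p) = (\<integral>\<^sup>+g. f g \<partial>Pi_pmf V d p) * (\<integral>\<^sup>+g. h g \<partial>Pi_pmf V d p)"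
proof -
  let ?A = "Pi_pmf X d p" and ?B = "Pi_pmf (V - X) d p"
  have P: "Pi_pmf V d p = map_pmf (\<lambda>(a, b) x. if x \<in> X then a x else b x) (pair_pmf ?A ?B)"
    using Pi_pmf_union[of X "V - X" d p] V X by (simp add: Un_absorb1 finite_subset)
  \<comment> \<open>Proved for all such pairs of functions, so that setting one of them to 1 also
    identifies the two integrals on the right-hand side.\<close>
  have fh: "(\<integral>\<^sup>+g. f g * h g \<partial>Pi_pmf V d p) = (\<integral>\<^sup>+a. f a \<partial>?A) * (\<integral>\<^sup>+b. h b \<partial>?B)"
    if f: "\<And>g g'. (\<And>x. x \<in> X \<Longrightarrow> g x = g' x) \<Longrightarrow> f g = f g'"
      and h: "\<And>g g'. (\<And>x. x \<in> V - X \<Longrightarrow> g x = g' x) \<Longrightarrow> h g = h g'"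
    for f h :: "('a \<Rightarrow> 'b) \<Rightarrow> ennreal"
  proof -
    have "f (\<lambda>x. if x \<in> X then a x else b x) = f a" "h (\<lambda>x. if x \<in> X then a x else b x) = h b" for a b
      by (rule f, simp) (rule h, simp)
    then show ?thesis
      unfolding P by (simp add: nn_integral_pair_pmf' nn_integral_cmult nn_integral_multc)
  qed
  show ?thesis
    using fh[where f = f and h = h, OF f h] fh[where f = f and h = "\<lambda>_. 1", OF f]
      fh[where f = "\<lambda>_. 1" and h = h, OF _ h] by simp
qed

lemma nn_integral_Pi_pmf_prod:
  fixes f :: "'i \<Rightarrow> ('a \<Rightarrow> 'b) \<Rightarrow> ennreal"
  assumes V: "finite V" and S: "finite S"
    and X: "\<And>i. i \<in> S \<Longrightarrow> X i \<subseteq> V" "\<And>i j. i \<in> S \<Longrightarrow> j \<in> S \<Longrightarrow> i \<noteq> j \<Longrightarrow> X i \<inter> X j = {}"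
    and f: "\<And>i g g'. i \<in> S \<Longrightarrow> (\<And>x. x \<in> X i \<Longrightarrow> g x = g' x) \<Longrightarrow> f i g = f i g'"
  shows "(\<integral>\<^sup>+g. (\<Prod>i\<in>S. f i g) \<partial>Pi_pmf V d p) = (\<Prod>i\<in>S. \<integral>\<^sup>+g. f i g \<partial>Pi_pmf V d p)"
  using S X f
proof (induction S rule: finite_induct)
  case empty
  then show ?case by simp
next
  case (insert i S)
  have "(\<integral>\<^sup>+g. (\<Prod>k\<in>insert i S. f k g) \<partial>Pi_pmf V d p)
      = (\<integral>\<^sup>+g. f i g * (\<Prod>k\<in>S. f k g) \<partial>Pi_pmf V d p)"
    by (simp add: insert.hyps)
  also have "\<dots> = (\<integral>\<^sup>+g. f i g \<partial>Pi_pmf V d p) * (\<integral>\<^sup>+g. (\<Prod>k\<in>S. f k g) \<partial>Pi_pmf V d p)"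
  proof (rule nn_integral_Pi_pmf_indep[OF V, of "X i"])
    show "X i \<subseteq> V" by (simp add: insert.prems(1))
    show "f i g = f i g'" if "\<And>x. x \<in> X i \<Longrightarrow> g x = g' x" for g g'
      by (rule insert.prems(3)) (use that in auto)
    show "(\<Prod>k\<in>S. f k g) = (\<Prod>k\<in>S. f k g')" if *: "\<And>x. x \<in> V - X i \<Longrightarrow> g x = g' x" for g g'
    proof (rule prod.cong[OF refl], rule insert.prems(3))
      fix k x assume "k \<in> S" "x \<in> X k"
      moreover have "k \<noteq> i" using insert.hyps \<open>k \<in> S\<close> by auto
      ultimately have "x \<in> V - X i" using insert.prems(1)[of k] insert.prems(2)[of k i] by auto
      then show "g x = g' x" by (rule *)
    qed simp
  qed
  also have "(\<integral>\<^sup>+g. (\<Prod>k\<in>S. f k g) \<partial>Pi_pmf V d p) = (\<Prod>k\<in>S. \<integral>\<^sup>+g. f k g \<partial>Pi_pmf V d p)"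
  proof (rule insert.IH)
    show "X k \<subseteq> V" if "k \<in> S" for k by (rule insert.prems(1)) (use that in simp)
    show "X k \<inter> X l = {}" if "k \<in> S" "l \<in> S" "k \<noteq> l" for k l
      by (rule insert.prems(2)) (use that in simp_all)
    show "f k g = f k g'" if "k \<in> S" "\<And>x. x \<in> X k \<Longrightarrow> g x = g' x" for k g g'
      by (rule insert.prems(3)) (use that in simp_all)
  qed
  finally show ?case by (simp add: insert.hyps)
qed

subsection \<open>One round of the marking process\<close>

type_synonym mstate = "nat \<Rightarrow> bool \<times> bool \<times> nat"

definition alive :: "mstate \<Rightarrow> nat \<Rightarrow> bool" where "alive s v = fst (s v)"
definition chosen :: "mstate \<Rightarrow> nat \<Rightarrow> bool" where "chosen s v = fst (snd (s v))"
definition level :: "mstate \<Rightarrow> nat \<Rightarrow> nat" where "level s v = snd (snd (s v))"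

definition desire :: "mstate \<Rightarrow> nat \<Rightarrow> real" where
  "desire s v = (if alive s v then (1/2) ^ level s v else 0)"

definition edeg :: "(nat \<Rightarrow> nat \<Rightarrow> bool) \<Rightarrow> mstate \<Rightarrow> nat \<Rightarrow> real" where
  "edeg E s v = (\<Sum>u\<in>{u. E v u}. desire s u)"

definition marked :: "mstate \<Rightarrow> (nat \<Rightarrow> nat) \<Rightarrow> nat \<Rightarrow> bool" where
  "marked s g v \<longleftrightarrow> alive s v \<and> level s v \<le> g v"

definition joins :: "(nat \<Rightarrow> nat \<Rightarrow> bool) \<Rightarrow> mstate \<Rightarrow> (nat \<Rightarrow> nat) \<Rightarrow> nat \<Rightarrow> bool" where
  "joins E s g v \<longleftrightarrow> marked s g v \<and> (\<forall>u. E v u \<longrightarrow> \<not> marked s g u)"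

text \<open>Levels never drop below 1, which keeps desires at most 1/2 as
  \<open>one_minus_ge_exp\<close> requires. Levels of decided vertices go on moving; their desire is
  0 anyway.\<close>

definition mround :: "(nat \<Rightarrow> nat \<Rightarrow> bool) \<Rightarrow> mstate \<Rightarrow> (nat \<Rightarrow> nat) \<Rightarrow> mstate" where
  "mround E s g = (\<lambda>v. (alive s v \<and> \<not> joins E s g v \<and> \<not> (\<exists>u. E v u \<and> joins E s g u),
      chosen s v \<or> joins E s g v,
      if edeg E s v \<ge> 2 then Suc (level s v) else max 1 (level s v - 1)))"

lemma mround_simps:
  "alive (mround E s g) v \<longleftrightarrow> alive s v \<and> \<not> joins E s g v \<and> \<not> (\<exists>u. E v u \<and> joins E s g u)"
  "chosen (mround E s g) v \<longleftrightarrow> chosen s v \<or> joins E s g v"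
  "level (mround E s g) v = (if edeg E s v \<ge> 2 then Suc (level s v) else max 1 (level s v - 1))"
  by (simp_all add: mround_def alive_def chosen_def level_def)

lemma desire_nonneg [simp]: "0 \<le> desire s v"
  by (simp add: desire_def)

lemma edeg_nonneg [simp]: "0 \<le> edeg E s v"
  unfolding edeg_def by (intro sum_nonneg) simp

lemma desire_le_half: "1 \<le> level s v \<Longrightarrow> desire s v \<le> 1/2"
  using power_decreasing[of 1 "level s v" "1/2 :: real"] by (simp add: desire_def)

text \<open>Bounds a product of probabilities of staying unmarked by the exponential of a sum of
  desires.\<close>

lemma one_minus_ge_exp:
  fixes x :: real
  assumes "0 \<le> x" "x \<le> 1/2"
  shows "exp (- (2 * x)) \<le> 1 - x"
proof -
  have "x * x \<le> 1/2 * x" using assms by (intro mult_right_mono) auto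
  then have "- (2 * x) \<le> ln (1 - x)"
    using ln_one_minus_pos_lower_bound[OF assms] assms by (simp add: power2_eq_square)
  then have "exp (- (2 * x)) \<le> exp (ln (1 - x))" by simp
  then show ?thesis using assms by simp
qed

text \<open>The events ``\<open>u\<close> is the only marked vertex of \<open>L \<union> N(u)\<close>'' for \<open>u \<in> L\<close> are pairwise disjoint.\<close>

lemma prob_joins_ge:
  assumes V: "finite V" "\<And>u v. E u v \<Longrightarrow> u \<in> V \<and> v \<in> V" "\<And>v. \<not> E v v"
    and lev: "\<And>v. 1 \<le> level s v \<and> level s v \<le> n"
    and L: "L \<subseteq> V" "\<And>u. u \<in> L \<Longrightarrow> alive s u \<and> edeg E s u \<le> 2"
    and sum: "1/20 \<le> (\<Sum>u\<in>L. desire s u)" "(\<Sum>u\<in>L. desire s u) \<le> 1"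
  shows "measure_pmf.prob (Pi_pmf V 0 (\<lambda>_. geo n)) {g. \<exists>u\<in>L. joins E s g u} \<ge> exp (-6) / 20"
proof -
  let ?P = "Pi_pmf V 0 (\<lambda>_. geo n)"
  define W where "W = (\<lambda>u. L \<union> {w. E u w} - {u})"
  \<comment> \<open>The event as a box: \<open>u\<close> draws at least its level and every
    undecided competitor draws less than its own. Decided vertices are never marked and stay
    unconstrained, so the probability is a product over \<open>W u\<close>.\<close>
  define B where "B = (\<lambda>u x. if x = u then {level s u..}
      else if x \<in> W u \<and> alive s x then {..<level s x} else UNIV)"
  have finL: "finite L" using L V finite_subset by blast
  have finN: "finite {w. E u w}" for u by (rule finite_subset[OF _ V(1)]) (use V(2) in auto)
  have WV: "W u \<subseteq> V" if "u \<in> L" for u using that L V(2) by (auto simp: W_def)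
  have evt: "joins E s g u" if "g \<in> Pi V (B u)" "u \<in> L" for g u
  proof -
    have "u \<in> V" using that L by auto
    then have "marked s g u" using that L(2)[of u] by (auto simp: marked_def B_def Pi_iff)
    moreover have "\<not> marked s g w" if "E u w" for w
    proof
      assume m: "marked s g w"
      have "w \<in> V" "w \<in> W u" "w \<noteq> u" using that V(2,3) by (auto simp: W_def)
      with \<open>g \<in> Pi V (B u)\<close> have "g w \<in> B u w" by auto
      with m \<open>w \<in> W u\<close> \<open>w \<noteq> u\<close> show False by (simp add: B_def marked_def)
    qed
    ultimately show ?thesis by (auto simp: joins_def)
  qed
  have disj: "Pi V (B u) \<inter> Pi V (B u') = {}" if "u \<in> L" "u' \<in> L" "u \<noteq> u'" for u u'
  proof (rule ccontr)
    assume "\<not> ?thesis"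
    then obtain g where g: "g \<in> Pi V (B u)" "g \<in> Pi V (B u')" by auto
    have "g u \<in> B u u" "g u \<in> B u' u" using g that L by auto
    moreover have "u \<in> W u'" using that by (auto simp: W_def)
    ultimately show False using that L(2)[of u] by (simp add: B_def)
  qed
  have prob_less: "measure_pmf.prob (geo n) {..<level s x} = 1 - (1/2) ^ level s x" for x
  proof -
    have "{..<level s x} = UNIV - {level s x..}" by auto
    then have "measure_pmf.prob (geo n) {..<level s x} = 1 - measure_pmf.prob (geo n) {level s x..}"
      using measure_pmf.prob_compl[of "{level s x..}" "geo n"] by simp
    then show ?thesis using prob_geo[of "level s x" n] lev by simp
  qed
  have single: "desire s u * exp (-6) \<le> measure_pmf.prob ?P (Pi V (B u))" if "u \<in> L" for u
  proof -
    have u: "u \<in> V" "alive s u" using that L by auto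
    have "measure_pmf.prob ?P (Pi V (B u)) = (\<Prod>x\<in>V. measure_pmf.prob (geo n) (B u x))"
      by (rule measure_Pi_pmf_Pi[OF V(1)])
    also have "\<dots> = measure_pmf.prob (geo n) (B u u) * (\<Prod>x\<in>V - {u}. measure_pmf.prob (geo n) (B u x))"
      by (rule prod.remove[OF V(1) u(1)])
    also have "measure_pmf.prob (geo n) (B u u) = desire s u"
      using u lev by (simp add: B_def desire_def prob_geo)
    also have "(\<Prod>x\<in>V - {u}. measure_pmf.prob (geo n) (B u x)) = (\<Prod>x\<in>W u. measure_pmf.prob (geo n) (B u x))"
      by (rule prod.mono_neutral_right) (use V(1) WV[OF that] in \<open>auto simp: B_def W_def\<close>)
    also have "\<dots> = (\<Prod>x\<in>W u. 1 - desire s x)"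
      by (rule prod.cong) (auto simp: B_def W_def prob_less desire_def)
    finally have eq: "measure_pmf.prob ?P (Pi V (B u)) = desire s u * (\<Prod>x\<in>W u. 1 - desire s x)" .
    have "(\<Sum>x\<in>W u. desire s x) \<le> (\<Sum>x\<in>L \<union> {w. E u w}. desire s x)"
      by (rule sum_mono2) (auto simp: W_def finL finN)
    also have "\<dots> \<le> (\<Sum>x\<in>L. desire s x) + (\<Sum>x\<in>{w. E u w}. desire s x)"
    proof -
      have "(\<Sum>x\<in>L \<union> {w. E u w}. desire s x) + (\<Sum>x\<in>L \<inter> {w. E u w}. desire s x)
          = (\<Sum>x\<in>L. desire s x) + (\<Sum>x\<in>{w. E u w}. desire s x)"
        by (rule sum.union_inter[OF finL finN])
      moreover have "0 \<le> (\<Sum>x\<in>L \<inter> {w. E u w}. desire s x)" by (rule sum_nonneg) simp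
      ultimately show ?thesis by linarith
    qed
    \<comment> \<open>The set \<open>L\<close> contributes at most 1 and the neighbourhood at most
      2; the factor 2 of \<open>one_minus_ge_exp\<close> turns this 3 into the 6 of
      \<open>exp (-6)\<close>.\<close>
    also have "\<dots> \<le> 1 + 2" using sum(2) L(2)[OF that] by (auto simp: edeg_def)
    finally have "exp (-6) \<le> exp (\<Sum>x\<in>W u. - (2 * desire s x))"
      by (simp add: sum_negf sum_distrib_left[symmetric])
    also have "\<dots> = (\<Prod>x\<in>W u. exp (- (2 * desire s x)))"
      by (rule exp_sum) (auto simp: W_def finL finN)
    also have "\<dots> \<le> (\<Prod>x\<in>W u. 1 - desire s x)"
      by (rule prod_mono) (use one_minus_ge_exp desire_le_half lev in auto)
    finally show ?thesis unfolding eq by (rule mult_left_mono) simp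
  qed
  have "exp (-6) / 20 \<le> (\<Sum>u\<in>L. desire s u) * exp (-6)"
    using mult_right_mono[OF sum(1), of "exp (-6)"] by simp
  also have "\<dots> \<le> (\<Sum>u\<in>L. measure_pmf.prob ?P (Pi V (B u)))"
    unfolding sum_distrib_right by (rule sum_mono) (rule single)
  also have "\<dots> = measure_pmf.prob ?P (\<Union>u\<in>L. Pi V (B u))"
    by (rule measure_pmf.finite_measure_finite_Union[symmetric])
       (use finL disj in \<open>auto simp: disjoint_family_on_def\<close>)
  also have "\<dots> \<le> measure_pmf.prob ?P {g. \<exists>u\<in>L. joins E s g u}"
    by (rule measure_pmf.finite_measure_mono) (use evt in auto)
  finally show ?thesis .
qed

text \<open>Weights are at most 1/2, so a set grown until it reaches 1/20 overshoots by little. The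
  cap bounds the competition inside \<open>L\<close> in \<open>prob_joins_ge\<close>.\<close>

lemma subset_sum_between:
  fixes p :: "'a \<Rightarrow> real"
  assumes "finite A" "\<And>x. x \<in> A \<Longrightarrow> 0 \<le> p x \<and> p x \<le> 1/2" "1/20 \<le> sum p A"
  shows "\<exists>L\<subseteq>A. 1/20 \<le> sum p L \<and> sum p L \<le> 1"
  using assms
proof (induction A rule: finite_induct)
  case empty
  then show ?case by simp
next
  case (insert x A)
  show ?case
  proof (cases "1/20 \<le> sum p A")
    case True
    then obtain L where "L \<subseteq> A" "1/20 \<le> sum p L \<and> sum p L \<le> 1" using insert by auto
    then show ?thesis by (intro exI[of _ L]) auto
  next
    case False
    moreover have "p x \<le> 1/2" using insert by auto
    ultimately have "sum p (insert x A) \<le> 1" using insert.hyps by simp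
    then show ?thesis using insert.prems by (intro exI[of _ "insert x A"]) simp
  qed
qed

subsection \<open>A potential that decays in every round\<close>

text \<open>\<open>join_prob\<close> is the bound of \<open>prob_joins_ge\<close>; the exponents are small enough that \<open>1 - join_prob\<close>
  beats the growth of the potential in a golden round, and their ratio makes the decrease of the
  effective degree win over the halved desire otherwise.\<close>

definition join_prob :: real where "join_prob = exp (-6) / 20"
definition deg_exp :: real where "deg_exp = join_prob / 2"
definition level_exp :: real where "level_exp = deg_exp / 4"
definition decay :: real where "decay = exp (- (join_prob / 40))"

definition potential :: "(nat \<Rightarrow> nat \<Rightarrow> bool) \<Rightarrow> mstate \<Rightarrow> nat \<Rightarrow> real" where
  "potential E s v = (if alive s v
     then max 1 (edeg E s v) powr deg_exp * 2 powr (level_exp * real (level s v)) else 0)"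

lemma join_prob_bounds: "0 < join_prob" "join_prob \<le> 1/20"
  by (simp_all add: join_prob_def)

lemma exps_pos: "0 < deg_exp" "deg_exp \<le> 1" "0 < level_exp"
  using join_prob_bounds by (simp_all add: deg_exp_def level_exp_def)

lemma decay_bounds: "0 < decay" "decay < 1"
  using join_prob_bounds by (simp_all add: decay_def)

lemma powr_2_le_exp: "0 \<le> x \<Longrightarrow> 2 powr x \<le> exp (x :: real)"
  using ln_le_minus_one[of "2::real"] mult_left_mono[of "ln 2" 1 x]
  by (simp add: powr_def mult.commute)

text \<open>Doubled degree and halved desire cost the exponent 5/8 \<open>join_prob\<close>, less
  than the \<open>join_prob\<close> gained by the chance of being decided.\<close>

lemma decay_golden: "2 powr (deg_exp + level_exp) * (1 - join_prob) \<le> decay"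
proof -
  have "2 powr (deg_exp + level_exp) \<le> exp (deg_exp + level_exp)" using exps_pos by (intro powr_2_le_exp) simp
  moreover have "1 - join_prob \<le> exp (- join_prob)" using exp_ge_add_one_self[of "- join_prob"] by simp
  ultimately have "2 powr (deg_exp + level_exp) * (1 - join_prob) \<le> exp (deg_exp + level_exp) * exp (- join_prob)"
    using join_prob_bounds by (intro mult_mono) auto
  also have "\<dots> \<le> decay"
    using join_prob_bounds by (simp add: decay_def exp_add[symmetric] deg_exp_def level_exp_def)
  finally show ?thesis .
qed

text \<open>The tightest of the four cases: in units of \<open>join_prob\<close> the shrinking
  degree gains 7/20 of 1/2 and the halved desire costs 1/8, which leaves 1/20; \<open>decay\<close>
  asks for 1/40.\<close>

lemma decay_heavy: "(13/20) powr deg_exp * 2 powr level_exp \<le> decay"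
proof -
  have "ln (13/20 :: real) \<le> 13/20 - 1" by (rule ln_le_minus_one) simp
  then have "deg_exp * ln (13/20) \<le> deg_exp * (- (7/20))" using exps_pos by (intro mult_left_mono) auto
  then have "(13/20) powr deg_exp \<le> exp (- (7/20) * deg_exp)" by (simp add: powr_def mult.commute)
  moreover have "2 powr level_exp \<le> exp level_exp" using exps_pos by (intro powr_2_le_exp) simp
  ultimately have "(13/20) powr deg_exp * 2 powr level_exp \<le> exp (- (7/20) * deg_exp) * exp level_exp"
    by (intro mult_mono) auto
  also have "\<dots> = exp (- (7/20) * deg_exp + level_exp)" by (rule exp_add[symmetric])
  also have "\<dots> \<le> decay"
    using join_prob_bounds by (simp add: decay_def deg_exp_def level_exp_def)
  finally show ?thesis .
qed

lemma decay_light: "2 powr (- level_exp) \<le> decay"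
proof -
  have "join_prob / 40 \<le> level_exp * (2/3)" using join_prob_bounds by (simp add: deg_exp_def level_exp_def)
  also have "\<dots> \<le> level_exp * ln 2" using exps_pos ln2_ge_two_thirds by (intro mult_left_mono) auto
  finally show ?thesis by (simp add: powr_def decay_def mult.commute)
qed

lemma decay_join: "1 - join_prob \<le> decay"
proof -
  have "1 - join_prob \<le> exp (- join_prob)" using exp_ge_add_one_self[of "- join_prob"] by simp
  also have "\<dots> \<le> decay" using join_prob_bounds by (simp add: decay_def)
  finally show ?thesis .
qed

lemma potential_nonneg [simp]: "0 \<le> potential E s v"
  by (simp add: potential_def)

lemma potential_ge_1: "alive s v \<Longrightarrow> 1 \<le> potential E s v"
  using mult_mono[of 1 "max 1 (edeg E s v) powr deg_exp" 1 "2 powr (level_exp * real (level s v))"] exps_pos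
  by (simp add: potential_def ge_one_powr_ge_zero)

section \<open>Decay of the potential at one vertex and on separated sets\<close>

locale graph_ctx =
  fixes V :: "nat set" and E :: "nat \<Rightarrow> nat \<Rightarrow> bool"
  assumes graph: "simple_graph V E"
begin

lemma finV: "finite V" and EV: "E u v \<Longrightarrow> u \<in> V \<and> v \<in> V" and Esym: "E u v \<Longrightarrow> E v u"
  and Eirr: "\<not> E v v"
  using graph by (auto simp: simple_graph_def)

lemma finN: "finite {u. E v u}"
  by (rule finite_subset[OF _ finV]) (use EV in auto)

text \<open>Neighbours of effective degree at least 2 halve their desire and the others at most
  double it; 3/2 is the excess of the factor 2 over the factor 1/2.\<close>

lemma edeg_mround_le:
  assumes lev: "\<And>v. 1 \<le> level s v"
  shows "edeg E (mround E s g) v \<le> edeg E s v / 2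
     + 3/2 * (\<Sum>u\<in>{u. E v u \<and> edeg E s u < 2}. desire s u)"
proof -
  have "desire (mround E s g) u \<le> desire s u / 2 + 3/2 * (if edeg E s u < 2 then desire s u else 0)" for u
  proof (cases "alive (mround E s g) u")
    case False
    then have "desire (mround E s g) u = 0" by (simp add: desire_def)
    moreover have "0 \<le> desire s u / 2 + 3/2 * (if edeg E s u < 2 then desire s u else 0)" by simp
    ultimately show ?thesis by simp
  next
    case True
    then have al: "alive s u" by (simp add: mround_simps)
    show ?thesis
    proof (cases "edeg E s u < 2")
      case True
      have "(1/2 :: real) ^ max 1 (level s u - 1) \<le> 2 * (1/2) ^ level s u"
      proof (cases "level s u = 1")
        case False
        then obtain j where "level s u = Suc j" "1 \<le> j" using lev[of u] by (cases "level s u") auto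
        then show ?thesis by (simp add: max_def)
      qed simp
      then show ?thesis using True al \<open>alive (mround E s g) u\<close>
        by (simp add: desire_def mround_simps)
    next
      case False
      then show ?thesis using al \<open>alive (mround E s g) u\<close>
        by (simp add: desire_def mround_simps)
    qed
  qed
  then have "edeg E (mround E s g) v
      \<le> (\<Sum>u\<in>{u. E v u}. desire s u / 2 + 3/2 * (if edeg E s u < 2 then desire s u else 0))"
    unfolding edeg_def[of E "mround E s g"] by (rule sum_mono)
  also have "\<dots> = edeg E s v / 2 + 3/2 * (\<Sum>u\<in>{u. E v u}. if edeg E s u < 2 then desire s u else 0)"
    by (simp add: sum.distrib sum_divide_distrib sum_distrib_left edeg_def)
  also have "(\<Sum>u\<in>{u. E v u}. if edeg E s u < 2 then desire s u else 0)
      = (\<Sum>u\<in>{u. E v u \<and> edeg E s u < 2}. desire s u)"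
    by (subst sum.inter_filter[symmetric, OF finN]) simp
  finally show ?thesis .
qed

text \<open>\<open>L\<close> is empty in a round that is not golden; then the bound \<open>c\<close> alone gives the decay.\<close>

lemma vertex_round:
  assumes lev: "\<And>v. 1 \<le> level s v \<and> level s v \<le> n" and v: "v \<in> V"
  shows "\<exists>L c. L \<subseteq> insert v {u. E v u} \<and> 0 \<le> c
    \<and> (\<forall>g. potential E (mround E s g) v \<le> c * (if \<exists>u\<in>L. joins E s g u then 0 else 1))
    \<and> c * (1 - measure_pmf.prob (Pi_pmf V 0 (\<lambda>_. geo n)) {g. \<exists>u\<in>L. joins E s g u})
        \<le> decay * potential E s v"
proof (cases "alive s v")
  case False
  then show ?thesis by (intro exI[of _ "{}"] exI[of _ 0]) (simp add: potential_def mround_simps)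
next
  case al: True
  let ?prob = "\<lambda>L. measure_pmf.prob (Pi_pmf V 0 (\<lambda>_. geo n)) {g. \<exists>u\<in>L. joins E s g u}"
  define d where "d = edeg E s v"
  define j where "j = level s v"
  define d' where "d' = (\<lambda>g. edeg E (mround E s g) v)"
  define j' where "j' = (if d \<ge> 2 then Suc j else max 1 (j - 1))"
  define N where "N = {u. E v u \<and> edeg E s u < 2}"
  define dl where "dl = (\<Sum>u\<in>N. desire s u)"
  have d0: "0 \<le> d" by (simp add: d_def)
  have jb: "1 \<le> j" using lev by (simp add: j_def)
  have d': "d' g \<le> d / 2 + 3/2 * dl" for g
    unfolding d'_def d_def dl_def N_def by (rule edeg_mround_le) (use lev in auto)
  have dl: "dl \<le> d" unfolding dl_def d_def edeg_def N_def
    by (rule sum_mono2) (use finN in auto)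
  have pot: "potential E s v = max 1 d powr deg_exp * 2 powr (level_exp * j)"
    using al by (simp add: potential_def d_def j_def)
  have pot': "potential E (mround E s g) v \<le> X powr deg_exp * 2 powr (level_exp * j') * (if \<exists>u\<in>L. joins E s g u then 0 else 1)"
    if "L \<subseteq> insert v {u. E v u}" "max 1 (d' g) \<le> X" for g X L
  proof (cases "alive (mround E s g) v")
    case False
    then show ?thesis by (simp add: potential_def)
  next
    case True
    then have "\<not> (\<exists>u\<in>L. joins E s g u)" using that(1) by (auto simp: mround_simps)
    moreover have "max 1 (d' g) powr deg_exp \<le> X powr deg_exp"
      using that(2) exps_pos by (intro powr_mono2) auto
    moreover have "level (mround E s g) v = j'" by (simp add: mround_simps j'_def d_def j_def)
    ultimately show ?thesis using True by (simp add: potential_def d'_def mult_right_mono)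
  qed
  have join: "1 - ?prob L \<le> 1 - join_prob"
    if "L \<subseteq> V" "\<And>u. u \<in> L \<Longrightarrow> alive s u \<and> edeg E s u \<le> 2" "1/20 \<le> sum (desire s) L" "sum (desire s) L \<le> 1" for L
    using prob_joins_ge[of V E s n L, OF finV EV Eirr lev that] by (simp add: join_prob_def)
  show ?thesis
  \<comment> \<open>A golden round: the two conditions give \<open>dl\<close> at least 1/20, the
    amount that \<open>prob_joins_ge\<close> needs.\<close>
  proof (cases "d / 10 \<le> dl \<and> 1/2 \<le> d")
    case golden: True
    define N' where "N' = {u\<in>N. alive s u}"
    have "finite N" unfolding N_def by (rule finite_subset[OF _ finN[of v]]) auto
    moreover have "sum (desire s) N' = dl" unfolding dl_def N'_def
      by (rule sum.mono_neutral_left) (use \<open>finite N\<close> in \<open>auto simp: desire_def\<close>)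
    ultimately obtain L where L: "L \<subseteq> N'" "1/20 \<le> sum (desire s) L" "sum (desire s) L \<le> 1"
      using subset_sum_between[of N' "desire s"] golden desire_le_half lev
      by (auto simp: N'_def)
    have LN: "L \<subseteq> insert v {u. E v u}" using L(1) by (auto simp: N'_def N_def)
    have LV: "L \<subseteq> V" using LN v EV by auto
    have pr: "1 - ?prob L \<le> 1 - join_prob"
      by (rule join[OF LV]) (use L in \<open>auto simp: N'_def N_def\<close>)
    let ?c = "(2 * max 1 d) powr deg_exp * 2 powr (level_exp * (j + 1))"
    \<comment> \<open>In the worst case all neighbours double their desire and the level of
      \<open>v\<close> rises by one; \<open>decay_golden\<close> pays for both.\<close>
    have X: "max 1 (d' g) \<le> 2 * max 1 d" for g using d'[of g] dl d0 by auto
    have "2 powr (level_exp * real j') \<le> 2 powr (level_exp * (real j + 1))"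
      using exps_pos by (intro powr_mono mult_left_mono) (auto simp: j'_def)
    then have b: "(2 * max 1 d) powr deg_exp * 2 powr (level_exp * j') * x \<le> ?c * x" if "0 \<le> x" for x :: real
      by (intro mult_right_mono[OF _ that] mult_left_mono) (auto simp: add.commute)
    have c_eq: "?c = potential E s v * 2 powr (deg_exp + level_exp)"
    proof -
      have "(2 * max 1 d) powr deg_exp = 2 powr deg_exp * max 1 d powr deg_exp" by (simp add: powr_mult)
      moreover have "level_exp * real (j + 1) = level_exp * real j + level_exp" by (simp add: distrib_left)
      ultimately show ?thesis by (simp only: pot powr_add mult_ac)
    qed
    have "?c * (1 - ?prob L) \<le> ?c * (1 - join_prob)" by (rule mult_left_mono[OF pr]) simp
    also have "\<dots> = potential E s v * (2 powr (deg_exp + level_exp) * (1 - join_prob))"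
      unfolding c_eq by (rule mult.assoc)
    also have "\<dots> \<le> potential E s v * decay" by (rule mult_left_mono[OF decay_golden]) simp
    finally have "?c * (1 - ?prob L) \<le> decay * potential E s v" by (simp add: mult.commute)
    moreover have "potential E (mround E s g) v \<le> ?c * (if \<exists>u\<in>L. joins E s g u then 0 else 1)" for g
      by (rule order_trans[OF pot'[OF LN X] b]) simp
    ultimately show ?thesis using LN by (intro exI[of _ L] exI[of _ ?c]) auto
  next
    case ng: False
    consider "2 \<le> d" | "d < 2" "j = 1" | "d < 2" "2 \<le> j" using jb by linarith
    then show ?thesis
    proof cases
      case 1
      let ?c = "(13/20 * d) powr deg_exp * 2 powr (level_exp * j')"
      \<comment> \<open>Less than a tenth of \<open>d\<close> can double, and 1/2 + 3/2 * 1/10 =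
        13/20. As \<open>d\<close> is at least 2, this bound also exceeds the 1 in the
        maximum.\<close>
      have X: "max 1 (d' g) \<le> 13/20 * d" for g using d'[of g] ng 1 by auto
      have "?c = potential E s v * ((13/20) powr deg_exp * 2 powr level_exp)"
      proof -
        have "(13/20 * d) powr deg_exp = (13/20) powr deg_exp * d powr deg_exp" by (rule powr_mult)
        moreover have "level_exp * real j' = level_exp * real j + level_exp" using 1 by (simp add: j'_def distrib_left)
        moreover have "max 1 d = d" using 1 by simp
        ultimately show ?thesis by (simp only: pot powr_add mult_ac)
      qed
      also have "\<dots> \<le> potential E s v * decay" by (rule mult_left_mono[OF decay_heavy]) simp
      finally have "?c \<le> decay * potential E s v" by (simp add: mult.commute)
      then show ?thesis using pot'[of "{}", OF _ X]
        by (intro exI[of _ "{}"] exI[of _ ?c]) auto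
    next
      \<comment> \<open>The desire is already 1/2 and cannot double, so the decay must come from
        \<open>v\<close> itself, which joins with constant probability.\<close>
      case 2
      let ?c = "max 1 d powr deg_exp * 2 powr (level_exp * j')"
      \<comment> \<open>Either \<open>d\<close> is below 1/2 and stays below 1 even when doubled, or
        few neighbours can double and \<open>d\<close> does not grow.\<close>
      have X: "max 1 (d' g) \<le> max 1 d" for g using d'[of g] ng dl d0 2 by auto
      have c: "?c = potential E s v" using 2 by (simp add: pot j'_def)
      have "1 - ?prob {v} \<le> 1 - join_prob"
      proof (rule join)
        have "desire s v = 1/2" using 2 al by (simp add: desire_def j_def)
        then show "1/20 \<le> sum (desire s) {v}" "sum (desire s) {v} \<le> 1" by simp_all
      qed (use v al 2 in \<open>auto simp: d_def\<close>)
      also have "\<dots> \<le> decay" by (rule decay_join)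
      finally have "?c * (1 - ?prob {v}) \<le> decay * potential E s v"
        unfolding c by (subst mult.commute) (rule mult_right_mono, auto)
      then show ?thesis using pot'[of "{v}", OF _ X]
        by (intro exI[of _ "{v}"] exI[of _ ?c]) auto
    next
      case 3
      let ?c = "max 1 d powr deg_exp * 2 powr (level_exp * j')"
      have X: "max 1 (d' g) \<le> max 1 d" for g using d'[of g] ng dl d0 3 by auto
      have "real j' = real j - 1" using 3 by (simp add: j'_def)
      then have "?c = potential E s v * 2 powr (- level_exp)"
        by (simp add: pot right_diff_distrib powr_diff powr_minus divide_inverse)
      also have "\<dots> \<le> potential E s v * decay" by (rule mult_left_mono[OF decay_light]) simp
      finally have "?c \<le> decay * potential E s v" by (simp add: mult.commute)
      then show ?thesis using pot'[of "{}", OF _ X]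
        by (intro exI[of _ "{}"] exI[of _ ?c]) auto
    qed
  qed
qed

text \<open>Distance at least 5 means disjoint 2-balls, and a 2-ball holds all draws that decide
  whether \<open>v\<close> or a neighbour of \<open>v\<close> joins.\<close>

definition separated :: "nat set \<Rightarrow> bool" where
  "separated S \<longleftrightarrow> S \<subseteq> V \<and> (\<forall>u\<in>S. \<forall>v\<in>S. u \<noteq> v \<longrightarrow> u \<notin> nball E 4 v)"

lemma nball_closed: "v \<in> V \<Longrightarrow> nball E r v \<subseteq> V"
  by (rule nball_subset_closed) (use EV in auto)

text \<open>The new potential of \<open>v\<close> reads draws up to distance 3, since it involves
  which neighbours survive. The majorant from \<open>vertex_round\<close> only asks whether a vertex
  of \<open>L v\<close> joins and reads distance 2; with it the factors become independent.\<close>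

lemma round_decay:
  assumes lev: "\<And>v. 1 \<le> level s v \<and> level s v \<le> n" and S: "separated S"
  shows "(\<integral>\<^sup>+g. (\<Prod>v\<in>S. ennreal (potential E (mround E s g) v)) \<partial>Pi_pmf V 0 (\<lambda>_. geo n))
    \<le> (\<Prod>v\<in>S. ennreal (decay * potential E s v))"
proof -
  let ?P = "Pi_pmf V 0 (\<lambda>_. geo n)"
  have SV: "S \<subseteq> V" and finS: "finite S" using S finV finite_subset by (auto simp: separated_def)
  have "\<forall>v\<in>S. \<exists>L c. L \<subseteq> insert v {u. E v u} \<and> 0 \<le> c
    \<and> (\<forall>g. potential E (mround E s g) v \<le> c * (if \<exists>u\<in>L. joins E s g u then 0 else 1))
    \<and> c * (1 - measure_pmf.prob ?P {g. \<exists>u\<in>L. joins E s g u}) \<le> decay * potential E s v"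
    using vertex_round[OF lev] SV by blast
  from bchoice[OF this] obtain L where "\<forall>v\<in>S. \<exists>c. L v \<subseteq> insert v {u. E v u} \<and> 0 \<le> c
    \<and> (\<forall>g. potential E (mround E s g) v \<le> c * (if \<exists>u\<in>L v. joins E s g u then 0 else 1))
    \<and> c * (1 - measure_pmf.prob ?P {g. \<exists>u\<in>L v. joins E s g u}) \<le> decay * potential E s v" ..
  from bchoice[OF this] obtain c where "\<forall>v\<in>S. L v \<subseteq> insert v {u. E v u} \<and> 0 \<le> c v
    \<and> (\<forall>g. potential E (mround E s g) v \<le> c v * (if \<exists>u\<in>L v. joins E s g u then 0 else 1))
    \<and> c v * (1 - measure_pmf.prob ?P {g. \<exists>u\<in>L v. joins E s g u}) \<le> decay * potential E s v" ..
  then have Lc: "\<And>v. v \<in> S \<Longrightarrow> L v \<subseteq> insert v {u. E v u}" "\<And>v. v \<in> S \<Longrightarrow> 0 \<le> c v"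
     "\<And>v g. v \<in> S \<Longrightarrow> potential E (mround E s g) v \<le> c v * (if \<exists>u\<in>L v. joins E s g u then 0 else 1)"
     "\<And>v. v \<in> S \<Longrightarrow> c v * (1 - measure_pmf.prob ?P {g. \<exists>u\<in>L v. joins E s g u}) \<le> decay * potential E s v"
    by simp_all
  define f where "f = (\<lambda>v g. if \<exists>u\<in>L v. joins E s g u then 0 else (1 :: ennreal))"
  have "(\<integral>\<^sup>+g. (\<Prod>v\<in>S. ennreal (potential E (mround E s g) v)) \<partial>?P)
      \<le> (\<integral>\<^sup>+g. (\<Prod>v\<in>S. ennreal (c v) * f v g) \<partial>?P)"
  proof (intro nn_integral_mono prod_mono_ennreal)
    fix g v assume "v \<in> S"
    have "ennreal (potential E (mround E s g) v) \<le> ennreal (c v * (if \<exists>u\<in>L v. joins E s g u then 0 else 1))"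
      by (rule ennreal_leI) (rule Lc(3)[OF \<open>v \<in> S\<close>])
    also have "\<dots> = ennreal (c v) * f v g" by (simp add: f_def)
    finally show "ennreal (potential E (mround E s g) v) \<le> ennreal (c v) * f v g" .
  qed
  also have "\<dots> = (\<Prod>v\<in>S. ennreal (c v)) * (\<integral>\<^sup>+g. (\<Prod>v\<in>S. f v g) \<partial>?P)"
    by (simp add: prod.distrib nn_integral_cmult)
  also have "(\<integral>\<^sup>+g. (\<Prod>v\<in>S. f v g) \<partial>?P) = (\<Prod>v\<in>S. \<integral>\<^sup>+g. f v g \<partial>?P)"
  proof (rule nn_integral_Pi_pmf_prod[OF finV finS, where X = "nball E 2"])
    show "nball E 2 v \<subseteq> V" if "v \<in> S" for v using nball_closed that SV by blast
    show "nball E 2 u \<inter> nball E 2 v = {}" if "u \<in> S" "v \<in> S" "u \<noteq> v" for u v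
    proof (rule ccontr)
      assume "\<not> ?thesis"
      then obtain w where w: "w \<in> nball E 2 u" "w \<in> nball E 2 v" by auto
      have "u \<in> nball E 2 w" using nball_sym[OF Esym w(1)] .
      then have "u \<in> nball E 4 v" using nball_trans[OF w(2), of u 2] by simp
      then show False using S that by (auto simp: separated_def)
    qed
    show "f v g = f v g'" if v: "v \<in> S" and eq: "\<And>x. x \<in> nball E 2 v \<Longrightarrow> g x = g' x" for v g g'
    proof -
      have "joins E s g u = joins E s g' u" if "u \<in> L v" for u
      proof -
        have u: "u \<in> nball E 1 v" using Lc(1)[OF v] that by auto
        have "g u = g' u" using eq u nball_mono[of 1 2 E v] by auto
        moreover have "g w = g' w" if "E u w" for w
          using eq nball_step[OF u that] by (simp add: numeral_2_eq_2)
        ultimately show ?thesis by (auto simp: joins_def marked_def)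
      qed
      then show ?thesis by (simp add: f_def)
    qed
  qed
  also have "(\<Prod>v\<in>S. ennreal (c v)) * (\<Prod>v\<in>S. \<integral>\<^sup>+g. f v g \<partial>?P) = (\<Prod>v\<in>S. ennreal (c v) * (\<integral>\<^sup>+g. f v g \<partial>?P))"
    by (simp add: prod.distrib)
  also have "\<dots> \<le> (\<Prod>v\<in>S. ennreal (decay * potential E s v))"
  proof (rule prod_mono_ennreal)
    fix v assume v: "v \<in> S"
    have "(\<integral>\<^sup>+g. f v g \<partial>?P) = (\<integral>\<^sup>+g. indicator (UNIV - {g. \<exists>u\<in>L v. joins E s g u}) g \<partial>?P)"
      by (intro nn_integral_cong) (auto simp: f_def indicator_def)
    also have "\<dots> = ennreal (1 - measure_pmf.prob ?P {g. \<exists>u\<in>L v. joins E s g u})"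
      using measure_pmf.prob_compl[of "{g. \<exists>u\<in>L v. joins E s g u}" ?P]
      by (simp add: measure_pmf.emeasure_eq_measure)
    finally show "ennreal (c v) * (\<integral>\<^sup>+g. f v g \<partial>?P) \<le> ennreal (decay * potential E s v)"
      using Lc(2)[OF v] Lc(4)[OF v] by (simp add: ennreal_mult'[symmetric] ennreal_leI)
  qed
  finally show ?thesis .
qed

end

subsection \<open>The marking process over many rounds\<close>

primrec mrun :: "(nat \<Rightarrow> nat \<Rightarrow> bool) \<Rightarrow> nat \<Rightarrow> mstate \<Rightarrow> (nat \<Rightarrow> nat list) \<Rightarrow> mstate" where
  "mrun E 0 s x = s"
| "mrun E (Suc T) s x = mrun E T (mround E s (\<lambda>v. hd (x v))) (\<lambda>v. tl (x v))"

definition mstart :: mstate where "mstart v = (True, False, 1)"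

lemma is_local_mround: "is_local 2 (\<lambda>E y. mround E (\<lambda>v. fst (y v)) (\<lambda>v. hd (snd (y v))))"
proof (rule is_localI)
  fix E E' :: "nat \<Rightarrow> nat \<Rightarrow> bool" and y y' :: "nat \<Rightarrow> (bool \<times> bool \<times> nat) \<times> nat list" and v
  assume *: "\<And>u. u \<in> nball E 2 v \<Longrightarrow> E u = E' u" "\<And>u. u \<in> nball E 2 v \<Longrightarrow> y u = y' u"
  let ?s = "\<lambda>v. fst (y v)" and ?g = "\<lambda>v. hd (snd (y v))"
  let ?s' = "\<lambda>v. fst (y' v)" and ?g' = "\<lambda>v. hd (snd (y' v))"
  have m: "marked ?s ?g u = marked ?s' ?g' u" "desire ?s u = desire ?s' u" if "u \<in> nball E 2 v" for u
    using *(2)[OF that] by (simp_all add: marked_def alive_def level_def desire_def)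
  have sub: "u \<in> nball E 2 v" if "u \<in> nball E 1 v" for u
    using nball_mono[of 1 2 E v] that by auto
  have j: "joins E ?s ?g u = joins E' ?s' ?g' u" if u: "u \<in> nball E 1 v" for u
  proof -
    have "w \<in> nball E 2 v" if "E u w" for w using nball_step[OF u that] by (simp add: numeral_2_eq_2)
    then show ?thesis using m(1) sub[OF u] *(1)[OF sub[OF u]] by (auto simp: joins_def)
  qed
  have Ev: "E v = E' v" using *(1)[of v] by simp
  have n: "u \<in> nball E 1 v" if "E v u" for u using that by simp
  have d: "edeg E ?s v = edeg E' ?s' v"
    unfolding edeg_def Ev[symmetric] by (rule sum.cong) (use n sub m(2) in auto)
  have ex: "(\<exists>u. E v u \<and> joins E ?s ?g u) = (\<exists>u. E' v u \<and> joins E' ?s' ?g' u)"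
    unfolding Ev[symmetric] using n j by blast
  have yv: "y v = y' v" using *(2)[of v] by simp
  show "mround E ?s ?g v = mround E' ?s' ?g' v"
    unfolding mround_def d ex j[of v, OF nball_self] by (simp add: yv alive_def chosen_def level_def)
qed

lemma is_local_mrun: "is_local (2 * T) (\<lambda>E y. mrun E T (\<lambda>v. fst (y v)) (\<lambda>v. snd (y v)))"
proof (induction T)
  case 0
  show ?case by (rule is_localI) simp
next
  case (Suc T)
  let ?F = "\<lambda>E (y :: nat \<Rightarrow> (bool \<times> bool \<times> nat) \<times> nat list) v.
     (mround E (\<lambda>v. fst (y v)) (\<lambda>v. hd (snd (y v))) v, tl (snd (y v)))"
  have "is_local 2 (\<lambda>E (y :: nat \<Rightarrow> (bool \<times> bool \<times> nat) \<times> nat list) v. tl (snd (y v)))"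
    by (rule is_local_mono[OF is_local_pointwise]) simp
  then have "is_local 2 ?F" using is_local_app[OF is_local_mround, where h = Pair] by blast
  from is_local_comp[OF this Suc] show ?case by simp
qed

context graph_ctx
begin

lemma mround_partial_mis:
  assumes "partial_mis V E {v \<in> V. alive s v} {v \<in> V. chosen s v}"
  shows "partial_mis V E {v \<in> V. alive (mround E s g) v} {v \<in> V. chosen (mround E s g) v}"
proof -
  let ?J = "{v \<in> V. joins E s g v}"
  have "{v \<in> V. chosen (mround E s g) v} = {v \<in> V. chosen s v} \<union> ?J"
    by (auto simp: mround_simps)
  moreover have "partial_mis V E {v \<in> V. alive (mround E s g) v} ({v \<in> V. chosen s v} \<union> ?J)"
  proof (rule partial_mis_extend[OF assms Esym])
    show "?J \<subseteq> {v \<in> V. alive s v}" by (auto simp: joins_def marked_def)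
    show "\<forall>u\<in>?J. \<forall>v\<in>?J. \<not> E u v" by (auto simp: joins_def)
    show "{v \<in> V. alive (mround E s g) v} = {v \<in> V. alive s v} - ?J - {v. \<exists>u\<in>?J. E v u}"
      using EV by (auto simp: mround_simps)
  qed
  ultimately show ?thesis by simp
qed

lemma mrun_partial_mis:
  "partial_mis V E {v \<in> V. alive s v} {v \<in> V. chosen s v} \<Longrightarrow>
   partial_mis V E {v \<in> V. alive (mrun E T s x) v} {v \<in> V. chosen (mrun E T s x) v}"
proof (induction T arbitrary: s x)
  case (Suc T)
  then show ?case using mround_partial_mis by simp
qed simp

lemma mrun_mstart_partial_mis:
  "partial_mis V E {v \<in> V. alive (mrun E T mstart x) v} {v \<in> V. chosen (mrun E T mstart x) v}"
  by (rule mrun_partial_mis) (simp add: alive_def chosen_def mstart_def partial_mis_init)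

text \<open>Draws the first round at all vertices before the remaining rounds, so that the process
  can be conditioned on its first round.\<close>

lemma Pi_pmf_replicate_Suc:
  "Pi_pmf V (replicate (Suc T) d) (\<lambda>_. replicate_pmf (Suc T) q) =
   Pi_pmf V d (\<lambda>_. q) \<bind> (\<lambda>g. map_pmf (\<lambda>xs v. if v \<in> V then g v # xs v else replicate (Suc T) d)
      (Pi_pmf V (replicate T d) (\<lambda>_. replicate_pmf T q)))"
proof -
  have "Pi_pmf V (replicate (Suc T) d) (\<lambda>_. replicate_pmf (Suc T) q) =
     Pi_pmf V d (\<lambda>_. q) \<bind> (\<lambda>g. Pi_pmf V (replicate (Suc T) d)
        (\<lambda>v. replicate_pmf T q \<bind> (\<lambda>xs. return_pmf (g v # xs))))"
    unfolding replicate_pmf.simps by (rule Pi_pmf_bind[OF finV])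
  also have "\<dots> = Pi_pmf V d (\<lambda>_. q) \<bind> (\<lambda>g. Pi_pmf V (replicate T d) (\<lambda>_. replicate_pmf T q)
      \<bind> (\<lambda>xs. Pi_pmf V (replicate (Suc T) d) (\<lambda>v. return_pmf (g v # xs v))))"
    by (intro bind_pmf_cong refl Pi_pmf_bind[OF finV])
  also have "\<dots> = Pi_pmf V d (\<lambda>_. q) \<bind> (\<lambda>g. Pi_pmf V (replicate T d) (\<lambda>_. replicate_pmf T q)
      \<bind> (\<lambda>xs. return_pmf (\<lambda>v. if v \<in> V then g v # xs v else replicate (Suc T) d)))"
    by (simp only: Pi_pmf_return_pmf[OF finV])
  finally show ?thesis by (simp add: map_pmf_def)
qed

text \<open>Induction over the first round, for an arbitrary start. The bound for the later rounds
  is again a product of potentials, to which \<open>round_decay\<close> applies. Levels rise by at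
  most one per round, so \<open>level s v + T \<le> n\<close> keeps them where \<open>geo n\<close>
  is exact.\<close>

lemma run_decay:
  assumes S: "separated S"
  shows "(\<And>v. 1 \<le> level s v \<and> level s v + T \<le> n) \<Longrightarrow>
    (\<integral>\<^sup>+x. (\<Prod>v\<in>S. ennreal (potential E (mrun E T s x) v))
        \<partial>Pi_pmf V (replicate T 0) (\<lambda>_. replicate_pmf T (geo n)))
     \<le> (\<Prod>v\<in>S. ennreal (decay ^ T * potential E s v))"
proof (induction T arbitrary: s)
  case 0
  have "S \<subseteq> V" using S by (simp add: separated_def)
  then show ?case by (simp add: Pi_pmf_return_pmf[OF finV])
next
  case (Suc T)
  let ?P = "Pi_pmf V 0 (\<lambda>_. geo n)" and ?Q = "Pi_pmf V (replicate T 0) (\<lambda>_. replicate_pmf T (geo n))"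
  let ?y = "\<lambda>g xs v. if v \<in> V then g v # xs v else replicate (Suc T) (0::nat)"
  let ?\<Phi> = "\<lambda>s. \<Prod>v\<in>S. ennreal (potential E s v)"
  have out: "g v = 0" if "g \<in> set_pmf ?P" "v \<notin> V" for g v
    using set_Pi_pmf_subset[OF finV, of 0 "\<lambda>_. geo n"] that by auto
  have outx: "x v = replicate T 0" if "x \<in> set_pmf ?Q" "v \<notin> V" for x v
    using set_Pi_pmf_subset[OF finV, of "replicate T 0" "\<lambda>_. replicate_pmf T (geo n)"] that by auto
  have "(\<integral>\<^sup>+x. ?\<Phi> (mrun E (Suc T) s x)
        \<partial>Pi_pmf V (replicate (Suc T) 0) (\<lambda>_. replicate_pmf (Suc T) (geo n)))
     = (\<integral>\<^sup>+g. \<integral>\<^sup>+xs. ?\<Phi> (mrun E (Suc T) s (?y g xs)) \<partial>?Q \<partial>?P)"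
    by (simp only: Pi_pmf_replicate_Suc nn_integral_bind_pmf nn_integral_map_pmf)
  also have "\<dots> = (\<integral>\<^sup>+g. \<integral>\<^sup>+xs. ?\<Phi> (mrun E T (mround E s g) xs) \<partial>?Q \<partial>?P)"
  proof (rule nn_integral_cong_AE, rule AE_pmfI)
    fix g assume g: "g \<in> set_pmf ?P"
    show "(\<integral>\<^sup>+xs. ?\<Phi> (mrun E (Suc T) s (?y g xs)) \<partial>?Q)
        = (\<integral>\<^sup>+xs. ?\<Phi> (mrun E T (mround E s g) xs) \<partial>?Q)"
    proof (rule nn_integral_cong_AE, rule AE_pmfI)
      fix xs assume xs: "xs \<in> set_pmf ?Q"
      have "(\<lambda>v. hd (?y g xs v)) = g" using out[OF g] by auto
      moreover have "(\<lambda>v. tl (?y g xs v)) = xs" using outx[OF xs] by auto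
      ultimately show "?\<Phi> (mrun E (Suc T) s (?y g xs)) = ?\<Phi> (mrun E T (mround E s g) xs)"
        by (simp only: mrun.simps)
    qed
  qed
  also have "\<dots> \<le> (\<integral>\<^sup>+g. (\<Prod>v\<in>S. ennreal (decay ^ T * potential E (mround E s g) v)) \<partial>?P)"
  proof (intro nn_integral_mono Suc.IH)
    fix g v
    show "1 \<le> level (mround E s g) v \<and> level (mround E s g) v + T \<le> n"
      using Suc.prems[of v] by (auto simp: mround_simps)
  qed
  also have "\<dots> = (\<integral>\<^sup>+g. (\<Prod>v\<in>S. ennreal (decay ^ T)) * ?\<Phi> (mround E s g) \<partial>?P)"
    using decay_bounds by (simp add: ennreal_mult' prod.distrib)
  also have "\<dots> = (\<Prod>v\<in>S. ennreal (decay ^ T)) * (\<integral>\<^sup>+g. ?\<Phi> (mround E s g) \<partial>?P)"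
    by (rule nn_integral_cmult) simp
  also have "\<dots> \<le> (\<Prod>v\<in>S. ennreal (decay ^ T)) * (\<Prod>v\<in>S. ennreal (decay * potential E s v))"
  proof (intro mult_left_mono round_decay S)
    fix v show "1 \<le> level s v \<and> level s v \<le> n" using Suc.prems[of v] by simp
  qed simp
  also have "\<dots> = (\<Prod>v\<in>S. ennreal (decay ^ T) * ennreal (decay * potential E s v))"
    by (rule prod.distrib[symmetric])
  also have "\<dots> = (\<Prod>v\<in>S. ennreal (decay ^ Suc T * potential E s v))"
    using decay_bounds by (intro prod.cong refl) (simp add: ennreal_mult'[symmetric] mult_ac)
  finally show ?case .
qed

text \<open>Markov's inequality for the product of the potentials: each factor is at least 1 while
  its vertex is undecided, and starts at no more than \<open>2 * (D + 1)\<close>.\<close>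

lemma prob_all_alive:
  assumes S: "separated S" and deg: "\<And>v. v \<in> V \<Longrightarrow> card {u. E v u} \<le> D" and n: "T + 1 \<le> n"
  shows "measure_pmf.prob (Pi_pmf V (replicate T 0) (\<lambda>_. replicate_pmf T (geo n)))
     {x. \<forall>v\<in>S. alive (mrun E T mstart x) v} \<le> (2 * (real D + 1) * decay ^ T) ^ card S"
proof -
  let ?P = "Pi_pmf V (replicate T 0) (\<lambda>_. replicate_pmf T (geo n))"
  let ?A = "{x. \<forall>v\<in>S. alive (mrun E T mstart x) v}"
  have pot: "potential E mstart v \<le> 2 * (real D + 1)" if "v \<in> S" for v
  proof -
    have "v \<in> V" using S that by (auto simp: separated_def)
    have "edeg E mstart v \<le> (\<Sum>u\<in>{u. E v u}. 1)"
      unfolding edeg_def by (rule sum_mono) (simp add: desire_def mstart_def level_def)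
    also have "\<dots> \<le> real D" using deg[OF \<open>v \<in> V\<close>] by simp
    finally have "max 1 (edeg E mstart v) \<le> real D + 1" by simp
    then have "max 1 (edeg E mstart v) powr deg_exp \<le> (real D + 1) powr deg_exp"
      using exps_pos by (intro powr_mono2) auto
    also have "\<dots> \<le> (real D + 1) powr 1" using exps_pos by (intro powr_mono) auto
    finally have 1: "max 1 (edeg E mstart v) powr deg_exp \<le> real D + 1" by simp
    have "2 powr (level_exp * real (level mstart v)) \<le> 2 powr (1::real)"
      using exps_pos by (intro powr_mono) (auto simp: level_exp_def level_def mstart_def)
    then have "max 1 (edeg E mstart v) powr deg_exp * 2 powr (level_exp * real (level mstart v)) \<le> (real D + 1) * 2"
      using 1 by (intro mult_mono) auto
    then show ?thesis by (simp add: potential_def mult.commute)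
  qed
  have "emeasure ?P ?A = (\<integral>\<^sup>+x. indicator ?A x \<partial>?P)" by simp
  also have "\<dots> \<le> (\<integral>\<^sup>+x. (\<Prod>v\<in>S. ennreal (potential E (mrun E T mstart x) v)) \<partial>?P)"
  proof (rule nn_integral_mono)
    fix x
    have "(\<Prod>v\<in>S. (1::ennreal)) \<le> (\<Prod>v\<in>S. ennreal (potential E (mrun E T mstart x) v))" if "x \<in> ?A"
      by (rule prod_mono_ennreal) (use that potential_ge_1 in auto)
    then show "indicator ?A x \<le> (\<Prod>v\<in>S. ennreal (potential E (mrun E T mstart x) v))"
      by (cases "x \<in> ?A") auto
  qed
  also have "\<dots> \<le> (\<Prod>v\<in>S. ennreal (decay ^ T * potential E mstart v))"
    by (rule run_decay[OF S]) (use n in \<open>simp add: level_def mstart_def\<close>)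
  also have "\<dots> \<le> (\<Prod>v\<in>S. ennreal (2 * (real D + 1) * decay ^ T))"
    by (rule prod_mono_ennreal, rule ennreal_leI)
       (use pot decay_bounds in \<open>simp add: mult.commute mult_left_mono\<close>)
  also have "\<dots> = ennreal ((2 * (real D + 1) * decay ^ T) ^ card S)"
    using decay_bounds by (simp add: ennreal_power)
  finally show ?thesis
    using decay_bounds by (simp add: measure_pmf.emeasure_eq_measure)
qed

end

subsection \<open>Shattering\<close>

lemma nat_first_failure:
  fixes P :: "nat \<Rightarrow> bool"
  assumes "P 0" "\<not> P t"
  shows "\<exists>k<t. P k \<and> \<not> P (Suc k)"
  using assms(2) by (induction t) (use assms(1) less_Suc_eq in auto)

lemma rtranclp_crossing:
  assumes "R\<^sup>*\<^sup>* v w" "Q v" "\<not> Q w"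
  shows "\<exists>x y. R\<^sup>*\<^sup>* v x \<and> R x y \<and> Q x \<and> \<not> Q y"
  using assms by (induction rule: rtranclp_induct) blast+

definition reach :: "(nat \<Rightarrow> nat \<Rightarrow> bool) \<Rightarrow> nat set \<Rightarrow> nat \<Rightarrow> nat set" where
  "reach E A v = {w. (induced E A)\<^sup>*\<^sup>* v w}"

context graph_ctx
begin

text \<open>A longest such list inside a component with entries at pairwise distance at least 5 has the
  whole component in the 4-balls around its entries.\<close>

primrec clists :: "nat \<Rightarrow> nat list set" where
  "clists 0 = (\<lambda>v. [v]) ` V"
| "clists (Suc t) = (\<Union>us\<in>clists t. (\<lambda>w. w # us) ` (\<Union>u\<in>set us. nball E 5 u))"

lemma clists_length: "us \<in> clists t \<Longrightarrow> length us = Suc t"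
  by (induction t arbitrary: us) auto

lemma clists_near: "us \<in> clists t \<Longrightarrow> u \<in> set us \<Longrightarrow> v \<in> set us \<Longrightarrow> u \<in> nball E (5 * t) v"
proof (induction t arbitrary: us u v)
  case (Suc t)
  then obtain w vs x where us: "us = w # vs" "vs \<in> clists t" "x \<in> set vs" "w \<in> nball E 5 x" by auto
  have xw: "x \<in> nball E 5 w" using nball_sym[OF Esym us(4)] .
  have IH: "a \<in> nball E (5 * t) b" if "a \<in> set vs" "b \<in> set vs" for a b
    using Suc.IH[OF us(2)] that by blast
  consider "u = w" "v = w" | "u = w" "v \<in> set vs" | "u \<in> set vs" "v = w" | "u \<in> set vs" "v \<in> set vs"
    using Suc.prems us by auto
  then show ?case
  proof cases
    case 1
    then show ?thesis by simp
  next
    case 2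
    then show ?thesis using nball_trans[OF IH[OF us(3) 2(2)] us(4)] by (simp add: add.commute)
  next
    case 3
    then show ?thesis using nball_trans[OF xw IH[OF 3(1) us(3)]] by simp
  next
    case 4
    then show ?thesis using IH[of u v] nball_mono[of "5 * t" "5 * Suc t" E v] by auto
  qed
qed auto

lemma card_clists:
  assumes deg: "\<And>v. card {u. E v u} \<le> D" and "t \<le> m"
  shows "finite (clists t) \<and> card (clists t) \<le> card V * (m * (D + 1) ^ 5) ^ t"
  using assms(2)
proof (induction t)
  case 0
  then show ?case using card_image_le[OF finV] finV by simp
next
  case (Suc t)
  let ?B = "(D + 1) ^ 5"
  have IH: "finite (clists t)" "card (clists t) \<le> card V * (m * ?B) ^ t" using Suc by auto
  have nb: "finite (nball E 5 u)" "card (nball E 5 u) \<le> ?B" for u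
    using finite_card_nball[OF finN deg, where r = 5] by auto
  have one: "card ((\<lambda>w. w # us) ` (\<Union>u\<in>set us. nball E 5 u)) \<le> m * ?B" if "us \<in> clists t" for us
  proof -
    have "card ((\<lambda>w. w # us) ` (\<Union>u\<in>set us. nball E 5 u)) \<le> card (\<Union>u\<in>set us. nball E 5 u)"
      by (rule card_image_le) (use nb in auto)
    also have "\<dots> \<le> (\<Sum>u\<in>set us. card (nball E 5 u))" by (rule card_UN_le) simp
    also have "\<dots> \<le> (\<Sum>u\<in>set us. ?B)" by (rule sum_mono) (use nb in auto)
    also have "\<dots> = card (set us) * ?B" by simp
    also have "\<dots> \<le> m * ?B"
      using card_length[of us] clists_length[OF that] Suc.prems by (intro mult_right_mono) auto
    finally show ?thesis .
  qed
  have "finite (clists (Suc t))" using IH nb by auto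
  moreover have "card (clists (Suc t)) \<le> card V * (m * ?B) ^ Suc t"
  proof -
    have "card (clists (Suc t)) \<le> (\<Sum>us\<in>clists t. card ((\<lambda>w. w # us) ` (\<Union>u\<in>set us. nball E 5 u)))"
      unfolding clists.simps by (rule card_UN_le[OF IH(1)])
    also have "\<dots> \<le> (\<Sum>us\<in>clists t. m * ?B)" by (rule sum_mono) (rule one)
    also have "\<dots> = card (clists t) * (m * ?B)" by simp
    also have "\<dots> \<le> card V * (m * ?B) ^ t * (m * ?B)" by (rule mult_right_mono[OF IH(2)]) simp
    also have "\<dots> = card V * (m * ?B) ^ Suc t" by (simp only: power_Suc mult_ac)
    finally show ?thesis .
  qed
  ultimately show ?case by blast
qed

definition shattered :: "nat \<Rightarrow> nat \<Rightarrow> nat set \<Rightarrow> bool" where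
  "shattered D t A \<longleftrightarrow> (\<forall>v\<in>A. reach E A v \<subseteq> nball E (5 * t) v \<and> finite (reach E A v)
      \<and> card (reach E A v) \<le> t * (D + 1) ^ 4)"

lemma not_shattered:
  assumes A: "A \<subseteq> V" and deg: "\<And>v. card {u. E v u} \<le> D" and ns: "\<not> shattered D t A"
  shows "\<exists>us\<in>clists t. distinct us \<and> separated (set us) \<and> set us \<subseteq> A"
proof (rule ccontr)
  assume no: "\<not> ?thesis"
  have "reach E A v \<subseteq> nball E (5 * t) v \<and> finite (reach E A v) \<and> card (reach E A v) \<le> t * (D + 1) ^ 4"
    if v: "v \<in> A" for v
  proof -
    let ?C = "reach E A v"
    \<comment> \<open>Keeping \<open>v\<close> in the list turns the distance bound between entries
      into a radius around \<open>v\<close>.\<close>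
    define P where "P = (\<lambda>k. \<exists>us\<in>clists k. distinct us \<and> separated (set us) \<and> set us \<subseteq> ?C \<and> v \<in> set us)"
    have CA: "?C \<subseteq> A" using induced_rtranclp_in v by (auto simp: reach_def)
    have "P 0" unfolding P_def
      by (rule bexI[of _ "[v]"]) (use v A in \<open>auto simp: separated_def reach_def\<close>)
    moreover have "\<not> P t" using no CA unfolding P_def by blast
    ultimately obtain k where k: "k < t" "P k" "\<not> P (Suc k)" using nat_first_failure by blast
    then obtain us where us: "us \<in> clists k" "distinct us" "separated (set us)" "set us \<subseteq> ?C" "v \<in> set us"
      unfolding P_def by blast
    have cover: "?C \<subseteq> (\<Union>u\<in>set us. nball E 4 u)"
    proof
      fix w assume "w \<in> ?C"
      then have vw: "(induced E A)\<^sup>*\<^sup>* v w" by (simp add: reach_def)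
      show "w \<in> (\<Union>u\<in>set us. nball E 4 u)"
      proof (rule ccontr)
        assume "w \<notin> (\<Union>u\<in>set us. nball E 4 u)"
        \<comment> \<open>The path to an uncovered vertex leaves the 4-balls across some edge; the
          far end of that edge is at distance 5 from an entry and extends the list.\<close>
        then obtain x y where xy: "(induced E A)\<^sup>*\<^sup>* v x" "induced E A x y"
            "x \<in> (\<Union>u\<in>set us. nball E 4 u)" "y \<notin> (\<Union>u\<in>set us. nball E 4 u)"
          using rtranclp_crossing[OF vw, of "\<lambda>x. x \<in> (\<Union>u\<in>set us. nball E 4 u)"] us(5) by auto
        then obtain u where u: "u \<in> set us" "x \<in> nball E 4 u" by auto
        have "E x y" using xy(2) by (simp add: induced_def)
        then have "y \<in> nball E 5 u" using nball_step[OF u(2), of y] by simp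
        then have "y # us \<in> clists (Suc k)" using us(1) u(1) by auto
        moreover have "distinct (y # us)" using us(2) xy(4) by auto
        moreover have "y \<in> ?C" using xy(1,2) by (auto simp: reach_def)
        moreover have "separated (set (y # us))"
        proof -
          have "a \<notin> nball E 4 y" if "a \<in> set us" for a
          proof
            assume a: "a \<in> nball E 4 y"
            have "y \<in> nball E 4 a" using nball_sym[OF Esym a] .
            then show False using that xy(4) by auto
          qed
          then show ?thesis using us(3) xy(4) \<open>y \<in> ?C\<close> CA A by (auto simp: separated_def)
        qed
        ultimately have "P (Suc k)" using us(4,5) unfolding P_def by (intro bexI[of _ "y # us"]) auto
        then show False using k by simp
      qed
    qed
    have nb: "finite (nball E 4 u)" "card (nball E 4 u) \<le> (D + 1) ^ 4" for u
      using finite_card_nball[OF finN deg, where r = 4] by auto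
    have "?C \<subseteq> nball E (5 * t) v"
    proof
      fix w assume "w \<in> ?C"
      then obtain u where u: "u \<in> set us" "w \<in> nball E 4 u" using cover by auto
      have "w \<in> nball E (5 * k + 4) v" using nball_trans[OF clists_near[OF us(1) u(1) us(5)] u(2)] .
      then show "w \<in> nball E (5 * t) v" using nball_mono[of "5 * k + 4" "5 * t" E v] k(1) by auto
    qed
    moreover have "finite ?C" using cover nb by (auto intro: finite_subset)
    moreover have "card ?C \<le> t * (D + 1) ^ 4"
    proof -
      have "card ?C \<le> card (\<Union>u\<in>set us. nball E 4 u)" by (rule card_mono[OF _ cover]) (use nb in auto)
      also have "\<dots> \<le> (\<Sum>u\<in>set us. card (nball E 4 u))" by (rule card_UN_le) simp
      also have "\<dots> \<le> (\<Sum>u\<in>set us. (D + 1) ^ 4)" by (rule sum_mono) (use nb in auto)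
      also have "\<dots> = card (set us) * (D + 1) ^ 4" by simp
      also have "\<dots> \<le> t * (D + 1) ^ 4"
        using card_length[of us] clists_length[OF us(1)] k(1) by (intro mult_right_mono) auto
      finally show ?thesis .
    qed
    ultimately show ?thesis by blast
  qed
  then show False using ns by (auto simp: shattered_def)
qed

text \<open>Union bound over the at most \<open>card V * (t * (D + 1) ^ 5) ^ t\<close> lists, each
  of which survives as a separated set of \<open>t + 1\<close> vertices.\<close>

lemma prob_not_shattered:
  assumes deg: "\<And>v. card {u. E v u} \<le> D" and n: "T + 1 \<le> n" and t: "1 \<le> t"
  shows "measure_pmf.prob (Pi_pmf V (replicate T 0) (\<lambda>_. replicate_pmf T (geo n)))
     {x. \<not> shattered D t {v \<in> V. alive (mrun E T mstart x) v}}
    \<le> real (card V) * (2 * real t * (real D + 1) ^ 6 * decay ^ T) ^ Suc t"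
proof -
  let ?P = "Pi_pmf V (replicate T 0) (\<lambda>_. replicate_pmf T (geo n))"
  let ?A = "\<lambda>us. {x. \<forall>v\<in>set us. alive (mrun E T mstart x) v}"
  let ?q = "2 * (real D + 1) * decay ^ T"
  define Us where "Us = {us \<in> clists t. distinct us \<and> separated (set us)}"
  have cl: "finite (clists t)" "card (clists t) \<le> card V * (t * (D + 1) ^ 5) ^ t"
    using card_clists[OF deg, of t t] by auto
  have fin: "finite Us" using cl by (simp add: Us_def)
  have "{x. \<not> shattered D t {v \<in> V. alive (mrun E T mstart x) v}} \<subseteq> (\<Union>us\<in>Us. ?A us)"
  proof
    fix x assume "x \<in> {x. \<not> shattered D t {v \<in> V. alive (mrun E T mstart x) v}}"
    then obtain us where "us \<in> clists t" "distinct us" "separated (set us)"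
        "set us \<subseteq> {v \<in> V. alive (mrun E T mstart x) v}"
      using not_shattered[of "{v \<in> V. alive (mrun E T mstart x) v}", OF _ deg] by blast
    then show "x \<in> (\<Union>us\<in>Us. ?A us)" unfolding Us_def by blast
  qed
  then have "measure_pmf.prob ?P {x. \<not> shattered D t {v \<in> V. alive (mrun E T mstart x) v}}
      \<le> measure_pmf.prob ?P (\<Union>us\<in>Us. ?A us)"
    by (intro measure_pmf.finite_measure_mono) auto
  also have "\<dots> \<le> (\<Sum>us\<in>Us. measure_pmf.prob ?P (?A us))"
    by (rule measure_pmf.finite_measure_subadditive_finite[OF fin]) auto
  also have "\<dots> \<le> (\<Sum>us\<in>Us. ?q ^ Suc t)"
  proof (rule sum_mono)
    fix us assume us: "us \<in> Us"
    have "card (set us) = Suc t" using us clists_length by (auto simp: Us_def distinct_card)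
    then show "measure_pmf.prob ?P (?A us) \<le> ?q ^ Suc t"
      using prob_all_alive[of "set us" D T n, OF _ deg n] us by (simp add: Us_def)
  qed
  also have "\<dots> = real (card Us) * ?q ^ Suc t" by simp
  also have "\<dots> \<le> real (card (clists t)) * ?q ^ Suc t"
    using card_mono[OF cl(1), of Us] decay_bounds by (intro mult_right_mono) (auto simp: Us_def)
  also have "\<dots> \<le> real (card V * (t * (D + 1) ^ 5) ^ t) * ?q ^ Suc t"
    using cl(2) decay_bounds by (intro mult_right_mono) (simp_all only: of_nat_le_iff, auto)
  also have "\<dots> = real (card V) * ((real t * (real D + 1) ^ 5) ^ t * ?q ^ Suc t)"
    by (simp add: mult.assoc add.commute)
  \<comment> \<open>One spare factor of at least 1 makes both exponents \<open>Suc t\<close>, so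
    that everything merges into a single power.\<close>
  also have "\<dots> \<le> real (card V) * ((real t * (real D + 1) ^ 5) ^ Suc t * ?q ^ Suc t)"
  proof (intro mult_left_mono mult_right_mono)
    have "1 \<le> real t * (real D + 1) ^ 5" using t mult_mono[of 1 "real t" 1 "(real D + 1) ^ 5"] by simp
    then show "(real t * (real D + 1) ^ 5) ^ t \<le> (real t * (real D + 1) ^ 5) ^ Suc t"
      by (intro power_increasing) auto
  qed (use decay_bounds in auto)
  also have "(real t * (real D + 1) ^ 5) ^ Suc t * ?q ^ Suc t = (real t * (real D + 1) ^ 5 * ?q) ^ Suc t"
    by (rule power_mult_distrib[symmetric])
  also have "real t * (real D + 1) ^ 5 * ?q = 2 * real t * (real D + 1) ^ 6 * decay ^ T"
    by (simp add: eval_nat_numeral mult_ac)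
  finally show ?thesis .
qed

end

subsection \<open>The bound for arbitrary maximum degree\<close>

lemma is_local_mrun_start: "is_local (2 * T) (\<lambda>E x. mrun E T mstart x)"
proof -
  have "is_local 0 (\<lambda>E (x :: nat \<Rightarrow> nat list) v. (mstart v, x v))"
    by (rule is_local_pointwise)
  from is_local_comp[OF this is_local_mrun[of T]] show ?thesis by simp
qed

lemma solve_comps_restrict:
  assumes "nball E R v \<subseteq> V"
  shows "solve_comps R E U v = solve_comps R E (U \<inter> V) v"
proof -
  have "U \<inter> V \<inter> nball E R v = U \<inter> nball E R v" using assms by auto
  then show ?thesis using assms by (auto simp: solve_comps_def local_comp_def)
qed

context graph_ctx
begin

lemma solve_comps_finish:
  assumes p: "partial_mis V E {v \<in> V. a v} {v \<in> V. i v}"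
    and rad: "\<And>v. v \<in> V \<Longrightarrow> a v \<Longrightarrow> reach E {v \<in> V. a v} v \<subseteq> nball E R v"
  shows "maximal_independent_set V E {v \<in> V. i v \<or> solve_comps R E {u. a u} v}"
proof -
  have "{u. a u} \<inter> V = {v \<in> V. a v}" by auto
  then have "solve_comps R E {u. a u} v = solve_comps R E {v \<in> V. a v} v" if "v \<in> V" for v
    using solve_comps_restrict[OF nball_closed[OF that, of R], of "{u. a u}"] by (simp only:)
  moreover have "v \<in> V" if "solve_comps R E {v \<in> V. a v} v" for v
    using that by (simp add: solve_comps_def)
  ultimately have eq: "{v \<in> V. i v \<or> solve_comps R E {u. a u} v}
      = {v \<in> V. i v} \<union> {v. solve_comps R E {v \<in> V. a v} v}" by auto
  have "mis_on E {v \<in> V. a v} {v. solve_comps R E {v \<in> V. a v} v}"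
    by (rule solve_comps_correct[OF Esym Eirr])
       (use finV rad in \<open>auto simp: reach_def\<close>)
  from partial_mis_complete[OF p Esym this] show ?thesis
    unfolding eq by (rule mis_on_maximal)
qed

end

text \<open>\<open>B\<close> is the exponent won per list entry: the failure bound becomes
  \<open>card V * exp (- B) ^ Suc t\<close>, so \<open>B * Suc t\<close> has to reach a multiple of
  log N.\<close>

lemma shatter_params:
  assumes "1 \<le> t" "(ln 2 + ln (real t) + 6 * ln (real D + 1) + B) / (join_prob / 40) \<le> real T"
  shows "2 * real t * (real D + 1) ^ 6 * decay ^ T \<le> exp (- B)"
proof -
  have "ln 2 + ln (real t) + 6 * ln (real D + 1) + B \<le> real T * (join_prob / 40)"
    using assms(2) join_prob_bounds by (subst (asm) pos_divide_le_eq) auto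
  then have "exp (ln 2 + ln (real t) + 6 * ln (real D + 1) - real T * (join_prob / 40)) \<le> exp (- B)"
    by simp
  also have "exp (ln 2 + ln (real t) + 6 * ln (real D + 1) - real T * (join_prob / 40))
      = 2 * real t * (real D + 1) ^ 6 * decay ^ T"
  proof -
    have "exp (6 * ln (real D + 1)) = (real D + 1) ^ 6"
      using exp_of_nat_mult[of 6 "ln (real D + 1)"] by simp
    moreover have "exp (- (real T * (join_prob / 40))) = decay ^ T"
      using exp_of_nat_mult[of T "- (join_prob / 40)"] by (simp add: decay_def)
    moreover have "exp (ln 2 + ln (real t) + 6 * ln (real D + 1) - real T * (join_prob / 40))
        = exp (ln 2) * exp (ln (real t)) * exp (6 * ln (real D + 1)) * exp (- (real T * (join_prob / 40)))"
      by (simp only: diff_conv_add_uminus exp_add)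
    ultimately show ?thesis using assms(1) by simp
  qed
  finally show ?thesis .
qed

lemma tail_le:
  assumes "c > 0"
  shows "real N * exp (- ((c + 1) * ln (real N + 2))) \<le> 1 / (real N powr c)"
proof (cases "N = 0")
  case False
  have "exp (- ((c + 1) * ln (real N + 2))) \<le> exp (- ((c + 1) * ln (real N)))"
    using assms False by simp
  also have "\<dots> = real N powr (- (c + 1))" using False by (simp add: powr_def algebra_simps)
  finally have "real N * exp (- ((c + 1) * ln (real N + 2))) \<le> real N powr 1 * real N powr (- (c + 1))"
    using False by (simp add: mult_left_mono)
  also have "\<dots> = 1 / (real N powr c)"
    unfolding powr_add[symmetric] by (simp add: powr_minus_divide)
  finally show ?thesis .
qed simp

lemma nat_ceiling_bounds:
  "0 \<le> x \<Longrightarrow> x \<le> real (nat \<lceil>x\<rceil>)" "0 \<le> x \<Longrightarrow> real (nat \<lceil>x\<rceil>) \<le> x + 1"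
  by linarith+

text \<open>With \<open>B = (c + 1) * r N\<close> and \<open>t\<close> about \<open>r N\<close>, the
  failure exponent is a product of two numbers of order sqrt(log N), while the rounds only pay their
  sum plus O(log D). That sum is below the stated product because both of its factors are bounded
  away from 0.\<close>

theorem general_degree:
  fixes c :: real
  assumes c: "c > 0"
  shows "\<exists>(A::local_alg) (T::nat \<Rightarrow> nat \<Rightarrow> nat) (C::real). C > 0
    \<and> (\<forall>N D. real (T N D) \<le> C * ln (real D + 2) * sqrt (ln (real N + 2)))
    \<and> (\<forall>N D V E. admissible N D V E \<longrightarrow>
          success_prob A N D (T N D) V E \<ge> 1 - 1 / (real N powr c))"
proof -
  define \<kappa> where "\<kappa> = join_prob / 40"
  define r where "r = (\<lambda>N. sqrt (ln (real N + 2)))"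
  define t where "t = (\<lambda>N. nat \<lceil>r N\<rceil>)"
  define x where "x = (\<lambda>N D. (ln 2 + ln (real (t N)) + 6 * ln (real D + 1) + (c + 1) * r N) / \<kappa>)"
  define T where "T = (\<lambda>N D. nat \<lceil>x N D\<rceil>)"
  define F where "F = (\<lambda>N D E y v. chosen (mrun E (T N D) mstart y) v
      \<or> solve_comps (5 * t N) E {u. alive (mrun E (T N D) mstart y) u} v)"
  define R where "R = (\<lambda>N D. 2 * T N D + 5 * t N)"
  have \<kappa>: "0 < \<kappa>" using join_prob_bounds by (simp add: \<kappa>_def)
  have r: "2/3 \<le> r N" for N
  proof -
    have "(2/3 :: real)\<^sup>2 \<le> ln 2" using ln2_ge_two_thirds by (simp add: power2_eq_square)
    also have "\<dots> \<le> ln (real N + 2)" by simp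
    finally show ?thesis unfolding r_def by (rule real_le_rsqrt)
  qed
  have r2: "r N * r N = ln (real N + 2)" for N by (simp add: r_def)
  have t12: "r N \<le> real (t N)" "real (t N) \<le> r N + 1" for N
    using nat_ceiling_bounds[of "r N"] r[of N] by (auto simp: t_def)
  have t3: "1 \<le> t N" for N using t12(1)[of N] r[of N] by (cases "t N") auto
  note t = t12 t3
  have x0: "0 \<le> x N D" for N D
    using t(3)[of N] r[of N] c \<kappa> by (auto simp: x_def intro!: divide_nonneg_pos add_nonneg_nonneg)
  have T: "x N D \<le> real (T N D)" "real (T N D) \<le> x N D + 1" for N D
    using nat_ceiling_bounds[OF x0] by (auto simp: T_def)
  have loc: "is_local (R N D) (F N D)" for N D
  proof -
    let ?G = "\<lambda>E s v. chosen s v \<or> solve_comps (5 * t N) E {u. alive s u} v"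
    have "is_local (5 * t N) (\<lambda>E. chosen)"
      unfolding chosen_def by (rule is_local_mono[OF is_local_pointwise]) simp
    from is_local_app[OF this is_local_solve_comps[of _ fst], where h = "(\<or>)"]
    have "is_local (5 * t N) ?G" by (simp add: alive_def)
    from is_local_comp[OF is_local_mrun_start this] show ?thesis by (simp add: F_def R_def)
  qed
  obtain A where A: "\<And>N D V E. simple_graph V E \<Longrightarrow> success_prob A N D (R N D) V E =
     measure_pmf.prob (Pi_pmf V (replicate (T N D) 0) (\<lambda>_. replicate_pmf (T N D) (geo (T N D + 1))))
       {y. maximal_independent_set V E {v \<in> V. F N D E y v}}"
    using local_computable[where P = "\<lambda>N D. replicate_pmf (T N D) (geo (T N D + 1))"
        and d = "\<lambda>N D. replicate (T N D) 0" and F = F and R = R, OF coin_gen_replicate[OF coin_gen_geo] loc] by blast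
  \<comment> \<open>Every term is measured in units of \<open>a * r N\<close>, where both factors
    are at least 2/3: a constant 1 costs 9/4, a single \<open>a\<close> or \<open>r N\<close> costs
    3/2.\<close>
  define C where "C = 2 / \<kappa> * (9/4 + 3/2 + 9 + 3/2 * (c + 1)) + 9/4 * 7 + 15/2"
  show ?thesis
  proof (intro exI[of _ A] exI[of _ R] exI[of _ C] conjI allI impI)
    have "0 \<le> 2 / \<kappa> * (9/4 + 3/2 + 9 + 3/2 * (c + 1))" using \<kappa> c by (intro mult_nonneg_nonneg) auto
    then show "C > 0" by (simp add: C_def)
  next
    fix N D
    define a where "a = ln (real D + 2)"
    have "ln 2 \<le> ln (real D + 2)" by simp
    then have a: "2/3 \<le> a" using ln2_ge_two_thirds unfolding a_def by linarith
    have ar: "4/9 \<le> a * r N" "r N \<le> 3/2 * (a * r N)" "a \<le> 3/2 * (a * r N)"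
      using mult_mono[OF a r[of N]] mult_right_mono[OF a, of "r N"] mult_left_mono[OF r[of N], of a] a r[of N]
      by auto
    have "ln (real (t N)) \<le> r N" using ln_le_minus_one[of "real (t N)"] t(2,3)[of N] by simp
    moreover have "ln (real D + 1) \<le> a" by (simp add: a_def)
    moreover have "ln (2 :: real) \<le> 1" using ln_le_minus_one[of "2::real"] by simp
    ultimately have "x N D \<le> (1 + r N + 6 * a + (c + 1) * r N) / \<kappa>"
      unfolding x_def using \<kappa> by (intro divide_right_mono) auto
    also have "\<dots> \<le> ((9/4 + 3/2 + 9 + 3/2 * (c + 1)) * (a * r N)) / \<kappa>"
    proof (intro divide_right_mono)
      have "(c + 1) * r N \<le> (c + 1) * (3/2 * (a * r N))" using ar c by (intro mult_left_mono) auto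
      moreover have "(9/4 + 3/2 + 9 + 3/2 * (c + 1)) * p = 9/4 * p + 3/2 * p + 9 * p + (c + 1) * (3/2 * p)" for p
        by (simp add: field_simps)
      moreover have "1 + r N + 6 * a \<le> 9/4 * (a * r N) + 3/2 * (a * r N) + 9 * (a * r N)" using ar by simp
      ultimately show "1 + r N + 6 * a + (c + 1) * r N \<le> (9/4 + 3/2 + 9 + 3/2 * (c + 1)) * (a * r N)"
        by (metis add_mono)
    qed (use \<kappa> in simp)
    finally have "2 * x N D \<le> 2 / \<kappa> * (9/4 + 3/2 + 9 + 3/2 * (c + 1)) * (a * r N)"
      using \<kappa> by (simp add: field_simps)
    moreover have "real (R N D) \<le> 2 * x N D + 2 + 5 * r N + 5"
      using T(2)[of N D] t(2)[of N] by (simp add: R_def)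
    moreover have "2 + 5 * r N + 5 \<le> (9/4 * 7 + 15/2) * (a * r N)" using ar by simp
    ultimately have "real (R N D) \<le> C * (a * r N)" unfolding C_def by (simp add: distrib_right)
    then show "real (R N D) \<le> C * ln (real D + 2) * sqrt (ln (real N + 2))"
      by (simp add: a_def r_def)
  next
    fix N D V E assume adm: "admissible N D V E"
    then interpret graph_ctx V E by unfold_locales (simp add: admissible_def)
    have card: "card V \<le> N" using adm by (simp add: admissible_def)
    have deg: "card {u. E v u} \<le> D" for v
    proof (cases "v \<in> V")
      case True
      then show ?thesis using adm by (simp add: admissible_def neighbors_def)
    next
      case False
      then have "{u. E v u} = {}" using EV by auto
      then show ?thesis by simp
    qed
    let ?P = "Pi_pmf V (replicate (T N D) 0) (\<lambda>_. replicate_pmf (T N D) (geo (T N D + 1)))"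
    let ?S = "\<lambda>y. shattered D (t N) {v \<in> V. alive (mrun E (T N D) mstart y) v}"
    have good: "maximal_independent_set V E {v \<in> V. F N D E y v}" if "?S y" for y
      unfolding F_def
      by (rule solve_comps_finish[OF mrun_mstart_partial_mis])
         (use that in \<open>simp add: shattered_def\<close>)
    let ?q = "2 * real (t N) * (real D + 1) ^ 6 * decay ^ T N D"
    have q: "?q \<le> exp (- ((c + 1) * r N))"
      by (rule shatter_params[OF t(3)]) (use T(1)[of N D] in \<open>simp add: x_def \<kappa>_def\<close>)
    have "measure_pmf.prob ?P {y. \<not> ?S y} \<le> real (card V) * ?q ^ Suc (t N)"
      by (rule prob_not_shattered[OF deg _ t(3)]) simp
    also have "\<dots> \<le> real N * exp (- ((c + 1) * r N)) ^ Suc (t N)"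
      using card q decay_bounds by (intro mult_mono power_mono) auto
    also have "exp (- ((c + 1) * r N)) ^ Suc (t N) = exp (- ((c + 1) * (r N * real (Suc (t N)))))"
      by (subst exp_of_nat_mult[symmetric]) (simp add: mult_ac)
    also have "\<dots> \<le> exp (- ((c + 1) * ln (real N + 2)))"
    proof -
      have "r N * r N \<le> r N * real (Suc (t N))" using t(1)[of N] r[of N] by (intro mult_left_mono) auto
      then have "(c + 1) * ln (real N + 2) \<le> (c + 1) * (r N * real (Suc (t N)))"
        using c unfolding r2 by (intro mult_left_mono) auto
      then show ?thesis by simp
    qed
    also have "real N * exp (- ((c + 1) * ln (real N + 2))) \<le> 1 / (real N powr c)"
      by (rule tail_le[OF c])
    finally have bad: "measure_pmf.prob ?P {y. \<not> ?S y} \<le> 1 / (real N powr c)"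
      by (simp add: mult_left_mono)
    have "1 - measure_pmf.prob ?P {y. \<not> ?S y} = measure_pmf.prob ?P {y. ?S y}"
      using measure_pmf.prob_compl[of "{y. \<not> ?S y}" ?P] by (simp add: Collect_neg_eq Compl_eq_Diff_UNIV[symmetric])
    also have "\<dots> \<le> measure_pmf.prob ?P {y. maximal_independent_set V E {v \<in> V. F N D E y v}}"
      by (rule measure_pmf.finite_measure_mono) (use good in auto)
    also have "\<dots> = success_prob A N D (R N D) V E" using A[OF graph] by simp
    finally show "success_prob A N D (R N D) V E \<ge> 1 - 1 / (real N powr c)" using bad by linarith
  qed
qed

subsection \<open>Reducing the number of colours\<close>

text \<open>Gilbert--Varshamov: a maximal code already has enough words.\<close>

lemma hash_code_exists:
  assumes k: "k \<le> m"
  shows "\<exists>h :: nat \<Rightarrow> nat \<Rightarrow> nat. (\<forall>x<2 ^ k. \<forall>a<m. h x a < 2 * m)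
     \<and> (\<forall>x<2 ^ k. \<forall>y<2 ^ k. x \<noteq> y \<longrightarrow> card {a\<in>{..<m}. h x a = h y a} < k \<or> k = 0)"
proof -
  let ?q = "2 * m"
  define W where "W = PiE {..<m} (\<lambda>_. {..<?q})"
  define ag where "ag = (\<lambda>c w :: nat \<Rightarrow> nat. card {a\<in>{..<m}. c a = w a})"
  define good where "good = (\<lambda>C. C \<subseteq> W \<and> (\<forall>c\<in>C. \<forall>w\<in>C. c \<noteq> w \<longrightarrow> ag c w < k))"
  have finW: "finite W" unfolding W_def by (intro finite_PiE) auto
  have cardW: "card W = ?q ^ m" unfolding W_def by (simp add: card_PiE)
  have fin_good: "finite {C. good C}"
    by (rule finite_subset[of _ "Pow W"]) (use finW in \<open>auto simp: good_def\<close>)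
  have "{C. good C} \<noteq> {}" by (auto simp: good_def)
  then have "Max (card ` {C. good C}) \<in> card ` {C. good C}"
    by (intro Max_in) (use fin_good in auto)
  then obtain C where C: "good C" "card C = Max (card ` {C. good C})" by auto
  then have max: "card C' \<le> card C" if "good C'" for C'
    using fin_good that by simp
  have CW: "C \<subseteq> W" and finC: "finite C" using C(1) finW finite_subset by (auto simp: good_def)
  \<comment> \<open>Words that agree with \<open>c\<close> in at least \<open>k\<close> positions:
    choose \<open>k\<close> of these positions, in at most \<open>m ^ k\<close> ways, and fill the
    other positions freely.\<close>
  have ball: "card {w\<in>W. k \<le> ag c w} \<le> m ^ k * ?q ^ (m - k)" if c: "c \<in> W" for c
  proof -
    define KK where "KK = {K. K \<subseteq> {..<m} \<and> card K = k}"
    have "finite KK" unfolding KK_def by (rule finite_subset[of _ "Pow {..<m}"]) auto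
    have "card KK = m choose k" using n_subsets[of "{..<m}" k] by (simp add: KK_def)
    then have KKle: "card KK \<le> m ^ k" using binomial_le_pow[OF k] by simp
    have one: "card {w\<in>W. \<forall>a\<in>K. w a = c a} \<le> ?q ^ (m - k)" if "K \<in> KK" for K
    proof -
      have "{w\<in>W. \<forall>a\<in>K. w a = c a} \<subseteq> PiE {..<m} (\<lambda>a. if a \<in> K then {c a} else {..<?q})"
        using that by (auto simp: W_def PiE_iff extensional_def KK_def)
      then have "card {w\<in>W. \<forall>a\<in>K. w a = c a} \<le> card (PiE {..<m} (\<lambda>a. if a \<in> K then {c a} else {..<?q}))"
        by (intro card_mono finite_PiE) auto
      also have "\<dots> = (\<Prod>a<m. card (if a \<in> K then {c a} else {..<?q}))" by (simp add: card_PiE)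
      also have "\<dots> = (\<Prod>a<m. if a \<in> K then 1 else ?q)" by (intro prod.cong) auto
      also have "\<dots> = (\<Prod>a\<in>{..<m} - K. ?q)"
        by (rule prod.mono_neutral_cong_right) (use that in \<open>auto simp: KK_def\<close>)
      also have "\<dots> = ?q ^ (m - k)"
        using that finite_subset[of K "{..<m}"] by (simp add: KK_def card_Diff_subset)
      finally show ?thesis .
    qed
    have "{w\<in>W. k \<le> ag c w} \<subseteq> (\<Union>K\<in>KK. {w\<in>W. \<forall>a\<in>K. w a = c a})"
    proof
      fix w assume w: "w \<in> {w\<in>W. k \<le> ag c w}"
      then have le: "k \<le> card {a\<in>{..<m}. c a = w a}" by (simp add: ag_def)
      obtain K where K: "K \<subseteq> {a\<in>{..<m}. c a = w a}" "card K = k"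
        using obtain_subset_with_card_n[OF le] by blast
      then have "K \<in> KK" "w \<in> {w\<in>W. \<forall>a\<in>K. w a = c a}" using w by (auto simp: KK_def)
      then show "w \<in> (\<Union>K\<in>KK. {w\<in>W. \<forall>a\<in>K. w a = c a})" by (rule UN_I)
    qed
    then have "card {w\<in>W. k \<le> ag c w} \<le> card (\<Union>K\<in>KK. {w\<in>W. \<forall>a\<in>K. w a = c a})"
      by (rule card_mono[rotated]) (use finW \<open>finite KK\<close> in auto)
    also have "\<dots> \<le> (\<Sum>K\<in>KK. card {w\<in>W. \<forall>a\<in>K. w a = c a})" by (rule card_UN_le) fact
    also have "\<dots> \<le> (\<Sum>K\<in>KK. ?q ^ (m - k))" by (rule sum_mono) (rule one)
    also have "\<dots> = card KK * ?q ^ (m - k)" by simp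
    also have "\<dots> \<le> m ^ k * ?q ^ (m - k)" using KKle by (rule mult_right_mono) simp
    finally show ?thesis .
  qed
  have "2 ^ k \<le> card C"
  proof (rule ccontr)
    assume less: "\<not> 2 ^ k \<le> card C"
    have "W \<subseteq> (\<Union>c\<in>C. {w\<in>W. k \<le> ag c w})"
    proof
      fix w assume w: "w \<in> W"
      show "w \<in> (\<Union>c\<in>C. {w\<in>W. k \<le> ag c w})"
      proof (cases "w \<in> C")
        case True
        have "ag w w = m" by (simp add: ag_def)
        then show ?thesis using w k True by (intro UN_I[of w]) auto
      next
        case False
        have ng: "\<not> good (insert w C)"
        proof
          assume "good (insert w C)"
          then have "card (insert w C) \<le> card C" by (rule max)
          then show False using False finC by simp
        qed
        have C': "\<And>c d. c \<in> C \<Longrightarrow> d \<in> C \<Longrightarrow> c \<noteq> d \<Longrightarrow> ag c d < k"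
          using C(1) by (simp add: good_def)
        have sym: "ag c d = ag d c" for c d by (simp add: ag_def eq_commute)
        have "insert w C \<subseteq> W" using CW w by simp
        with ng have "\<not> (\<forall>c\<in>insert w C. \<forall>d\<in>insert w C. c \<noteq> d \<longrightarrow> ag c d < k)"
          unfolding good_def by (simp only: simp_thms)
        then obtain c d where cd: "c \<in> insert w C" "d \<in> insert w C" "c \<noteq> d" "\<not> ag c d < k" by blast
        have "c = w \<and> d \<in> C \<or> d = w \<and> c \<in> C" using C'[of c d] cd by auto
        then have "\<exists>c\<in>C. k \<le> ag c w" using cd(4) sym[of c d] by (metis leI)
        then show ?thesis using w by blast
      qed
    qed
    then have "card W \<le> card (\<Union>c\<in>C. {w\<in>W. k \<le> ag c w})"
      by (rule card_mono[rotated]) (use finW finC in auto)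
    also have "\<dots> \<le> (\<Sum>c\<in>C. card {w\<in>W. k \<le> ag c w})" by (rule card_UN_le[OF finC])
    also have "\<dots> \<le> (\<Sum>c\<in>C. m ^ k * ?q ^ (m - k))" by (rule sum_mono) (use ball CW in auto)
    also have "\<dots> = card C * (m ^ k * ?q ^ (m - k))" by simp
    finally have le: "?q ^ m \<le> card C * (m ^ k * ?q ^ (m - k))" by (simp add: cardW)
    show False
    proof (cases "m = 0")
      case True
      then show False using le less k by simp
    next
      case False
      \<comment> \<open>An alphabet of twice the length makes the count close exactly:
        \<open>2 ^ k * m ^ k = ?q ^ k\<close>.\<close>
      then have "card C * (m ^ k * ?q ^ (m - k)) < 2 ^ k * (m ^ k * ?q ^ (m - k))"
        using less by (intro mult_strict_right_mono) auto
      also have "\<dots> = ?q ^ k * ?q ^ (m - k)" by (simp add: power_mult_distrib)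
      also have "\<dots> = ?q ^ m" by (simp only: power_add[symmetric] le_add_diff_inverse[OF k])
      finally show False using le by simp
    qed
  qed
  from obtain_subset_with_card_n[OF this] obtain C' where C': "C' \<subseteq> C" "card C' = 2 ^ k" "finite C'"
    by metis
  obtain h where h: "bij_betw h {0..<2 ^ k :: nat} C'"
    using ex_bij_betw_nat_finite[OF C'(3)] unfolding C'(2) by metis
  have hC: "h x \<in> C" if "x < 2 ^ k" for x
    using bij_betwE[OF h] that C'(1) by auto
  show ?thesis
  proof (intro exI[of _ h] conjI allI impI)
    fix x a :: nat assume "x < 2 ^ k" "a < m"
    then have "h x \<in> W" using hC CW by blast
    then show "h x a < 2 * m" using \<open>a < m\<close> by (auto simp: W_def PiE_iff)
  next
    fix x y :: nat assume xy: "x < 2 ^ k" "y < 2 ^ k" "x \<noteq> y"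
    have "h x \<noteq> h y" using inj_onD[OF bij_betw_imp_inj_on[OF h], of x y] xy by auto
    with hC[OF xy(1)] hC[OF xy(2)] show "card {a\<in>{..<m}. h x a = h y a} < k \<or> k = 0" using C(1) by (simp add: good_def ag_def)
  qed
qed

definition hash_code :: "nat \<Rightarrow> nat \<Rightarrow> nat \<Rightarrow> nat \<Rightarrow> nat" where
  "hash_code k m = (SOME h. (\<forall>x<2 ^ k. \<forall>a<m. h x a < 2 * m)
     \<and> (\<forall>x<2 ^ k. \<forall>y<2 ^ k. x \<noteq> y \<longrightarrow> card {a\<in>{..<m}. h x a = h y a} < k \<or> k = 0))"

lemma hash_code:
  assumes "k \<le> m"
  shows "x < 2 ^ k \<Longrightarrow> a < m \<Longrightarrow> hash_code k m x a < 2 * m"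
    and "x < 2 ^ k \<Longrightarrow> y < 2 ^ k \<Longrightarrow> x \<noteq> y \<Longrightarrow>
      card {a\<in>{..<m}. hash_code k m x a = hash_code k m y a} < k \<or> k = 0"
proof -
  have *: "(\<forall>x<2 ^ k. \<forall>a<m. hash_code k m x a < 2 * m)
     \<and> (\<forall>x<2 ^ k. \<forall>y<2 ^ k. x \<noteq> y \<longrightarrow> card {a\<in>{..<m}. hash_code k m x a = hash_code k m y a} < k \<or> k = 0)"
    unfolding hash_code_def by (rule someI_ex[OF hash_code_exists[OF assms]])
  show "x < 2 ^ k \<Longrightarrow> a < m \<Longrightarrow> hash_code k m x a < 2 * m"
    and "x < 2 ^ k \<Longrightarrow> y < 2 ^ k \<Longrightarrow> x \<noteq> y \<Longrightarrow>
      card {a\<in>{..<m}. hash_code k m x a = hash_code k m y a} < k \<or> k = 0"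
    using * by simp_all
qed

definition separates :: "nat \<Rightarrow> nat \<Rightarrow> (nat \<Rightarrow> nat \<Rightarrow> bool) \<Rightarrow> nat \<Rightarrow> (nat \<Rightarrow> nat) \<Rightarrow> nat \<Rightarrow> nat \<Rightarrow> bool" where
  "separates k m G r x v a \<longleftrightarrow> a < m \<and> (\<forall>u\<in>nball G r v. u \<noteq> v \<longrightarrow> hash_code k m (x v) a \<noteq> hash_code k m (x u) a)"

text \<open>One step of Linial's colour reduction, carried out on balls of radius \<open>r\<close>:
  a position at which the code word of \<open>v\<close> differs from all others in the ball, packed
  with the letter found there.\<close>

definition colour :: "nat \<Rightarrow> nat \<Rightarrow> (nat \<Rightarrow> nat \<Rightarrow> bool) \<Rightarrow> nat \<Rightarrow> (nat \<Rightarrow> nat) \<Rightarrow> nat \<Rightarrow> nat" where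
  "colour k m G r x v = (let a = (LEAST a. separates k m G r x v a) in a * (2 * m) + hash_code k m (x v) a)"

text \<open>At most \<open>s - 1\<close> other vertices, each spoiling at most \<open>k\<close>
  positions, cannot spoil all of the \<open>m \<ge> s * k\<close> positions.\<close>

lemma separates_exists:
  assumes k: "1 \<le> k" and m: "s * k \<le> m"
    and fin: "finite (nball G r v)" "card (nball G r v) \<le> s"
    and ids: "\<And>u. u \<in> nball G r v \<Longrightarrow> x u < 2 ^ k" "inj_on x (nball G r v)"
  shows "\<exists>a. separates k m G r x v a"
proof (rule ccontr)
  assume no: "\<not> ?thesis"
  let ?B = "nball G r v"
  have v: "v \<in> ?B" by simp
  have "0 < card ?B" using fin(1) v card_gt_0_iff by blast
  then have s: "1 \<le> s" using fin(2) by linarith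
  have "k \<le> s * k" using s by simp
  then have km: "k \<le> m" using m by linarith
  have "{..<m} \<subseteq> (\<Union>u\<in>?B - {v}. {a\<in>{..<m}. hash_code k m (x v) a = hash_code k m (x u) a})"
    using no by (auto simp: separates_def)
  then have "card {..<m} \<le> card (\<Union>u\<in>?B - {v}. {a\<in>{..<m}. hash_code k m (x v) a = hash_code k m (x u) a})"
    by (rule card_mono[rotated]) (use fin in auto)
  also have "\<dots> \<le> (\<Sum>u\<in>?B - {v}. card {a\<in>{..<m}. hash_code k m (x v) a = hash_code k m (x u) a})"
    by (rule card_UN_le) (use fin in auto)
  also have "\<dots> \<le> (\<Sum>u\<in>?B - {v}. k)"
  proof (rule sum_mono)
    fix u assume u: "u \<in> ?B - {v}"
    then have "x v \<noteq> x u" using ids(2) v by (auto simp: inj_on_def)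
    then show "card {a\<in>{..<m}. hash_code k m (x v) a = hash_code k m (x u) a} \<le> k"
      using hash_code(2)[OF km ids(1)[OF v] ids(1)[of u]] u k by auto
  qed
  also have "\<dots> = (card ?B - 1) * k" using fin by simp
  also have "\<dots> < s * k" using fin(2) s k by (intro mult_strict_right_mono) auto
  finally show False using m by simp
qed

lemma colour_less:
  assumes "1 \<le> k" "s * k \<le> m" "finite (nball G r v)" "card (nball G r v) \<le> s"
    "\<And>u. u \<in> nball G r v \<Longrightarrow> x u < 2 ^ k" "inj_on x (nball G r v)"
  shows "colour k m G r x v < 2 * m * m"
proof -
  define a where "a = (LEAST a. separates k m G r x v a)"
  have "separates k m G r x v a" unfolding a_def by (rule LeastI_ex) (rule separates_exists[OF assms])
  then have a: "a < m" by (simp add: separates_def)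
  have "0 < card (nball G r v)" using assms(3) nball_self card_gt_0_iff by blast
  then have "s \<noteq> 0" using assms(4) by linarith
  then have "k \<le> s * k" by (cases s) auto
  then have "k \<le> m" using assms(2) by linarith
  then have "hash_code k m (x v) a < 2 * m" using hash_code(1) assms(5)[of v] a by simp
  then have "a * (2 * m) + hash_code k m (x v) a < Suc a * (2 * m)" by simp
  also have "\<dots> \<le> m * (2 * m)" using a by (intro mult_right_mono) auto
  finally have "a * (2 * m) + hash_code k m (x v) a < 2 * m * m" by (simp only: mult.left_commute mult.assoc)
  moreover have "colour k m G r x v = a * (2 * m) + hash_code k m (x v) a"
    by (simp add: colour_def a_def Let_def)
  ultimately show ?thesis by simp
qed

text \<open>Division by \<open>2 * m\<close> recovers the position; equal colours would thus agree
  in a letter at a position that was chosen to tell \<open>v\<close> from \<open>u\<close>.\<close>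

lemma colour_neq:
  assumes ass: "1 \<le> k" "s * k \<le> m"
    and B: "\<And>w. w \<in> {u, v} \<Longrightarrow> finite (nball G r w)" "\<And>w. w \<in> {u, v} \<Longrightarrow> card (nball G r w) \<le> s"
      "\<And>w y. w \<in> {u, v} \<Longrightarrow> y \<in> nball G r w \<Longrightarrow> x y < 2 ^ k" "\<And>w. w \<in> {u, v} \<Longrightarrow> inj_on x (nball G r w)"
    and uv: "u \<in> nball G r v" "u \<noteq> v"
  shows "colour k m G r x u \<noteq> colour k m G r x v"
proof
  assume eq: "colour k m G r x u = colour k m G r x v"
  define a where "a = (\<lambda>w. LEAST a. separates k m G r x w a)"
  have sep: "separates k m G r x w (a w)" if "w \<in> {u, v}" for w
    unfolding a_def by (rule LeastI_ex) (rule separates_exists[OF ass B], use that in auto)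
  have "0 < card (nball G r v)" using B(1)[of v] nball_self card_gt_0_iff by blast
  then have "s \<noteq> 0" using B(2)[of v] by auto
  then have "k \<le> s * k" by (cases s) auto
  then have km: "k \<le> m" using ass(2) by linarith
  have c: "hash_code k m (x w) (a w) < 2 * m" if "w \<in> {u, v}" for w
    using hash_code(1)[OF km] B(3)[OF that nball_self] sep[OF that] by (simp add: separates_def)
  have col: "colour k m G r x w = a w * (2 * m) + hash_code k m (x w) (a w)" for w
    by (simp add: colour_def a_def Let_def)
  have "a u = colour k m G r x u div (2 * m)" "a v = colour k m G r x v div (2 * m)"
    using c[of u] c[of v] by (simp_all add: col)
  then have "a u = a v" using eq by simp
  then have "hash_code k m (x u) (a v) = hash_code k m (x v) (a v)" using eq by (simp add: col)
  then show False using sep[of v] uv by (auto simp: separates_def)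
qed

lemma is_local_colour: "is_local r (\<lambda>G x. colour k m G r x)"
proof (rule is_localI)
  fix E E' :: "nat \<Rightarrow> nat \<Rightarrow> bool" and x x' :: "nat \<Rightarrow> nat" and v
  assume *: "\<And>u. u \<in> nball E r v \<Longrightarrow> E u = E' u" "\<And>u. u \<in> nball E r v \<Longrightarrow> x u = x' u"
  have "nball E' r v = nball E r v" using nball_cong[OF *(1)] by simp
  moreover have "x v = x' v" using *(2) by simp
  ultimately have "separates k m E r x v = separates k m E' r x' v"
    using *(2) by (auto simp: separates_def fun_eq_iff)
  then show "colour k m E r x v = colour k m E' r x' v"
    using \<open>x v = x' v\<close> by (simp add: colour_def)
qed

subsection \<open>Random identifiers\<close>

lemma id_pmf_exists:
  "\<exists>d P. coin_gen d P \<and> set_pmf P \<subseteq> {..<2 ^ k :: nat} \<and> (\<forall>i. pmf P i \<le> (1/2) ^ k)"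
proof -
  let ?L = "{xs :: bool list. length xs = k}"
  have "finite ?L" "card ?L = card {..<2 ^ k :: nat}"
    using finite_lists_length_eq[of "UNIV :: bool set" k] card_lists_length_eq[of "UNIV :: bool set" k]
    by simp_all
  then obtain f where f: "bij_betw f ?L {..<2 ^ k :: nat}"
    using finite_same_card_bij by blast
  let ?P = "map_pmf f (replicate_pmf k coin)"
  have sup: "set_pmf (replicate_pmf k coin) = ?L" by (auto simp: set_replicate_pmf)
  have "pmf ?P i \<le> (1/2) ^ k" for i
  proof (cases "i \<in> set_pmf ?P")
    case True
    then obtain xs where xs: "i = f xs" "xs \<in> ?L" using sup by auto
    have "pmf ?P i = pmf (replicate_pmf k coin) xs"
      unfolding xs(1) by (rule pmf_map_inj) (use sup f xs in \<open>auto simp: bij_betw_def\<close>)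
    then show ?thesis using xs by (simp add: pmf_replicate_coin)
  next
    case False
    then have "pmf ?P i = 0" by (metis pmf_eq_0_set_pmf)
    then show ?thesis by simp
  qed
  moreover have "set_pmf ?P \<subseteq> {..<2 ^ k}" using sup f by (auto simp: bij_betw_def)
  ultimately show ?thesis using coin_gen_map[OF coin_gen_bits, of f k] by blast
qed

text \<open>Union bound over pairs. For a fixed pair everything except the identifier of
  \<open>u\<close> is drawn first; \<open>u\<close> then hits the value of \<open>v\<close> with
  probability at most \<open>p\<close>.\<close>

lemma prob_ids_collide:
  assumes V: "finite V" and P: "\<And>i. pmf P i \<le> p"
  shows "measure_pmf.prob (Pi_pmf V d (\<lambda>_. P)) {x. \<not> inj_on x V} \<le> (real (card V))\<^sup>2 * p"
proof -
  let ?Q = "Pi_pmf V d (\<lambda>_. P)"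
  define S where "S = {(u, v). u \<in> V \<and> v \<in> V \<and> u \<noteq> v}"
  have fin: "finite S" by (rule finite_subset[of _ "V \<times> V"]) (use V in \<open>auto simp: S_def\<close>)
  have p0: "0 \<le> p" using P[of undefined] pmf_nonneg[of P undefined] by linarith
  have one: "measure_pmf.prob ?Q {x. x u = x v} \<le> p" if "u \<in> V" "v \<in> V" "u \<noteq> v" for u v
  proof -
    have "?Q = map_pmf (\<lambda>(y, f). f(u := y)) (pair_pmf P (Pi_pmf (V - {u}) d (\<lambda>_. P)))"
      using Pi_pmf_insert[of "V - {u}" u d "\<lambda>_. P"] V that by (simp add: insert_absorb)
    also have "\<dots> = Pi_pmf (V - {u}) d (\<lambda>_. P) \<bind> (\<lambda>f. map_pmf (\<lambda>y. f(u := y)) P)"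
      by (subst pair_commute_pmf) (simp add: pair_pmf_def map_bind_pmf map_pmf_def bind_assoc_pmf bind_return_pmf)
    finally have "emeasure ?Q {x. x u = x v} =
       (\<integral>\<^sup>+f. emeasure (map_pmf (\<lambda>y. f(u := y)) P) {x. x u = x v} \<partial>Pi_pmf (V - {u}) d (\<lambda>_. P))"
      by (simp add: emeasure_bind_pmf)
    also have "\<dots> \<le> (\<integral>\<^sup>+f. ennreal p \<partial>Pi_pmf (V - {u}) d (\<lambda>_. P))"
    proof (rule nn_integral_mono)
      fix f :: "'a \<Rightarrow> 'b"
      have "emeasure (map_pmf (\<lambda>y. f(u := y)) P) {x. x u = x v} = emeasure P {f v}"
        using that by (simp add: vimage_def)
      also have "\<dots> = ennreal (pmf P (f v))" by (simp add: emeasure_pmf_single)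
      also have "\<dots> \<le> ennreal p" by (rule ennreal_leI) (rule P)
      finally show "emeasure (map_pmf (\<lambda>y. f(u := y)) P) {x. x u = x v} \<le> ennreal p" .
    qed
    also have "\<dots> = ennreal p" by (simp add: measure_pmf.emeasure_space_1)
    finally show ?thesis using p0 by (simp add: measure_pmf.emeasure_eq_measure)
  qed
  have "{x. \<not> inj_on x V} \<subseteq> (\<Union>(u, v)\<in>S. {x. x u = x v})" by (auto simp: inj_on_def S_def)
  then have "measure_pmf.prob ?Q {x. \<not> inj_on x V} \<le> measure_pmf.prob ?Q (\<Union>(u, v)\<in>S. {x. x u = x v})"
    by (intro measure_pmf.finite_measure_mono) auto
  also have "\<dots> \<le> (\<Sum>(u, v)\<in>S. measure_pmf.prob ?Q {x. x u = x v})"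
    using measure_pmf.finite_measure_subadditive_finite[OF fin, of "\<lambda>(u, v). {x. x u = x v}" ?Q]
    by (simp add: case_prod_unfold)
  also have "\<dots> \<le> (\<Sum>(u, v)\<in>S. p)" by (rule sum_mono) (use one in \<open>auto simp: S_def\<close>)
  also have "\<dots> = real (card S) * p" by (simp add: case_prod_unfold)
  also have "\<dots> \<le> (real (card V))\<^sup>2 * p"
  proof (rule mult_right_mono[OF _ p0])
    have "card S \<le> card (V \<times> V)" by (rule card_mono) (use V in \<open>auto simp: S_def\<close>)
    then have "card S \<le> (card V)\<^sup>2" by (simp add: card_cartesian_product power2_eq_square)
    then show "real (card S) \<le> (real (card V))\<^sup>2" by (metis of_nat_le_iff of_nat_power)
  qed
  finally show ?thesis .
qed

subsection \<open>Deterministic clustering\<close>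

text \<open>One step of the Rozhon--Ghaffari clustering: a cluster label is a centre together with its
  colour, and bit \<open>i\<close> of the colour says whether the cluster grows (1) or shrinks (0) in phase \<open>i\<close>.\<close>

definition target :: "(nat \<Rightarrow> nat \<Rightarrow> bool) \<Rightarrow> nat \<Rightarrow> (nat \<Rightarrow> (nat \<times> nat) option) \<Rightarrow> nat \<Rightarrow> (nat \<times> nat) option" where
  "target G i cl v = (if (\<exists>l. cl v = Some l \<and> \<not> bit (snd l) i) \<and> (\<exists>l u. G v u \<and> cl u = Some l \<and> bit (snd l) i)
     then Some (SOME l. \<exists>u. G v u \<and> cl u = Some l \<and> bit (snd l) i) else None)"

text \<open>A growing cluster takes its proposers if they number at least a \<open>1/(2 * b)\<close>
  fraction of its members; otherwise they lose their label. Counting inside a ball keeps the step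
  local, and \<open>step_eq\<close> shows that nothing is cut off.\<close>

definition rg_step :: "(nat \<Rightarrow> nat \<Rightarrow> bool) \<Rightarrow> nat \<Rightarrow> nat \<Rightarrow> nat \<Rightarrow> (nat \<Rightarrow> (nat \<times> nat) option) \<Rightarrow> nat \<Rightarrow> (nat \<times> nat) option" where
  "rg_step G r b i cl v = (case target G i cl v of None \<Rightarrow> cl v
     | Some l \<Rightarrow> if card {w \<in> nball G r v. cl w = Some l} \<le> 2 * b * card {w \<in> nball G r v. target G i cl w = Some l}
         then Some l else None)"

primrec rg_phases :: "(nat \<Rightarrow> nat \<Rightarrow> bool) \<Rightarrow> nat \<Rightarrow> nat \<Rightarrow> nat \<Rightarrow> nat \<Rightarrow> (nat \<Rightarrow> (nat \<times> nat) option) \<Rightarrow> nat \<Rightarrow> (nat \<times> nat) option" where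
  "rg_phases G r b K 0 cl = cl"
| "rg_phases G r b K (Suc i) cl = (rg_step G r b i ^^ K) (rg_phases G r b K i cl)"

lemma target_SomeD:
  assumes "target G i cl v = Some l"
  obtains l0 u where "cl v = Some l0" "\<not> bit (snd l0) i" "G v u" "cl u = Some l" "bit (snd l) i"
proof -
  have ex: "\<exists>l. cl v = Some l \<and> \<not> bit (snd l) i" "\<exists>l u. G v u \<and> cl u = Some l \<and> bit (snd l) i"
    and l: "l = (SOME l. \<exists>u. G v u \<and> cl u = Some l \<and> bit (snd l) i)"
    using assms by (auto simp: target_def split: if_splits)
  have "\<exists>u. G v u \<and> cl u = Some l \<and> bit (snd l) i"
    unfolding l by (rule someI_ex) (rule ex(2))
  then show ?thesis using ex(1) that by auto
qed

lemma target_not_None: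
  assumes "cl v = Some l0" "\<not> bit (snd l0) i" "G v u" "cl u = Some l" "bit (snd l) i"
  shows "target G i cl v \<noteq> None"
proof -
  have "\<exists>l. cl v = Some l \<and> \<not> bit (snd l) i" "\<exists>l u. G v u \<and> cl u = Some l \<and> bit (snd l) i"
    using assms by blast+
  then show ?thesis by (simp only: target_def if_P) simp
qed

lemma target_None_label: "cl v = None \<Longrightarrow> target G i cl v = None"
  by (simp add: target_def)

text \<open>\<open>b\<close> phases, one per colour bit, of \<open>K\<close> steps each. A cluster
  gaining the factor \<open>1 + 1/(2 * b)\<close> in each of \<open>K\<close> steps would outgrow
  \<open>s\<close>. Radii grow by one per step, up to \<open>b * K\<close>; \<open>r\<close> spans
  two such radii with one more step at either end.\<close>

locale clustering =
  fixes G :: "nat \<Rightarrow> nat \<Rightarrow> bool" and C :: "nat set" and col :: "nat \<Rightarrow> nat" and b r s K :: nat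
  assumes Gsym: "G u v \<Longrightarrow> G v u"
    and closed: "u \<in> C \<Longrightarrow> G u v \<Longrightarrow> v \<in> C"
    and finC: "finite C" and cardC: "card C \<le> s"
    and b: "1 \<le> b" and r: "2 * (b * K + 1) \<le> r"
    and K: "s * (2 * b) ^ K < (2 * b + 1) ^ K"
begin

text \<open>Distances are taken in \<open>G\<close>, so \<open>\<rho>\<close> is a weak radius: the
  centre may have left its own cluster. Agreement of neighbouring labels on the \<open>i\<close> low
  bits is what the first \<open>i\<close> phases have won.\<close>

definition labels_inv :: "nat \<Rightarrow> nat \<Rightarrow> (nat \<Rightarrow> (nat \<times> nat) option) \<Rightarrow> bool" where
  "labels_inv \<rho> i cl \<longleftrightarrow> (\<forall>v\<in>C. \<forall>l. cl v = Some l \<longrightarrow> snd l = col (fst l) \<and> fst l \<in> C \<and> v \<in> nball G \<rho> (fst l))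
     \<and> (\<forall>u\<in>C. \<forall>v l l'. G u v \<longrightarrow> cl u = Some l \<longrightarrow> cl v = Some l' \<longrightarrow> take_bit i (snd l) = take_bit i (snd l'))"

definition members :: "(nat \<Rightarrow> (nat \<times> nat) option) \<Rightarrow> nat \<times> nat \<Rightarrow> nat set" where
  "members cl l = {w \<in> C. cl w = Some l}"

definition proposers :: "nat \<Rightarrow> (nat \<Rightarrow> (nat \<times> nat) option) \<Rightarrow> nat \<times> nat \<Rightarrow> nat set" where
  "proposers i cl l = {w \<in> C. target G i cl w = Some l}"

definition accepts :: "nat \<Rightarrow> (nat \<Rightarrow> (nat \<times> nat) option) \<Rightarrow> nat \<times> nat \<Rightarrow> bool" where
  "accepts i cl l \<longleftrightarrow> card (members cl l) \<le> 2 * b * card (proposers i cl l)"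

definition stopped :: "nat \<Rightarrow> (nat \<Rightarrow> (nat \<times> nat) option) \<Rightarrow> nat \<times> nat \<Rightarrow> bool" where
  "stopped i cl l \<longleftrightarrow> (\<forall>u\<in>C. \<forall>w l'. cl u = Some l \<longrightarrow> G u w \<longrightarrow> cl w = Some l' \<longrightarrow> bit (snd l') i)"

text \<open>The members of growing clusters that are finished for this phase; deaths are charged to
  them.\<close>

definition settled :: "nat \<Rightarrow> (nat \<Rightarrow> (nat \<times> nat) option) \<Rightarrow> nat set" where
  "settled i cl = {v \<in> C. \<exists>l. cl v = Some l \<and> bit (snd l) i \<and> stopped i cl l}"

lemma labels_invD:
  assumes "labels_inv \<rho> i cl" "v \<in> C" "cl v = Some l"
  shows "snd l = col (fst l)" "fst l \<in> C" "v \<in> nball G \<rho> (fst l)"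
    and "G v u \<Longrightarrow> cl u = Some l' \<Longrightarrow> take_bit i (snd l) = take_bit i (snd l')"
  using assms unfolding labels_inv_def by blast+

lemma nball_C: "v \<in> C \<Longrightarrow> nball G \<rho> v \<subseteq> C"
  by (rule nball_subset_closed) (use closed in auto)

text \<open>\<open>v\<close>, the members of its target and the other proposers are all within
  \<open>\<rho> + 1\<close> of one centre, hence within \<open>r\<close> of
  \<open>v\<close>.\<close>

lemma step_eq:
  assumes I: "labels_inv \<rho> i cl" and \<rho>: "\<rho> \<le> b * K" and v: "v \<in> C"
  shows "rg_step G r b i cl v = (case target G i cl v of None \<Rightarrow> cl v
     | Some l \<Rightarrow> if accepts i cl l then Some l else None)"
proof (cases "target G i cl v")
  case None
  then show ?thesis by (simp add: rg_step_def)
next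
  case (Some l)
  then obtain u where u: "G v u" "cl u = Some l" by (rule target_SomeD)
  have uC: "u \<in> C" using closed v u by blast
  have "u \<in> nball G \<rho> (fst l)" using labels_invD(3)[OF I uC u(2)] .
  then have "fst l \<in> nball G \<rho> u" using nball_sym[where E = G, OF Gsym] by blast
  then have vc: "fst l \<in> nball G (Suc \<rho>) v" using nball_trans[OF nball_adj[of G, OF u(1)], of "fst l" \<rho>] by simp
  have far: "w \<in> nball G r v" if "w \<in> nball G (Suc \<rho>) (fst l)" for w
  proof -
    have "w \<in> nball G (Suc \<rho> + Suc \<rho>) v" by (rule nball_trans[OF vc that])
    moreover have "Suc \<rho> + Suc \<rho> \<le> r" using r \<rho> by simp
    ultimately show ?thesis using nball_mono by blast
  qed
  have "{w \<in> nball G r v. cl w = Some l} = members cl l"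
  proof (intro set_eqI iffI)
    fix w assume "w \<in> {w \<in> nball G r v. cl w = Some l}"
    then show "w \<in> members cl l" using nball_C[OF v] by (auto simp: members_def)
  next
    fix w assume w: "w \<in> members cl l"
    then have "w \<in> nball G \<rho> (fst l)" using labels_invD(3)[OF I] by (auto simp: members_def)
    then have "w \<in> nball G (Suc \<rho>) (fst l)" using nball_mono[of \<rho> "Suc \<rho>" G "fst l"] by (meson le_SucI order_refl subsetD)
    then show "w \<in> {w \<in> nball G r v. cl w = Some l}" using far w by (auto simp: members_def)
  qed
  moreover have "{w \<in> nball G r v. target G i cl w = Some l} = proposers i cl l"
  proof (intro set_eqI iffI)
    fix w assume "w \<in> {w \<in> nball G r v. target G i cl w = Some l}"
    then show "w \<in> proposers i cl l" using nball_C[OF v] by (auto simp: proposers_def)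
  next
    fix w assume w: "w \<in> proposers i cl l"
    then have "w \<in> C" "target G i cl w = Some l" by (auto simp: proposers_def)
    from this(2) obtain u where u: "G w u" "cl u = Some l" by (rule target_SomeD)
    have "u \<in> C" using closed \<open>w \<in> C\<close> u by blast
    then have "u \<in> nball G \<rho> (fst l)" using labels_invD(3)[OF I _ u(2)] by blast
    then have "w \<in> nball G (Suc \<rho>) (fst l)" using Gsym[OF u(1)] by (rule nball_step)
    then show "w \<in> {w \<in> nball G r v. target G i cl w = Some l}" using far w by (auto simp: proposers_def)
  qed
  ultimately show ?thesis using Some by (simp add: rg_step_def accepts_def)
qed

section \<open>Effect of a single clustering step\<close>

context
  fixes \<rho> i cl cl'
  assumes I: "labels_inv \<rho> i cl" and \<rho>: "\<rho> < b * K"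
    and cl': "cl' = rg_step G r b i cl"
begin

lemma cl'_eq: "v \<in> C \<Longrightarrow> cl' v = (case target G i cl v of None \<Rightarrow> cl v
     | Some l \<Rightarrow> if accepts i cl l then Some l else None)"
  unfolding cl' using step_eq[OF I] \<rho> by simp

lemma cl'_SomeD:
  assumes "v \<in> C" "cl' v = Some l"
  shows "target G i cl v = None \<and> cl v = Some l \<or> target G i cl v = Some l \<and> accepts i cl l"
  using assms cl'_eq[OF assms(1)] by (auto split: option.splits if_splits)

text \<open>A vertex only moves to the label of a neighbour, which agrees with its own on the low
  bits; so the gains of earlier phases survive.\<close>

lemma cl'_old:
  assumes "v \<in> C" "cl' v = Some l"
  obtains l0 where "cl v = Some l0" "take_bit i (snd l0) = take_bit i (snd l)"
proof -
  from cl'_SomeD[OF assms] consider "cl v = Some l" | "target G i cl v = Some l" by blast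
  then show ?thesis
  proof cases
    case 1
    then show ?thesis using that by blast
  next
    case 2
    then obtain l0 u where "cl v = Some l0" "G v u" "cl u = Some l" by (rule target_SomeD)
    then show ?thesis using that labels_invD(4)[OF I assms(1)] by blast
  qed
qed

lemma labels_inv_step: "labels_inv (Suc \<rho>) i cl'"
  unfolding labels_inv_def
proof (intro conjI ballI allI impI)
  fix v l assume v: "v \<in> C" "cl' v = Some l"
  obtain u where u: "u = v \<or> G u v" "u \<in> C" "cl u = Some l"
  proof -
    from cl'_SomeD[OF v] consider "cl v = Some l" | "target G i cl v = Some l" by blast
    then show ?thesis
    proof cases
      case 1
      then show ?thesis using that v by blast
    next
      case 2
      then obtain u where "G v u" "cl u = Some l" by (rule target_SomeD)
      then show ?thesis using that Gsym closed v(1) by blast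
    qed
  qed
  show "snd l = col (fst l)" "fst l \<in> C" using labels_invD[OF I u(2,3)] by auto
  have "u \<in> nball G \<rho> (fst l)" using labels_invD(3)[OF I u(2,3)] .
  then show "v \<in> nball G (Suc \<rho>) (fst l)"
    using u(1) nball_step[of u G \<rho> "fst l" v] nball_mono[of \<rho> "Suc \<rho>" G "fst l"] by (meson le_SucI order_refl subsetD)
next
  fix u v l l' assume u: "u \<in> C" "G u v" "cl' u = Some l" "cl' v = Some l'"
  have v: "v \<in> C" using closed u by blast
  obtain m where m: "cl u = Some m" "take_bit i (snd m) = take_bit i (snd l)" using cl'_old[OF u(1,3)] .
  obtain m' where m': "cl v = Some m'" "take_bit i (snd m') = take_bit i (snd l')" using cl'_old[OF v u(4)] .
  show "take_bit i (snd l) = take_bit i (snd l')" using labels_invD(4)[OF I u(1) m(1) u(2) m'(1)] m m' by simp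
qed

lemma blue_stays: "v \<in> C \<Longrightarrow> cl v = Some l \<Longrightarrow> bit (snd l) i \<Longrightarrow> cl' v = Some l"
  using cl'_eq[of v] by (auto simp: target_def)

lemma red_old:
  assumes "w \<in> C" "cl' w = Some l" "\<not> bit (snd l) i"
  shows "cl w = Some l \<and> target G i cl w = None"
proof -
  have "target G i cl w \<noteq> Some l" using assms(3) by (metis target_SomeD)
  then show ?thesis using cl'_SomeD[OF assms(1,2)] by blast
qed

lemma members_step:
  assumes "bit (snd l) i"
  shows "members cl' l = members cl l \<union> (if accepts i cl l then proposers i cl l else {})"
proof (intro set_eqI iffI)
  fix v assume "v \<in> members cl' l"
  then have "v \<in> C" "cl' v = Some l" by (auto simp: members_def)
  then show "v \<in> members cl l \<union> (if accepts i cl l then proposers i cl l else {})"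
    using cl'_SomeD[of v l] by (auto simp: members_def proposers_def)
next
  fix v assume "v \<in> members cl l \<union> (if accepts i cl l then proposers i cl l else {})"
  then consider "v \<in> members cl l" | "accepts i cl l" "v \<in> proposers i cl l"
    by (auto split: if_splits)
  then show "v \<in> members cl' l"
  proof cases
    case 1
    then show ?thesis using blue_stays assms by (auto simp: members_def)
  next
    case 2
    then show ?thesis using cl'_eq[of v] by (auto simp: members_def proposers_def)
  qed
qed

text \<open>A shrinking vertex next to \<open>l\<close> must have proposed somewhere, so after the
  step it has joined a growing cluster or died; and \<open>l\<close> has gained no member that could
  touch further shrinking vertices.\<close>

lemma stopped_step:
  assumes l: "bit (snd l) i" and no: "\<not> accepts i cl l \<or> proposers i cl l = {}"
  shows "stopped i cl' l"
  unfolding stopped_def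
proof (intro ballI allI impI)
  fix u w l' assume u: "u \<in> C" "cl' u = Some l" "G u w" "cl' w = Some l'"
  have "members cl' l = members cl l" using members_step[OF l] no by auto
  then have "cl u = Some l" using u by (auto simp: members_def)
  show "bit (snd l') i"
  proof (rule ccontr)
    assume "\<not> bit (snd l') i"
    then have "cl w = Some l'" "target G i cl w = None" using red_old[of w l'] closed[OF u(1,3)] u(4) by auto
    then show False
      using target_not_None[of cl w l' i G u l, OF _ \<open>\<not> bit (snd l') i\<close> Gsym[OF u(3)] \<open>cl u = Some l\<close> l] by blast
  qed
qed

lemma stopped_no_proposers:
  assumes "stopped i cl l"
  shows "proposers i cl l = {}"
proof (rule ccontr)
  assume "\<not> ?thesis"
  then obtain w where w: "w \<in> C" "target G i cl w = Some l" by (auto simp: proposers_def)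
  from w(2) obtain l0 u where "cl w = Some l0" "\<not> bit (snd l0) i" "G w u" "cl u = Some l" by (rule target_SomeD)
  moreover from this have "u \<in> C" "G u w" using closed Gsym w(1) by auto
  ultimately show False using assms unfolding stopped_def by blast
qed

lemma growth_step:
  assumes "bit (snd l) i" "\<not> stopped i cl' l"
  shows "(2 * b + 1) * card (members cl l) \<le> 2 * b * card (members cl' l)"
proof -
  have acc: "accepts i cl l" using stopped_step[OF assms(1)] assms(2) by blast
  have disj: "members cl l \<inter> proposers i cl l = {}"
  proof (rule ccontr)
    assume "\<not> ?thesis"
    then obtain w where w: "cl w = Some l" "target G i cl w = Some l"
      by (auto simp: members_def proposers_def)
    from w(2) obtain l0 where "cl w = Some l0" "\<not> bit (snd l0) i" by (rule target_SomeD)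
    then show False using w(1) assms(1) by simp
  qed
  have fin: "finite (members cl l)" "finite (proposers i cl l)"
    using finC by (auto simp: members_def proposers_def)
  have "card (members cl' l) = card (members cl l) + card (proposers i cl l)"
    using members_step[OF assms(1)] acc card_Un_disjoint[OF fin disj] by simp
  then show ?thesis using acc by (simp add: accepts_def algebra_simps)
qed

text \<open>A rejecting cluster has no shrinking neighbour afterwards, so it pays only once for the vertices
  it kills.\<close>

lemma dead_step:
  "2 * b * card {v \<in> C. cl v \<noteq> None \<and> cl' v = None} + card (settled i cl) \<le> card (settled i cl')"
proof -
  define Rej where "Rej = {l \<in> (\<lambda>v. the (cl v)) ` C. proposers i cl l \<noteq> {} \<and> \<not> accepts i cl l}"
  have finR: "finite Rej" using finC by (simp add: Rej_def)
  have fin: "finite (members cl l)" "finite (proposers i cl l)" for l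
    using finC by (auto simp: members_def proposers_def)
  have blue: "bit (snd l) i" if "l \<in> Rej" for l
  proof -
    from that obtain w where "target G i cl w = Some l" by (auto simp: Rej_def proposers_def)
    then show ?thesis by (rule target_SomeD)
  qed
  have "{v \<in> C. cl v \<noteq> None \<and> cl' v = None} \<subseteq> (\<Union>l\<in>Rej. proposers i cl l)"
  proof
    fix v assume v: "v \<in> {v \<in> C. cl v \<noteq> None \<and> cl' v = None}"
    then obtain l where l: "target G i cl v = Some l" "\<not> accepts i cl l"
      using cl'_eq[of v] by (auto split: option.splits if_splits)
    from l(1) obtain u where "G v u" "cl u = Some l" by (rule target_SomeD)
    then have "u \<in> C" "l = the (cl u)" using closed v by auto
    then have "l \<in> Rej" using l v by (auto simp: Rej_def proposers_def)
    then show "v \<in> (\<Union>l\<in>Rej. proposers i cl l)" using l v by (auto simp: proposers_def)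
  qed
  then have "card {v \<in> C. cl v \<noteq> None \<and> cl' v = None} \<le> card (\<Union>l\<in>Rej. proposers i cl l)"
    by (rule card_mono[rotated]) (use finR fin in auto)
  also have "\<dots> \<le> (\<Sum>l\<in>Rej. card (proposers i cl l))" by (rule card_UN_le[OF finR])
  finally have "2 * b * card {v \<in> C. cl v \<noteq> None \<and> cl' v = None} \<le> (\<Sum>l\<in>Rej. 2 * b * card (proposers i cl l))"
    by (simp add: sum_distrib_left[symmetric])
  also have "\<dots> \<le> (\<Sum>l\<in>Rej. card (members cl l))"
    by (rule sum_mono) (auto simp: Rej_def accepts_def)
  also have "\<dots> = card (\<Union>l\<in>Rej. members cl l)"
    by (rule card_UN_disjoint[symmetric]) (use finR fin in \<open>auto simp: members_def\<close>)
  finally have 1: "2 * b * card {v \<in> C. cl v \<noteq> None \<and> cl' v = None} \<le> card (\<Union>l\<in>Rej. members cl l)" .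
  \<comment> \<open>A rejecting cluster has a proposer, so it was not stopped before: its members
    are charged for the first time.\<close>
  have disj: "(\<Union>l\<in>Rej. members cl l) \<inter> settled i cl = {}"
  proof (rule ccontr)
    assume "\<not> ?thesis"
    then obtain v l where "l \<in> Rej" "v \<in> members cl l" "v \<in> settled i cl" by auto
    then have "stopped i cl l" by (auto simp: members_def settled_def)
    then show False using stopped_no_proposers \<open>l \<in> Rej\<close> by (auto simp: Rej_def)
  qed
  have sub: "(\<Union>l\<in>Rej. members cl l) \<union> settled i cl \<subseteq> settled i cl'"
  proof
    fix v assume "v \<in> (\<Union>l\<in>Rej. members cl l) \<union> settled i cl"
    then consider l where "l \<in> Rej" "v \<in> members cl l" | "v \<in> settled i cl" by auto
    then obtain l where l: "v \<in> C" "cl v = Some l" "bit (snd l) i" "\<not> accepts i cl l \<or> proposers i cl l = {}"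
    proof cases
      case (1 l)
      then show ?thesis using that[of l] blue by (auto simp: Rej_def members_def)
    next
      case 2
      then show ?thesis using that stopped_no_proposers by (auto simp: settled_def)
    qed
    then have "\<exists>l. cl' v = Some l \<and> bit (snd l) i \<and> stopped i cl' l"
      using blue_stays[OF l(1,2,3)] stopped_step[OF l(3,4)] by blast
    then show "v \<in> settled i cl'" using l(1) by (simp add: settled_def)
  qed
  have "card (\<Union>l\<in>Rej. members cl l) + card (settled i cl) = card ((\<Union>l\<in>Rej. members cl l) \<union> settled i cl)"
    by (rule card_Un_disjoint[symmetric]) (use finR fin finC disj in \<open>auto simp: settled_def\<close>)
  also have "\<dots> \<le> card (settled i cl')"
    by (rule card_mono[OF _ sub]) (use finC in \<open>simp add: settled_def\<close>)
  finally show ?thesis using 1 by linarith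
qed

end

text \<open>Stopped clusters have no proposers and remain stopped. Hence a cluster that is still not
  stopped has grown in every step so far, which gives the exponential lower bound on its
  size.\<close>

lemma phase_steps:
  assumes I: "labels_inv \<rho> i cl" and k: "\<rho> + k \<le> b * K"
  shows "labels_inv (\<rho> + k) i ((rg_step G r b i ^^ k) cl)
    \<and> 2 * b * card {v \<in> C. cl v \<noteq> None \<and> (rg_step G r b i ^^ k) cl v = None}
        \<le> card (settled i ((rg_step G r b i ^^ k) cl))
    \<and> (\<forall>v\<in>C. \<forall>l. (rg_step G r b i ^^ k) cl v = Some l \<longrightarrow> bit (snd l) i \<longrightarrow>
         \<not> stopped i ((rg_step G r b i ^^ k) cl) l \<longrightarrow>
         (2 * b + 1) ^ k \<le> (2 * b) ^ k * card (members ((rg_step G r b i ^^ k) cl) l))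
    \<and> (\<forall>v\<in>C. cl v = None \<longrightarrow> (rg_step G r b i ^^ k) cl v = None)"
  using k
proof (induction k)
  case 0
  have "1 \<le> card (members cl l)" if "v \<in> C" "cl v = Some l" for v l
  proof -
    have "v \<in> members cl l" "finite (members cl l)" using that finC by (auto simp: members_def)
    then show ?thesis using card_gt_0_iff[of "members cl l"] by auto
  qed
  moreover have "{v \<in> C. cl v \<noteq> None \<and> cl v = None} = {}" by blast
  ultimately show ?case using I by (simp only: funpow_0 card.empty power_0) simp
next
  case (Suc k)
  define c where "c = (rg_step G r b i ^^ k) cl"
  define c' where "c' = rg_step G r b i c"
  have c'_eq: "(rg_step G r b i ^^ Suc k) cl = c'" by (simp add: c_def c'_def)
  have IH: "labels_inv (\<rho> + k) i c" "2 * b * card {v \<in> C. cl v \<noteq> None \<and> c v = None} \<le> card (settled i c)"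
    "\<And>v l. v \<in> C \<Longrightarrow> c v = Some l \<Longrightarrow> bit (snd l) i \<Longrightarrow> \<not> stopped i c l \<Longrightarrow>
         (2 * b + 1) ^ k \<le> (2 * b) ^ k * card (members c l)"
    "\<And>v. v \<in> C \<Longrightarrow> cl v = None \<Longrightarrow> c v = None"
    using Suc.IH Suc.prems unfolding c_def[symmetric] by auto
  have \<rho>: "\<rho> + k < b * K" using Suc.prems by simp
  note step = IH(1) \<rho> c'_def
  have none: "c' v = None" if "v \<in> C" "c v = None" for v
    using cl'_eq[OF step that(1)] that(2) target_None_label[of c v G i] by simp
  show ?case unfolding c'_eq
  proof (intro conjI ballI allI impI)
    show "labels_inv (\<rho> + Suc k) i c'" using labels_inv_step[OF step] by simp
  next
    have fin: "finite {v \<in> C. P v}" for P using finC by simp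
    have "{v \<in> C. cl v \<noteq> None \<and> c' v = None}
        \<subseteq> {v \<in> C. cl v \<noteq> None \<and> c v = None} \<union> {v \<in> C. c v \<noteq> None \<and> c' v = None}" by blast
    then have "card {v \<in> C. cl v \<noteq> None \<and> c' v = None}
        \<le> card ({v \<in> C. cl v \<noteq> None \<and> c v = None} \<union> {v \<in> C. c v \<noteq> None \<and> c' v = None})"
      by (rule card_mono[rotated]) (intro finite_UnI fin)
    also have "\<dots> \<le> card {v \<in> C. cl v \<noteq> None \<and> c v = None} + card {v \<in> C. c v \<noteq> None \<and> c' v = None}"
      by (rule card_Un_le)
    finally have "2 * b * card {v \<in> C. cl v \<noteq> None \<and> c' v = None}
        \<le> 2 * b * (card {v \<in> C. cl v \<noteq> None \<and> c v = None} + card {v \<in> C. c v \<noteq> None \<and> c' v = None})"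
      by (rule mult_left_mono) simp
    also have "\<dots> \<le> card (settled i c')"
      unfolding distrib_left using dead_step[OF step] IH(2) by linarith
    finally show "2 * b * card {v \<in> C. cl v \<noteq> None \<and> c' v = None} \<le> card (settled i c')" .
  next
    fix v l assume v: "v \<in> C" "c' v = Some l" "bit (snd l) i" "\<not> stopped i c' l"
    obtain u where u: "u \<in> C" "c u = Some l"
    proof -
      from cl'_SomeD[OF step v(1,2)] consider "c v = Some l" | "target G i c v = Some l" by blast
      then show ?thesis
      proof cases
        case 1
        then show ?thesis using that v by blast
      next
        case 2
        then obtain u where "G v u" "c u = Some l" by (rule target_SomeD)
        then show ?thesis using that closed v(1) by blast
      qed
    qed
    have ns: "\<not> stopped i c l"
    proof
      assume "stopped i c l"
      then have "proposers i c l = {}" by (rule stopped_no_proposers[OF step])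
      then show False using stopped_step[OF step v(3)] v(4) by blast
    qed
    have "(2 * b + 1) ^ Suc k \<le> (2 * b + 1) * ((2 * b) ^ k * card (members c l))"
      unfolding power_Suc by (rule mult_left_mono[OF IH(3)[OF u v(3) ns]]) simp
    also have "\<dots> = (2 * b) ^ k * ((2 * b + 1) * card (members c l))" by (simp only: mult_ac)
    also have "\<dots> \<le> (2 * b) ^ k * (2 * b * card (members c' l))"
      by (rule mult_left_mono[OF growth_step[OF step v(3,4)]]) simp
    finally show "(2 * b + 1) ^ Suc k \<le> (2 * b) ^ Suc k * card (members c' l)" by (simp only: power_Suc mult_ac)
  next
    fix v assume "v \<in> C" "cl v = None"
    then show "c' v = None" using none IH(4) by blast
  qed
qed

text \<open>After \<open>K\<close> steps a cluster that is not stopped would have more than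
  \<open>s\<close> members. So all growing clusters are stopped, and bit \<open>i\<close> agrees
  across every edge between labelled vertices. The charging leaves at most
  \<open>card C / (2 * b)\<close> deaths.\<close>

lemma phase:
  assumes I: "labels_inv \<rho> i cl" and k: "\<rho> + K \<le> b * K"
  shows "labels_inv (\<rho> + K) (Suc i) ((rg_step G r b i ^^ K) cl)
    \<and> 2 * b * card {v \<in> C. cl v \<noteq> None \<and> (rg_step G r b i ^^ K) cl v = None} \<le> card C"
proof -
  define c where "c = (rg_step G r b i ^^ K) cl"
  note steps = phase_steps[OF assms, folded c_def]
  have st: "stopped i c l" if "v \<in> C" "c v = Some l" "bit (snd l) i" for v l
  proof (rule ccontr)
    assume "\<not> ?thesis"
    then have "(2 * b + 1) ^ K \<le> (2 * b) ^ K * card (members c l)" using steps that by blast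
    also have "\<dots> \<le> (2 * b) ^ K * s"
    proof (rule mult_left_mono)
      have "card (members c l) \<le> card C" by (rule card_mono[OF finC]) (auto simp: members_def)
      then show "card (members c l) \<le> s" using cardC by linarith
    qed simp
    finally show False using K by (simp add: mult.commute)
  qed
  have Ic: "labels_inv (\<rho> + K) i c" using steps by blast
  have "labels_inv (\<rho> + K) (Suc i) c"
    unfolding labels_inv_def
  proof (intro conjI ballI allI impI)
    fix v l assume "v \<in> C" "c v = Some l"
    then show "snd l = col (fst l)" "fst l \<in> C" "v \<in> nball G (\<rho> + K) (fst l)"
      using labels_invD[OF Ic] by auto
  next
    fix u v l l' assume u: "u \<in> C" "G u v" "c u = Some l" "c v = Some l'"
    have v: "v \<in> C" using closed u by blast
    have "take_bit i (snd l) = take_bit i (snd l')" using labels_invD(4)[OF Ic u(1,3,2,4)] .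
    moreover have "bit (snd l') i" if "bit (snd l) i"
      using st[OF u(1,3) that] u unfolding stopped_def by blast
    moreover have "bit (snd l) i" if "bit (snd l') i"
      using st[OF v u(4) that] u v Gsym[OF u(2)] unfolding stopped_def by blast
    ultimately show "take_bit (Suc i) (snd l) = take_bit (Suc i) (snd l')"
      by (auto simp: take_bit_Suc_from_most)
  qed
  moreover have "card (settled i c) \<le> card C"
    by (rule card_mono[OF finC]) (auto simp: settled_def)
  ultimately show ?thesis using steps unfolding c_def[symmetric] by linarith
qed

lemma phases:
  assumes init: "\<And>v. v \<in> C \<Longrightarrow> cl v = Some (v, col v)" and i: "i \<le> b"
  shows "labels_inv (i * K) i (rg_phases G r b K i cl)
    \<and> 2 * b * card {v \<in> C. rg_phases G r b K i cl v = None} \<le> i * card C"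
  using i
proof (induction i)
  case 0
  have "labels_inv 0 0 cl" unfolding labels_inv_def using init by auto
  moreover have "{v \<in> C. cl v = None} = {}" using init by auto
  ultimately show ?case by (simp only: rg_phases.simps card.empty) simp
next
  case (Suc i)
  define c where "c = rg_phases G r b K i cl"
  define c' where "c' = (rg_step G r b i ^^ K) c"
  have IH: "labels_inv (i * K) i c" "2 * b * card {v \<in> C. c v = None} \<le> i * card C"
    using Suc unfolding c_def by auto
  have "Suc i * K \<le> b * K" using Suc.prems by (intro mult_right_mono) auto
  then have "i * K + K \<le> b * K" by simp
  from phase[OF IH(1) this, folded c'_def]
  have p: "labels_inv (i * K + K) (Suc i) c'" "2 * b * card {v \<in> C. c v \<noteq> None \<and> c' v = None} \<le> card C"
    by auto
  have "card {v \<in> C. c' v = None} \<le> card ({v \<in> C. c v = None} \<union> {v \<in> C. c v \<noteq> None \<and> c' v = None})"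
    by (rule card_mono) (use finC in auto)
  also have "\<dots> \<le> card {v \<in> C. c v = None} + card {v \<in> C. c v \<noteq> None \<and> c' v = None}"
    by (rule card_Un_le)
  finally have "2 * b * card {v \<in> C. c' v = None}
      \<le> 2 * b * (card {v \<in> C. c v = None} + card {v \<in> C. c v \<noteq> None \<and> c' v = None})"
    by (rule mult_left_mono) simp
  also have "\<dots> \<le> Suc i * card C" unfolding distrib_left using IH(2) p(2) by simp
  finally show ?case using p(1) by (simp add: c_def c'_def add.commute)
qed

text \<open>The \<open>b\<close> phases lose at most half of the vertices. Adjacent surviving
  clusters agree in all colour bits, and their centres are within \<open>2 * (b * K) + 1\<close> of
  each other; a colouring proper at that distance forces the centres to coincide. So a surviving
  component lies inside one cluster.\<close>

theorem clustering_correct: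
  assumes init: "\<And>v. v \<in> C \<Longrightarrow> cl v = Some (v, col v)"
    and col: "\<And>v. v \<in> C \<Longrightarrow> col v < 2 ^ b"
    and proper: "\<And>u v. u \<in> C \<Longrightarrow> v \<in> C \<Longrightarrow> u \<in> nball G (2 * (b * K) + 1) v \<Longrightarrow> u \<noteq> v \<Longrightarrow> col u \<noteq> col v"
  defines "cl' \<equiv> rg_phases G r b K b cl"
  shows "2 * card {v \<in> C. cl' v = None} \<le> card C"
    and "\<And>v w. v \<in> C \<Longrightarrow> (induced G {v. cl' v \<noteq> None})\<^sup>*\<^sup>* v w \<Longrightarrow> w \<in> nball G (2 * (b * K)) v"
proof -
  have p: "labels_inv (b * K) b cl'" "2 * b * card {v \<in> C. cl' v = None} \<le> b * card C"
    using phases[OF init, of b] unfolding cl'_def by auto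
  then show "2 * card {v \<in> C. cl' v = None} \<le> card C" using b by simp
  have same: "l = l'" if u: "u \<in> C" "G u v" "cl' u = Some l" "cl' v = Some l'" for u v l l'
  proof -
    have v: "v \<in> C" using closed u by blast
    note iu = labels_invD[OF p(1) u(1,3)] and iv = labels_invD[OF p(1) v u(4)]
    have "take_bit b (snd l) = take_bit b (snd l')" using iu(4)[OF u(2,4)] .
    moreover have "take_bit b (col w) = col w" if "w \<in> C" for w
      using col[OF that] by (simp add: take_bit_eq_mod)
    ultimately have ceq: "col (fst l) = col (fst l')" using iu(1,2) iv(1,2) by simp
    have "fst l' \<in> nball G (b * K) v" using nball_sym[where E = G, OF Gsym] iv(3) by blast
    moreover have "v \<in> nball G (Suc (b * K)) (fst l)" using nball_step[OF iu(3) u(2)] .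
    ultimately have "fst l' \<in> nball G (Suc (b * K) + b * K) (fst l)" by (meson nball_trans)
    moreover have "Suc (b * K) + b * K = 2 * (b * K) + 1" by simp
    ultimately have "fst l = fst l'" using proper[of "fst l'" "fst l"] ceq iu(2) iv(2) by metis
    then show ?thesis using ceq iu(1) iv(1) by (simp add: prod_eq_iff)
  qed
  fix v w assume v: "v \<in> C" and vw: "(induced G {v. cl' v \<noteq> None})\<^sup>*\<^sup>* v w"
  show "w \<in> nball G (2 * (b * K)) v"
  proof (cases "cl' v")
    case None
    have "w = v"
      using vw by (cases rule: converse_rtranclpE) (use None in \<open>auto simp: induced_def\<close>)
    then show ?thesis by simp
  next
    case (Some l)
    have "w \<in> C \<and> cl' w = Some l"
      using vw
    proof (induction rule: rtranclp_induct)
      case base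
      then show ?case using v Some by simp
    next
      case (step y z)
      then obtain l' where "G y z" "cl' z = Some l'" by (auto simp: induced_def)
      then show ?case using step.IH same[of y z l l'] closed[of y z] by auto
    qed
    then have "w \<in> nball G (b * K) (fst l)" "v \<in> nball G (b * K) (fst l)"
      using labels_invD(3)[OF p(1)] v Some by blast+
    then have "w \<in> nball G (b * K + b * K) v"
      using nball_trans[of "fst l" G "b * K" v w "b * K"] nball_sym[where E = G, OF Gsym] by blast
    then show ?thesis by (simp add: mult_2)
  qed
qed

end

subsection \<open>Iterated clustering\<close>

lemma is_local_target: "is_local 1 (\<lambda>G cl. target G i cl)"
proof (rule is_localI)
  fix E E' :: "nat \<Rightarrow> nat \<Rightarrow> bool" and cl cl' :: "nat \<Rightarrow> (nat \<times> nat) option" and v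
  assume *: "\<And>u. u \<in> nball E 1 v \<Longrightarrow> E u = E' u" "\<And>u. u \<in> nball E 1 v \<Longrightarrow> cl u = cl' u"
  have "(\<exists>u. E v u \<and> cl u = Some l \<and> bit (snd l) i) = (\<exists>u. E' v u \<and> cl' u = Some l \<and> bit (snd l) i)" for l
  proof -
    have "E v = E' v" using *(1)[of v] by simp
    moreover have "cl u = cl' u" if "E v u" for u using *(2)[of u] that by simp
    ultimately show ?thesis by metis
  qed
  moreover have "cl v = cl' v" using *(2)[of v] by simp
  ultimately show "target E i cl v = target E' i cl' v" by (simp only: target_def)
qed

lemma is_local_rg_step: "is_local (Suc r) (\<lambda>G cl. rg_step G r b i cl)"
proof (rule is_localI)
  fix E E' :: "nat \<Rightarrow> nat \<Rightarrow> bool" and cl cl' :: "nat \<Rightarrow> (nat \<times> nat) option" and v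
  assume *: "\<And>u. u \<in> nball E (Suc r) v \<Longrightarrow> E u = E' u" "\<And>u. u \<in> nball E (Suc r) v \<Longrightarrow> cl u = cl' u"
  have sub: "w \<in> nball E (Suc r) v" if "w \<in> nball E r v" for w
    using nball_mono[of r "Suc r" E v] that by (meson le_SucI order_refl subsetD)
  have t: "target E i cl w = target E' i cl' w" if w: "w \<in> nball E r v" for w
  proof (rule is_localD[OF is_local_target])
    fix u assume "u \<in> nball E 1 w"
    then have "u \<in> nball E (Suc r) v" using nball_trans[OF w, of u 1] by simp
    then show "E u = E' u" "cl u = cl' u" using * by blast+
  qed
  have B: "nball E' r v = nball E r v" using nball_cong[of E r v E'] *(1) sub by blast
  have "{w \<in> nball E r v. cl w = Some l} = {w \<in> nball E' r v. cl' w = Some l}" for l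
    unfolding B using *(2) sub by (auto dest: sub)
  moreover have "{w \<in> nball E r v. target E i cl w = Some l} = {w \<in> nball E' r v. target E' i cl' w = Some l}" for l
    unfolding B using t by auto
  moreover have "cl v = cl' v" "target E i cl v = target E' i cl' v" using *(2)[of v] t[of v] by auto
  ultimately show "rg_step E r b i cl v = rg_step E' r b i cl' v" by (simp only: rg_step_def)
qed

lemma is_local_rg_phases: "is_local (i * (K * Suc r)) (\<lambda>G cl. rg_phases G r b K i cl)"
proof (induction i)
  case 0
  show ?case by (rule is_localI) simp
next
  case (Suc i)
  from is_local_comp[OF Suc is_local_funpow[OF is_local_rg_step[of r b i], of K]]
  show ?case by (simp add: add.commute)
qed

type_synonym dstate = "nat \<Rightarrow> bool \<times> bool \<times> nat"

definition initial_labels :: "nat \<Rightarrow> nat \<Rightarrow> nat \<Rightarrow> (nat \<Rightarrow> nat \<Rightarrow> bool) \<Rightarrow> dstate \<Rightarrow> nat \<Rightarrow> (nat \<times> nat) option" where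
  "initial_labels k m r G y v =
     (if fst (y v) then Some (v, colour k m G r (\<lambda>u. snd (snd (y u))) v) else None)"

definition final_labels :: "nat \<Rightarrow> nat \<Rightarrow> nat \<Rightarrow> nat \<Rightarrow> (nat \<Rightarrow> nat \<Rightarrow> bool) \<Rightarrow> dstate \<Rightarrow> nat \<Rightarrow> (nat \<times> nat) option" where
  "final_labels k m b K G y =
     rg_phases G (2 * (b * K + 1)) b K b (initial_labels k m (2 * (b * K) + 1) G y)"

definition cluster_mis :: "nat \<Rightarrow> nat \<Rightarrow> nat \<Rightarrow> nat \<Rightarrow> (nat \<Rightarrow> nat \<Rightarrow> bool) \<Rightarrow> dstate \<Rightarrow> nat \<Rightarrow> bool" where
  "cluster_mis k m b K G y = solve_comps (2 * (b * K)) G {u. final_labels k m b K G y u \<noteq> None}"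

definition cluster_round :: "nat \<Rightarrow> nat \<Rightarrow> nat \<Rightarrow> nat \<Rightarrow> (nat \<Rightarrow> nat \<Rightarrow> bool) \<Rightarrow> dstate \<Rightarrow> dstate" where
  "cluster_round k m b K G y = (\<lambda>v.
     (fst (y v) \<and> \<not> cluster_mis k m b K G y v \<and> \<not> (\<exists>u. G v u \<and> cluster_mis k m b K G y u),
      fst (snd (y v)) \<or> cluster_mis k m b K G y v, snd (snd (y v))))"

definition cluster_iter :: "nat \<Rightarrow> nat \<Rightarrow> nat \<Rightarrow> nat \<Rightarrow> (nat \<Rightarrow> nat \<Rightarrow> bool) \<Rightarrow> dstate \<Rightarrow> dstate" where
  "cluster_iter k m b K E y = cluster_round k m b K (induced E {u. fst (y u)}) y"

text \<open>The summands are the colouring, the \<open>b * K\<close> clustering steps and the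
  inspection of clusters; of the final 2, one step informs the neighbours and one restricts the
  graph to undecided vertices.\<close>

definition cluster_radius :: "nat \<Rightarrow> nat \<Rightarrow> nat" where
  "cluster_radius b K = 2 * (b * K) + 1 + b * (K * Suc (2 * (b * K + 1))) + 2 * (b * K) + 2"

lemma is_local_cluster_iter: "is_local (cluster_radius b K) (\<lambda>E y. cluster_iter k m b K E y)"
proof -
  let ?p = "2 * (b * K) + 1" and ?q = "2 * (b * K + 1)"
  have "is_local 0 (\<lambda>G (y :: dstate) v. snd (snd (y v)))" by (rule is_local_pointwise)
  from is_local_comp[OF this is_local_colour]
  have c: "is_local ?p (\<lambda>G (y :: dstate). colour k m G ?p (\<lambda>u. snd (snd (y u))))" by simp
  have "is_local ?p (\<lambda>G (y :: dstate) v. fst (y v))" by (rule is_local_mono[OF is_local_pointwise]) simp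
  from is_local_app[OF this c, where h = Pair]
  have "is_local ?p (\<lambda>G (y :: dstate) v. (fst (y v), colour k m G ?p (\<lambda>u. snd (snd (y u))) v))" .
  from is_local_comp[OF this is_local_pointwise[where f = "\<lambda>v (a, c). if a then Some (v, c) else None"]]
  have "is_local ?p (\<lambda>G y. initial_labels k m ?p G y)"
    by (simp add: initial_labels_def[abs_def])
  from is_local_comp[OF this is_local_rg_phases[of b K ?q b]]
  have "is_local (?p + b * (K * Suc ?q)) (\<lambda>G y. final_labels k m b K G y)"
    by (simp only: final_labels_def)
  from is_local_comp[OF this is_local_solve_comps[of "2 * (b * K)" "\<lambda>x. x \<noteq> None"]]
  have mis: "is_local (?p + b * (K * Suc ?q) + 2 * (b * K)) (\<lambda>G y. cluster_mis k m b K G y)" (is "is_local ?R _")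
    by (simp only: cluster_mis_def)
  have "is_local ?R (\<lambda>G (y :: dstate). y)" by (rule is_local_mono[where r = 0]) (auto intro: is_localI)
  from is_local_app[OF this mis, where h = Pair]
  have pr: "is_local ?R (\<lambda>G y v. (y v, cluster_mis k m b K G y v))" .
  have "is_local 1 (\<lambda>G (z :: nat \<Rightarrow> (bool \<times> bool \<times> nat) \<times> bool) v.
      (fst (fst (z v)) \<and> \<not> snd (z v) \<and> \<not> (\<exists>u. G v u \<and> snd (z u)),
       fst (snd (fst (z v))) \<or> snd (z v), snd (snd (fst (z v)))))"
  proof (rule is_localI)
    fix E E' :: "nat \<Rightarrow> nat \<Rightarrow> bool" and z z' :: "nat \<Rightarrow> (bool \<times> bool \<times> nat) \<times> bool" and v
    assume *: "\<And>u. u \<in> nball E 1 v \<Longrightarrow> E u = E' u" "\<And>u. u \<in> nball E 1 v \<Longrightarrow> z u = z' u"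
    have "E v = E' v" "z v = z' v" using *(1)[of v] *(2)[of v] by auto
    moreover have "z u = z' u" if "E v u" for u using *(2)[of u] that by simp
    ultimately have "(\<exists>u. E v u \<and> snd (z u)) = (\<exists>u. E' v u \<and> snd (z' u))" by metis
    then show "(fst (fst (z v)) \<and> \<not> snd (z v) \<and> \<not> (\<exists>u. E v u \<and> snd (z u)),
       fst (snd (fst (z v))) \<or> snd (z v), snd (snd (fst (z v)))) =
      (fst (fst (z' v)) \<and> \<not> snd (z' v) \<and> \<not> (\<exists>u. E' v u \<and> snd (z' u)),
       fst (snd (fst (z' v))) \<or> snd (z' v), snd (snd (fst (z' v))))"
      using \<open>z v = z' v\<close> by simp
  qed
  from is_local_comp[OF pr this]
  have "is_local (?R + 1) (\<lambda>G y. cluster_round k m b K G y)"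
    by (simp only: cluster_round_def fst_conv snd_conv)
  from is_local_induced[OF this, where P = fst] show ?thesis
    by (simp only: cluster_iter_def cluster_radius_def) (simp add: add_ac)
qed

section \<open>Halving the undecided part of every component\<close>

locale cluster_ctx = graph_ctx +
  fixes U\<^sub>0 :: "nat set" and x :: "nat \<Rightarrow> nat" and k m b K s :: nat
  assumes U\<^sub>0: "U\<^sub>0 \<subseteq> V"
    and comp: "\<And>v. v \<in> U\<^sub>0 \<Longrightarrow> card (reach E U\<^sub>0 v) \<le> s"
    and ids: "\<And>v. v \<in> V \<Longrightarrow> x v < 2 ^ k" "inj_on x V"
    and params: "1 \<le> k" "s * k \<le> m" "2 * m * m \<le> 2 ^ b" "1 \<le> b" "s * (2 * b) ^ K < (2 * b + 1) ^ K"
begin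

context
  fixes y :: dstate and U I :: "nat set"
  assumes U: "U = {v \<in> V. fst (y v)}" and I: "I = {v \<in> V. fst (snd (y v))}"
    and UU: "U \<subseteq> U\<^sub>0" and yx: "\<forall>v\<in>V. snd (snd (y v)) = x v"
    and part: "partial_mis V E U I"
begin

lemma iter_graph: "induced E {u. fst (y u)} = induced E U"
  using EV by (auto simp: induced_def U fun_eq_iff)

text \<open>The clustered set is the trace of an original component on \<open>U\<close>. It may be
  disconnected by now, but it is closed under the remaining edges and inherits the size bound
  \<open>s\<close>, so the parameters never change.\<close>

lemma iter_clustering:
  assumes v: "v \<in> U\<^sub>0"
  shows "2 * card {w \<in> reach E U\<^sub>0 v \<inter> U. final_labels k m b K (induced E U) y w = None} \<le> card (reach E U\<^sub>0 v \<inter> U)"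
    and "\<And>u w. u \<in> reach E U\<^sub>0 v \<inter> U \<Longrightarrow>
       (induced (induced E U) {w. final_labels k m b K (induced E U) y w \<noteq> None})\<^sup>*\<^sup>* u w \<Longrightarrow>
       w \<in> nball (induced E U) (2 * (b * K)) u"
proof -
  let ?G = "induced E U" and ?C = "reach E U\<^sub>0 v \<inter> U" and ?r0 = "2 * (b * K) + 1"
  let ?x = "\<lambda>u. snd (snd (y u))"
  let ?col = "colour k m ?G ?r0 ?x"
  have UV: "U \<subseteq> V" using U by auto
  have finC: "finite ?C" using UV finV finite_subset by blast
  have reach_fin: "finite (reach E U\<^sub>0 v)"
    by (rule finite_subset[OF _ finV]) (use induced_rtranclp_in U\<^sub>0 v in \<open>auto simp: reach_def\<close>)
  have closed: "w \<in> ?C" if "u \<in> ?C" "?G u w" for u w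
    using that UU by (auto simp: reach_def induced_def intro: rtranclp.rtrancl_into_rtrancl)
  have cardC: "card ?C \<le> s"
    using card_mono[OF reach_fin, of ?C] comp[OF v] by auto
  interpret clustering ?G ?C ?col b "2 * (b * K + 1)" s K
    by unfold_locales (use Esym closed finC cardC params in \<open>auto simp: induced_def\<close>)
  have nb: "nball ?G ?r0 u \<subseteq> ?C" if "u \<in> ?C" for u by (rule nball_C[OF that])
  have nbf: "finite (nball ?G ?r0 u)" "card (nball ?G ?r0 u) \<le> s" if "u \<in> ?C" for u
    using finite_subset[OF nb[OF that] finC] card_mono[OF finC nb[OF that]] cardC by auto
  have xid: "?x w < 2 ^ k" if "u \<in> ?C" "w \<in> nball ?G ?r0 u" for u w
  proof -
    have "w \<in> V" using nb[OF that(1)] that(2) UV by blast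
    then show ?thesis using ids(1) yx by simp
  qed
  have xinj: "inj_on ?x (nball ?G ?r0 u)" if "u \<in> ?C" for u
  proof -
    have "nball ?G ?r0 u \<subseteq> V" using nb[OF that] UV by blast
    then have "inj_on x (nball ?G ?r0 u)" using ids(2) inj_on_subset by blast
    moreover have "?x w = x w" if "w \<in> nball ?G ?r0 u" for w
      using yx that \<open>nball ?G ?r0 u \<subseteq> V\<close> by blast
    ultimately show ?thesis by (simp add: inj_on_def)
  qed
  have fl: "final_labels k m b K ?G y = rg_phases ?G (2 * (b * K + 1)) b K b (initial_labels k m ?r0 ?G y)"
    by (simp add: final_labels_def)
  have init: "initial_labels k m ?r0 ?G y u = Some (u, ?col u)" if "u \<in> ?C" for u
    using that by (simp add: initial_labels_def U)
  have cless: "?col u < 2 ^ b" if "u \<in> ?C" for u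
    using colour_less[OF params(1,2) nbf[OF that] xid[OF that] xinj[OF that]] params(3) by simp
  have proper: "?col u \<noteq> ?col w" if "u \<in> ?C" "w \<in> ?C" "u \<in> nball ?G ?r0 w" "u \<noteq> w" for u w
  proof (rule colour_neq[OF params(1,2) _ _ _ _ that(3,4)])
    have C: "a \<in> ?C" if "a \<in> {u, w}" for a using that \<open>u \<in> ?C\<close> \<open>w \<in> ?C\<close> by blast
    show "finite (nball ?G ?r0 a)" "card (nball ?G ?r0 a) \<le> s" "inj_on ?x (nball ?G ?r0 a)"
      if "a \<in> {u, w}" for a
      using nbf[OF C[OF that]] xinj[OF C[OF that]] by blast+
    show "?x z < 2 ^ k" if "a \<in> {u, w}" "z \<in> nball ?G ?r0 a" for a z
      by (rule xid[OF C[OF that(1)] that(2)])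
  qed
  show "2 * card {w \<in> ?C. final_labels k m b K ?G y w = None} \<le> card ?C"
    unfolding fl by (rule clustering_correct(1)[OF init cless proper])
  show "w \<in> nball ?G (2 * (b * K)) u"
    if "u \<in> ?C" "(induced ?G {w. final_labels k m b K ?G y w \<noteq> None})\<^sup>*\<^sup>* u w" for u w
    by (rule clustering_correct(2)[OF init cless proper that(1) that(2)[unfolded fl]])
qed

text \<open>Every vertex that keeps a label is decided by the independent set computed on the
  clusters, so only unlabelled vertices stay undecided, at most half of each original
  component.\<close>

lemma iter_step:
  defines "y' \<equiv> cluster_iter k m b K E y"
  defines "U' \<equiv> {v \<in> V. fst (y' v)}"
  shows "U' \<subseteq> U" and "\<And>v. v \<in> V \<Longrightarrow> snd (snd (y' v)) = x v"
    and "partial_mis V E U' {v \<in> V. fst (snd (y' v))}"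
    and "\<And>v. v \<in> U\<^sub>0 \<Longrightarrow> 2 * card (reach E U\<^sub>0 v \<inter> U') \<le> card (reach E U\<^sub>0 v \<inter> U)"
proof -
  let ?G = "induced E U"
  let ?fl = "final_labels k m b K ?G y"
  define W where "W = {u. ?fl u \<noteq> None}"
  define J where "J = {v \<in> V. cluster_mis k m b K ?G y v}"
  have Gsym: "?G u v \<Longrightarrow> ?G v u" for u v using Esym by (auto simp: induced_def)
  have y': "y' v = (fst (y v) \<and> \<not> cluster_mis k m b K ?G y v \<and> \<not> (\<exists>u. ?G v u \<and> cluster_mis k m b K ?G y u),
      fst (snd (y v)) \<or> cluster_mis k m b K ?G y v, snd (snd (y v)))" for v
    by (simp add: y'_def cluster_iter_def iter_graph cluster_round_def)
  show "U' \<subseteq> U" by (auto simp: U'_def U y')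
  show "snd (snd (y' v)) = x v" if "v \<in> V" for v using yx that by (simp add: y')
  have WU: "W \<inter> V \<subseteq> U"
  proof
    fix v assume v: "v \<in> W \<inter> V"
    show "v \<in> U"
    proof (rule ccontr)
      assume "v \<notin> U"
      then have "\<not> fst (y v)" using v U by auto
      then have n: "initial_labels k m (2 * (b * K) + 1) ?G y v = None" by (simp add: initial_labels_def)
      have stay: "(rg_step ?G r b i ^^ j) cl v = None" if "cl v = None" for r i j cl
        by (induction j) (simp_all add: that rg_step_def target_None_label)
      have "rg_phases ?G r b K i cl v = None" if "cl v = None" for r i cl
        by (induction i) (simp_all add: that stay)
      then show False using v n by (simp add: W_def final_labels_def)
    qed
  qed
  have Jmis: "mis_on ?G (W \<inter> V) J"
  proof -
    have Vcl: "nball ?G R v \<subseteq> V" if "v \<in> V" for R v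
      by (rule nball_subset_closed[OF _ that]) (use EV in \<open>auto simp: induced_def\<close>)
    have "J = {v. solve_comps (2 * (b * K)) ?G (W \<inter> V) v}"
    proof (intro set_eqI iffI)
      fix v assume "v \<in> J"
      then show "v \<in> {v. solve_comps (2 * (b * K)) ?G (W \<inter> V) v}"
        using solve_comps_restrict[OF Vcl, of v "2 * (b * K)" W]
        by (simp add: J_def cluster_mis_def W_def)
    next
      fix v assume v: "v \<in> {v. solve_comps (2 * (b * K)) ?G (W \<inter> V) v}"
      then have "v \<in> V" by (simp add: solve_comps_def)
      then show "v \<in> J"
        using v solve_comps_restrict[OF Vcl, of v "2 * (b * K)" W]
        by (simp add: J_def cluster_mis_def W_def)
    qed
    moreover have "mis_on ?G (W \<inter> V) {v. solve_comps (2 * (b * K)) ?G (W \<inter> V) v}"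
    proof (rule solve_comps_correct)
      fix v w assume v: "v \<in> W \<inter> V" and vw: "(induced ?G (W \<inter> V))\<^sup>*\<^sup>* v w"
      have "v \<in> U\<^sub>0" "v \<in> U" using v WU UU by auto
      have "(induced ?G W)\<^sup>*\<^sup>* v w"
        using vw by (rule rtranclp_mono[THEN predicate2D, rotated]) (auto simp: induced_def)
      then show "w \<in> nball ?G (2 * (b * K)) v"
        using iter_clustering(2)[OF \<open>v \<in> U\<^sub>0\<close>, of v w] \<open>v \<in> U\<close> by (simp add: reach_def W_def)
    qed (use Gsym Eirr finV in \<open>auto simp: induced_def\<close>)
    ultimately show ?thesis by simp
  qed
  have JU: "J \<subseteq> U" using Jmis WU by (auto simp: mis_on_def)
  have nbJ: "(\<exists>u. ?G v u \<and> cluster_mis k m b K ?G y u) \<longleftrightarrow> v \<in> U \<and> (\<exists>u\<in>J. E v u)" for v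
    using EV JU by (auto simp: induced_def J_def U)
  have U'_eq: "U' = U - J - {v. \<exists>u\<in>J. E v u}"
  proof (intro set_eqI iffI)
    fix v assume "v \<in> U'"
    then have "v \<in> V" "fst (y v)" "\<not> cluster_mis k m b K ?G y v"
        "\<not> (\<exists>u. ?G v u \<and> cluster_mis k m b K ?G y u)" by (auto simp: U'_def y')
    then show "v \<in> U - J - {v. \<exists>u\<in>J. E v u}" using nbJ[of v] by (auto simp: U J_def)
  next
    fix v assume v: "v \<in> U - J - {v. \<exists>u\<in>J. E v u}"
    then show "v \<in> U'" using nbJ[of v] by (auto simp: U'_def y' U J_def)
  qed
  have I': "{v \<in> V. fst (snd (y' v))} = I \<union> J" by (auto simp: y' I J_def)
  show "partial_mis V E U' {v \<in> V. fst (snd (y' v))}"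
    unfolding I'
  proof (rule partial_mis_extend[OF part Esym JU _ U'_eq])
    show "\<forall>u\<in>J. \<forall>v\<in>J. \<not> E u v"
    proof (intro ballI)
      fix u v assume uv: "u \<in> J" "v \<in> J"
      then have "\<not> ?G u v" using Jmis by (simp add: mis_on_def)
      then show "\<not> E u v" using uv JU by (auto simp: induced_def)
    qed
  qed
  fix v assume v: "v \<in> U\<^sub>0"
  have "reach E U\<^sub>0 v \<inter> U' \<subseteq> {w \<in> reach E U\<^sub>0 v \<inter> U. ?fl w = None}"
  proof
    fix w assume w: "w \<in> reach E U\<^sub>0 v \<inter> U'"
    then have wU: "w \<in> U" "w \<notin> J" "\<not> (\<exists>u\<in>J. E w u)" using U'_eq by auto
    have "w \<notin> W"
    proof
      assume "w \<in> W"
      then have "w \<in> W \<inter> V - J" using wU U by auto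
      then obtain u where "u \<in> J" "?G w u" using Jmis unfolding mis_on_def by blast
      then show False using wU(3) by (auto simp: induced_def)
    qed
    then have "?fl w = None" unfolding W_def by blast
    then show "w \<in> {w \<in> reach E U\<^sub>0 v \<inter> U. ?fl w = None}" using w wU by blast
  qed
  then have "card (reach E U\<^sub>0 v \<inter> U') \<le> card {w \<in> reach E U\<^sub>0 v \<inter> U. ?fl w = None}"
    by (rule card_mono[rotated]) (rule finite_subset[OF _ finV], use U in auto)
  then show "2 * card (reach E U\<^sub>0 v \<inter> U') \<le> card (reach E U\<^sub>0 v \<inter> U)"
    using iter_clustering(1)[OF v] by linarith
qed

end

lemma cluster_iterate:
  assumes y: "{v \<in> V. fst (y v)} = U\<^sub>0" "partial_mis V E U\<^sub>0 {v \<in> V. fst (snd (y v))}"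
      "\<And>v. v \<in> V \<Longrightarrow> snd (snd (y v)) = x v"
    and n: "s < 2 ^ n"
  shows "maximal_independent_set V E {v \<in> V. fst (snd ((cluster_iter k m b K E ^^ n) y v))}"
proof -
  define z where "z = (\<lambda>j. (cluster_iter k m b K E ^^ j) y)"
  define U where "U = (\<lambda>j. {v \<in> V. fst (z j v)})"
  have inv: "U j \<subseteq> U\<^sub>0 \<and> (\<forall>v\<in>V. snd (snd (z j v)) = x v)
      \<and> partial_mis V E (U j) {v \<in> V. fst (snd (z j v))}
      \<and> (\<forall>v\<in>U\<^sub>0. 2 ^ j * card (reach E U\<^sub>0 v \<inter> U j) \<le> s)" for j
  proof (induction j)
    case 0
    have "reach E U\<^sub>0 v \<inter> U\<^sub>0 = reach E U\<^sub>0 v" if "v \<in> U\<^sub>0" for v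
      using induced_rtranclp_in that by (auto simp: reach_def)
    then show ?case using y comp by (simp add: z_def U_def)
  next
    case (Suc j)
    have zS: "z (Suc j) = cluster_iter k m b K E (z j)" by (simp add: z_def)
    have IH: "U j \<subseteq> U\<^sub>0" "\<forall>v\<in>V. snd (snd (z j v)) = x v"
      "partial_mis V E (U j) {v \<in> V. fst (snd (z j v))}"
      "\<And>v. v \<in> U\<^sub>0 \<Longrightarrow> 2 ^ j * card (reach E U\<^sub>0 v \<inter> U j) \<le> s"
      using Suc by auto
    note st = iter_step[OF U_def[THEN fun_cong, of j] refl IH(1-3), folded zS, folded U_def[THEN fun_cong, of "Suc j"]]
    have "2 ^ Suc j * card (reach E U\<^sub>0 v \<inter> U (Suc j)) \<le> s" if "v \<in> U\<^sub>0" for v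
    proof -
      have "2 ^ j * (2 * card (reach E U\<^sub>0 v \<inter> U (Suc j))) \<le> 2 ^ j * card (reach E U\<^sub>0 v \<inter> U j)"
        by (rule mult_left_mono[OF st(4)[OF that]]) simp
      also have "\<dots> \<le> s" by (rule IH(4)[OF that])
      finally show ?thesis by (simp only: power_Suc mult_ac)
    qed
    then show ?case using st(1,2,3) IH(1) by blast
  qed
  have "U n = {}"
  proof (rule ccontr)
    assume "U n \<noteq> {}"
    then obtain v where v: "v \<in> U n" by blast
    then have "v \<in> U\<^sub>0" using inv[of n] by blast
    have "v \<in> reach E U\<^sub>0 v \<inter> U n" using v by (simp add: reach_def)
    moreover have "finite (U n)" using finV by (simp add: U_def)
    ultimately have "1 \<le> card (reach E U\<^sub>0 v \<inter> U n)"
      using card_gt_0_iff[of "reach E U\<^sub>0 v \<inter> U n"] by auto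
    then have "2 ^ n * 1 \<le> 2 ^ n * card (reach E U\<^sub>0 v \<inter> U n)" by (intro mult_left_mono) auto
    also have "\<dots> \<le> s" using inv[of n] \<open>v \<in> U\<^sub>0\<close> by blast
    finally show False using n by simp
  qed
  then have "partial_mis V E {} {v \<in> V. fst (snd (z n v))}" using inv[of n] by simp
  then show ?thesis unfolding z_def by (intro mis_on_maximal partial_mis_empty)
qed

end

subsection \<open>The bound for polylogarithmic maximum degree\<close>

text \<open>A crude upper bound for the binary logarithm, valid because ln 2 is at least
  1/2.\<close>

definition lg :: "nat \<Rightarrow> nat" where "lg n = nat \<lceil>2 * ln (real n)\<rceil>"

lemma le_power_lg: "1 \<le> n \<Longrightarrow> n \<le> 2 ^ lg n"
proof -
  assume n: "1 \<le> n"
  have "ln (real n) \<le> (2 * ln (real n)) * ln 2"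
    using mult_left_mono[of "1/2" "ln 2" "2 * ln (real n)"] ln2_ge_two_thirds n by simp
  also have "\<dots> \<le> real (lg n) * ln 2"
    using nat_ceiling_bounds(1)[of "2 * ln (real n)"] n by (intro mult_right_mono) (auto simp: lg_def)
  finally have "exp (ln (real n)) \<le> exp (real (lg n) * ln 2)" by simp
  also have "\<dots> = 2 ^ lg n" by (subst exp_of_nat_mult) simp
  finally have "real n \<le> real (2 ^ lg n)" using n by simp
  then show ?thesis by (simp only: of_nat_le_iff)
qed

lemma lg_le: "1 \<le> n \<Longrightarrow> real (lg n) \<le> 2 * ln (real n) + 1"
  unfolding lg_def by (rule nat_ceiling_bounds(2)) simp

text \<open>By Bernoulli's inequality, \<open>2 * b\<close> steps with growth factor
  \<open>1 + 1/(2 * b)\<close> double a cluster.\<close>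

lemma growth_beats_size:
  assumes "1 \<le> b" "s < 2 ^ n"
  shows "s * (2 * b) ^ (2 * b * n) < (2 * b + 1) ^ (2 * b * n)"
proof -
  have "1 + real (2 * b) * (1 / real (2 * b)) \<le> (1 + 1 / real (2 * b)) ^ (2 * b)"
    by (rule Bernoulli_inequality) (use assms(1) in \<open>simp add: field_simps\<close>)
  then have "2 \<le> (1 + 1 / real (2 * b)) ^ (2 * b)" using assms(1) by simp
  then have "2 * real (2 * b) ^ (2 * b) \<le> (1 + 1 / real (2 * b)) ^ (2 * b) * real (2 * b) ^ (2 * b)"
    by (rule mult_right_mono) simp
  also have "\<dots> = (real (2 * b) + 1) ^ (2 * b)"
  proof -
    have "(1 + 1 / real (2 * b)) * real (2 * b) = real (2 * b) + 1" using assms(1) by (simp add: field_simps)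
    then show ?thesis by (simp only: power_mult_distrib[symmetric])
  qed
  finally have "real (2 * (2 * b) ^ (2 * b)) \<le> real ((2 * b + 1) ^ (2 * b))"
    by (simp add: add.commute)
  then have two: "2 * (2 * b) ^ (2 * b) \<le> (2 * b + 1) ^ (2 * b)" by (simp only: of_nat_le_iff)
  have "s * (2 * b) ^ (2 * b * n) < 2 ^ n * (2 * b) ^ (2 * b * n)"
    using assms by (intro mult_strict_right_mono) auto
  also have "\<dots> = (2 * (2 * b) ^ (2 * b)) ^ n" by (simp only: power_mult power_mult_distrib)
  also have "\<dots> \<le> ((2 * b + 1) ^ (2 * b)) ^ n" by (rule power_mono[OF two]) simp
  also have "\<dots> = (2 * b + 1) ^ (2 * b * n)" by (simp only: power_mult)
  finally show ?thesis .
qed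

text \<open>Each of the two bad events, failed shattering and colliding identifiers, gets half of
  the failure budget; the surplus in the exponents pays for the halving and for the square.\<close>

lemma tail_le_half:
  assumes c: "c > 0"
  shows "real N * exp (- ((c + 2) * ln (real N + 2))) \<le> (1 / (real N powr c)) / 2"
    and "(real N)\<^sup>2 * exp (- ((c + 3) * ln (real N + 2))) \<le> (1 / (real N powr c)) / 2"
proof -
  let ?M = "real N + 2"
  have e: "exp (- ln ?M) = 1 / ?M" by (simp add: exp_minus divide_inverse)
  have t: "real N * exp (- ((c + 1) * ln ?M)) \<le> 1 / (real N powr c)" by (rule tail_le[OF c])
  have t0: "0 \<le> 1 / (real N powr c)" by simp
  have "real N * exp (- ((c + 2) * ln ?M)) = real N * exp (- ((c + 1) * ln ?M)) * exp (- ln ?M)"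
    by (simp add: mult.assoc exp_add[symmetric] algebra_simps)
  also have "\<dots> \<le> 1 / (real N powr c) * (1 / 2)"
    unfolding e by (rule mult_mono[OF t]) (auto simp: field_simps)
  finally show "real N * exp (- ((c + 2) * ln ?M)) \<le> (1 / (real N powr c)) / 2" by simp
  have "(real N)\<^sup>2 * exp (- ((c + 3) * ln ?M))
      = real N * exp (- ((c + 1) * ln ?M)) * (real N * exp (- ln ?M) * exp (- ln ?M))"
    by (simp add: power2_eq_square mult_ac exp_add[symmetric]) (simp add: algebra_simps)
  also have "\<dots> \<le> 1 / (real N powr c) * (1 / 2)"
  proof (rule mult_mono[OF t])
    have "real N * 2 \<le> ?M * ?M" by (simp add: algebra_simps)
    then have "real N / (?M * ?M) \<le> 1 / 2" by (subst pos_divide_le_eq) auto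
    then show "real N * exp (- ln ?M) * exp (- ln ?M) \<le> 1 / 2" unfolding e by simp
  qed auto
  finally show "(real N)\<^sup>2 * exp (- ((c + 3) * ln ?M)) \<le> (1 / (real N powr c)) / 2" by simp
qed

text \<open>All parameters depend on \<open>N\<close> only through \<open>Y = ln (N + 3)\<close>; \<open>e\<close> is the exponent of the
  degree bound.\<close>

locale polylog_params =
  fixes c :: real and e :: nat
  assumes c: "c > 0"
begin

definition Y :: "nat \<Rightarrow> real" where "Y N = ln (real N + 3)"
text \<open>Computed from \<open>N\<close> alone and used in place of the given \<open>D\<close>, so
  that the round count depends only on \<open>N\<close>.\<close>

definition deg_bound :: "nat \<Rightarrow> nat" where "deg_bound N = nat \<lfloor>Y N ^ e\<rfloor>"
definition list_len :: "nat \<Rightarrow> nat" where "list_len N = nat \<lceil>Y N\<rceil>"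
text \<open>A constant exponent \<open>c + 2\<close> per list entry is enough here, since the lists
  already have about log N entries.\<close>

definition time_bound :: "nat \<Rightarrow> real" where
  "time_bound N = (ln 2 + ln (real (list_len N)) + 6 * ln (real (deg_bound N) + 1) + (c + 2)) / (join_prob / 40)"
definition mark_rounds :: "nat \<Rightarrow> nat" where "mark_rounds N = nat \<lceil>time_bound N\<rceil>"
definition comp_bound :: "nat \<Rightarrow> nat" where "comp_bound N = list_len N * (deg_bound N + 1) ^ 4"
text \<open>The factor 3/2 compensates ln 2 being at least 2/3: a given identifier has probability
  at most \<open>exp (- ((c + 3) * Y N))\<close>.\<close>

definition id_bits :: "nat \<Rightarrow> nat" where "id_bits N = nat \<lceil>3/2 * (c + 3) * Y N\<rceil>"
definition codelen :: "nat \<Rightarrow> nat" where "codelen N = comp_bound N * id_bits N"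
definition colbits :: "nat \<Rightarrow> nat" where "colbits N = 1 + 2 * lg (codelen N)"
definition iters :: "nat \<Rightarrow> nat" where "iters N = Suc (lg (comp_bound N))"
definition phase_len :: "nat \<Rightarrow> nat" where "phase_len N = 2 * colbits N * iters N"
definition total_radius :: "nat \<Rightarrow> nat" where
  "total_radius N = 2 * mark_rounds N + iters N * cluster_radius (colbits N) (phase_len N)"

text \<open>This is the reason for the shift by 3 in \<open>Y\<close>: it makes \<open>Y N\<close>
  exceed 1, so \<open>ln (Y N)\<close> and its root are bounded away from 0.\<close>

lemma ln3: "1 < ln (3 :: real)"
  using exp_le exp_gt_one ln_less_cancel_iff[of "exp 1" 3] e_less_272 by simp

lemma Y_gt_1: "ln 3 \<le> Y N" "1 < Y N"
proof -
  show "ln 3 \<le> Y N" by (simp add: Y_def)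
  then show "1 < Y N" using ln3 by linarith
qed

lemma list_len_bounds: "Y N \<le> real (list_len N)" "real (list_len N) \<le> 2 * Y N" "1 \<le> list_len N"
proof -
  show 1: "Y N \<le> real (list_len N)" using nat_ceiling_bounds(1)[of "Y N"] Y_gt_1[of N] by (simp add: list_len_def)
  show "real (list_len N) \<le> 2 * Y N" 
    using nat_ceiling_bounds(2)[of "Y N"] Y_gt_1(2)[of N] unfolding list_len_def by linarith
  show "1 \<le> list_len N" using 1 Y_gt_1[of N] by (cases "list_len N") auto
qed

lemma deg_bound_bounds: "real D \<le> ln (real N + 2) ^ e \<Longrightarrow> D \<le> deg_bound N" "real (deg_bound N) + 1 \<le> 2 * Y N ^ e"
proof -
  have Ye: "1 \<le> Y N ^ e" using Y_gt_1(2)[of N] by (intro one_le_power) simp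
  show "real (deg_bound N) + 1 \<le> 2 * Y N ^ e"
    using Ye of_nat_floor[of "Y N ^ e"] unfolding deg_bound_def by linarith
  assume "real D \<le> ln (real N + 2) ^ e"
  also have "\<dots> \<le> Y N ^ e" unfolding Y_def by (intro power_mono) auto
  finally show "D \<le> deg_bound N" unfolding deg_bound_def by (simp add: le_nat_floor)
qed

lemma id_bits_bounds: "3/2 * (c + 3) * Y N \<le> real (id_bits N)" "real (id_bits N) \<le> (3/2 * (c + 3) + 1) * Y N" "1 \<le> id_bits N"
proof -
  have p: "0 < 3/2 * (c + 3) * Y N" using c Y_gt_1(2)[of N] by (intro mult_pos_pos) auto
  show 1: "3/2 * (c + 3) * Y N \<le> real (id_bits N)"
    unfolding id_bits_def by (rule nat_ceiling_bounds(1)) (use p in simp)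
  have "real (id_bits N) \<le> 3/2 * (c + 3) * Y N + 1"
    unfolding id_bits_def by (rule nat_ceiling_bounds(2)) (use p in simp)
  also have "\<dots> \<le> (3/2 * (c + 3) + 1) * Y N" using Y_gt_1(2)[of N] by (simp add: algebra_simps)
  finally show "real (id_bits N) \<le> (3/2 * (c + 3) + 1) * Y N" .
  show "1 \<le> id_bits N" using 1 p by (cases "id_bits N") auto
qed

lemma comp_bound_pos: "1 \<le> comp_bound N"
  using list_len_bounds(3)[of N] by (simp add: comp_bound_def)

lemma codelen_pos: "1 \<le> codelen N"
  using comp_bound_pos[of N] id_bits_bounds(3)[of N] by (simp add: codelen_def)

lemma cluster_params:
  "2 * codelen N * codelen N \<le> 2 ^ colbits N" "1 \<le> colbits N" "comp_bound N < 2 ^ iters N"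
  "comp_bound N * (2 * colbits N) ^ phase_len N < (2 * colbits N + 1) ^ phase_len N"
proof -
  have "codelen N * codelen N \<le> 2 ^ lg (codelen N) * 2 ^ lg (codelen N)"
    using le_power_lg[OF codelen_pos] by (intro mult_mono) auto
  also have "\<dots> = 2 ^ (2 * lg (codelen N))" by (simp add: mult_2 power_add)
  finally show "2 * codelen N * codelen N \<le> 2 ^ colbits N" by (simp add: colbits_def mult.assoc)
  show "1 \<le> colbits N" by (simp add: colbits_def)
  have "comp_bound N \<le> 2 ^ lg (comp_bound N)" by (rule le_power_lg[OF comp_bound_pos])
  also have "\<dots> < 2 ^ iters N" by (simp add: iters_def)
  finally show n: "comp_bound N < 2 ^ iters N" .
  show "comp_bound N * (2 * colbits N) ^ phase_len N < (2 * colbits N + 1) ^ phase_len N"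
    unfolding phase_len_def by (rule growth_beats_size[OF _ n]) (simp add: colbits_def)
qed

lemma time_bound_le: "time_bound N \<le> real (mark_rounds N)" "real (mark_rounds N) \<le> time_bound N + 1"
proof -
  have "0 \<le> time_bound N" unfolding time_bound_def
    using list_len_bounds(3)[of N] c join_prob_bounds by (intro divide_nonneg_pos add_nonneg_nonneg) auto
  then show "time_bound N \<le> real (mark_rounds N)" "real (mark_rounds N) \<le> time_bound N + 1"
    using nat_ceiling_bounds unfolding mark_rounds_def by auto
qed

text \<open>The exponent 7: \<open>iters\<close>, \<open>colbits\<close> and
  \<open>mark_rounds\<close> are linear in \<open>z = a * (1 + ln (Y N))\<close>, so
  \<open>phase_len\<close> is quadratic and its product with \<open>colbits\<close> cubic. The
  cluster radius is quadratic in that product, giving 6, and it is paid \<open>iters\<close>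
  times.\<close>

lemma total_radius_poly:
  "\<exists>a\<ge>1. \<forall>N. real (total_radius N) \<le> 100 * (a * (1 + ln (Y N))) ^ 7"
proof -
  define a0 where "a0 = ln (3/2 * (c + 3) + 1)"
  have "0 \<le> 3/2 * (c + 3)" using c by (intro mult_nonneg_nonneg) auto
  then have a0_pos: "0 < 3/2 * (c + 3) + 1" by (rule add_nonneg_pos) simp
  define a1 where "a1 = 5 + 4 * real e"
  define a where "a = a1 * 4 + 4 * (1 + \<bar>a0\<bar>) + 3 + (12 + 6 * real e + c) / (join_prob / 40)"
  have l: "0 \<le> ln (Y N)" for N using Y_gt_1(2)[of N] by simp
  have a1: "1 \<le> a1" by (simp add: a1_def)
  have lln2: "ln 2 \<le> (1 :: real)" using ln_le_minus_one[of "2::real"] by simp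
  have llen: "ln (real (list_len N)) \<le> 1 + ln (Y N)" for N
  proof -
    have "ln (real (list_len N)) \<le> ln (2 * Y N)" using list_len_bounds[of N] by simp
    also have "\<dots> = ln 2 + ln (Y N)" using Y_gt_1(2)[of N] by (simp add: ln_mult)
    finally show ?thesis using lln2 by simp
  qed
  have ldeg: "ln (real (deg_bound N) + 1) \<le> 1 + real e * ln (Y N)" for N
  proof -
    have "ln (real (deg_bound N) + 1) \<le> ln (2 * Y N ^ e)"
      using deg_bound_bounds(2)[of N] Y_gt_1(2)[of N] by (subst ln_le_cancel_iff) auto
    also have "\<dots> = ln 2 + ln (Y N ^ e)" using Y_gt_1(2)[of N] by (simp add: ln_mult)
    also have "ln (Y N ^ e) = real e * ln (Y N)" using Y_gt_1(2)[of N] by (simp add: ln_realpow)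
    finally show ?thesis using lln2 by simp
  qed
  have lsize: "ln (real (comp_bound N)) \<le> a1 * (1 + ln (Y N))" for N
  proof -
    have "real (comp_bound N) = real (list_len N) * (real (deg_bound N) + 1) ^ 4" by (simp add: comp_bound_def add.commute)
    then have "ln (real (comp_bound N)) = ln (real (list_len N)) + ln ((real (deg_bound N) + 1) ^ 4)"
      using list_len_bounds(3)[of N] by (simp add: ln_mult)
    also have "ln ((real (deg_bound N) + 1) ^ 4) = real 4 * ln (real (deg_bound N) + 1)" by (rule ln_realpow)
    finally have "ln (real (comp_bound N)) \<le> 1 + ln (Y N) + 4 * (1 + real e * ln (Y N))"
      using llen[of N] ldeg[of N] by simp
    also have "\<dots> \<le> a1 * (1 + ln (Y N))" using l[of N] by (simp add: a1_def algebra_simps)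
    finally show ?thesis .
  qed
  have lbits: "ln (real (id_bits N)) \<le> (1 + \<bar>a0\<bar>) * (1 + ln (Y N))" for N
  proof -
    have "ln (real (id_bits N)) \<le> ln ((3/2 * (c + 3) + 1) * Y N)"
      using id_bits_bounds[of N] c Y_gt_1(2)[of N] by (subst ln_le_cancel_iff) auto
    also have "\<dots> = a0 + ln (Y N)"
      unfolding a0_def by (rule ln_mult_pos[OF a0_pos]) (use Y_gt_1(2)[of N] in simp)
    also have "\<dots> \<le> (1 + \<bar>a0\<bar>) * (1 + ln (Y N))"
    proof -
      have "0 \<le> \<bar>a0\<bar> * ln (Y N)" using l[of N] by simp
      then show ?thesis by (simp add: algebra_simps)
    qed
    finally show ?thesis .
  qed
  have lcode: "ln (real (codelen N)) \<le> (a1 + 1 + \<bar>a0\<bar>) * (1 + ln (Y N))" for N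
  proof -
    have "ln (real (codelen N)) = ln (real (comp_bound N)) + ln (real (id_bits N))"
      using comp_bound_pos[of N] id_bits_bounds(3)[of N] by (simp add: codelen_def ln_mult)
    then show ?thesis using lsize[of N] lbits[of N] by (simp add: algebra_simps)
  qed
  have gdp: "0 < join_prob / 40" using join_prob_bounds by simp
  have a_ge: "a1 * 4 + 4 * (1 + \<bar>a0\<bar>) + 3 \<le> a" "(12 + 6 * real e + c) / (join_prob / 40) + 3 \<le> a"
    using c gdp a1 by (auto simp: a_def)
  have a: "1 \<le> a" using a_ge(1) a1 by simp
  show ?thesis
  proof (intro exI[of _ a] conjI allI a)
    fix N
    define z where "z = a * (1 + ln (Y N))"
    have z1: "1 \<le> z" using mult_mono[of 1 a 1 "1 + ln (Y N)"] a l[of N] by (simp add: z_def)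
    \<comment> \<open>Constants are absorbed by \<open>1 + ln (Y N) \<ge> 1\<close>, so each bound
      only requires its coefficients to sum to at most \<open>a\<close>.\<close>
    have scale: "q * (1 + ln (Y N)) + r \<le> z" if "q + r \<le> a" "0 \<le> r" for q r
    proof -
      have "r * 1 \<le> r * (1 + ln (Y N))" using that l[of N] by (intro mult_left_mono) auto
      moreover have "(q + r) * (1 + ln (Y N)) \<le> z"
        unfolding z_def using that l[of N] by (intro mult_right_mono) auto
      ultimately show ?thesis by (simp add: distrib_right)
    qed
    have n: "real (iters N) \<le> z"
    proof -
      have "real (iters N) \<le> (2 * a1) * (1 + ln (Y N)) + 2"
        using lg_le[OF comp_bound_pos[of N]] lsize[of N] by (simp add: iters_def)
      also have "\<dots> \<le> z" by (rule scale) (use a_ge(1) a1 in auto)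
      finally show ?thesis .
    qed
    have bb: "real (colbits N) \<le> z"
    proof -
      have "real (colbits N) \<le> (4 * (a1 + 1 + \<bar>a0\<bar>)) * (1 + ln (Y N)) + 3"
      proof -
        have "real (colbits N) = 2 * real (lg (codelen N)) + 1" by (simp add: colbits_def)
        also have "\<dots> \<le> 4 * ((a1 + 1 + \<bar>a0\<bar>) * (1 + ln (Y N))) + 3"
          using lg_le[OF codelen_pos[of N]] lcode[of N] by linarith
        finally show ?thesis by (simp only: mult.assoc)
      qed
      also have "\<dots> \<le> z" by (rule scale) (use a_ge(1) in auto)
      finally show ?thesis .
    qed
    have tt: "real (mark_rounds N) \<le> z"
    proof -
      have "time_bound N \<le> ((12 + 6 * real e + c) * (1 + ln (Y N))) / (join_prob / 40)"
        unfolding time_bound_def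
      proof (rule divide_right_mono)
        have "ln 2 + ln (real (list_len N)) + 6 * ln (real (deg_bound N) + 1) + (c + 2)
            \<le> 1 + (1 + ln (Y N)) + 6 * (1 + real e * ln (Y N)) + (c + 2)"
          by (intro add_mono mult_left_mono lln2 llen ldeg order_refl) simp
        also have "\<dots> \<le> (12 + 6 * real e + c) * (1 + ln (Y N))"
        proof -
          have "0 \<le> c * ln (Y N)" using c l[of N] by simp
          then show ?thesis using l[of N] by (simp add: algebra_simps)
        qed
        finally show "ln 2 + ln (real (list_len N)) + 6 * ln (real (deg_bound N) + 1) + (c + 2)
          \<le> (12 + 6 * real e + c) * (1 + ln (Y N))" .
      qed (use gdp in simp)
      also have "\<dots> = (12 + 6 * real e + c) / (join_prob / 40) * (1 + ln (Y N))" by simp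
      finally have "real (mark_rounds N) \<le> (12 + 6 * real e + c) / (join_prob / 40) * (1 + ln (Y N)) + 1"
        using time_bound_le(2)[of N] by linarith
      also have "\<dots> \<le> z" by (rule scale) (use a_ge(2) in auto)
      finally show ?thesis .
    qed
    define X where "X = colbits N * phase_len N"
    have X1: "1 \<le> X" by (simp add: X_def phase_len_def colbits_def iters_def)
    have "real X = 2 * (real (colbits N) * real (colbits N)) * real (iters N)"
      by (simp add: X_def phase_len_def mult_ac)
    also have "\<dots> \<le> 2 * (z * z) * z"
      using n bb z1 by (intro mult_mono) auto
    finally have Xz: "real X \<le> 2 * z ^ 3" by (simp add: power3_eq_cube)
    have XX: "X \<le> X * X" "1 \<le> X * X" using X1 mult_le_mono[OF X1 X1] by simp_all
    have "cluster_radius (colbits N) (phase_len N) = 2 * X + 1 + X * Suc (2 * (X + 1)) + 2 * X + 2"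
      by (simp only: cluster_radius_def X_def mult.assoc)
    also have "\<dots> = 2 * (X * X) + 7 * X + 3" by (simp add: algebra_simps)
    also have "\<dots> \<le> 12 * (X * X)" using XX by linarith
    finally have "real (cluster_radius (colbits N) (phase_len N)) \<le> 12 * (real X * real X)"
      by (metis of_nat_le_iff of_nat_mult of_nat_numeral)
    also have "\<dots> \<le> 12 * ((2 * z ^ 3) * (2 * z ^ 3))" using Xz z1 by (intro mult_left_mono mult_mono) auto
    finally have cr: "real (cluster_radius (colbits N) (phase_len N)) \<le> 48 * z ^ 6"
      by (simp add: eval_nat_numeral)
    have "real (total_radius N) = 2 * real (mark_rounds N) + real (iters N) * real (cluster_radius (colbits N) (phase_len N))"
      by (simp add: total_radius_def)
    also have "\<dots> \<le> 2 * z + z * (48 * z ^ 6)"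
      using tt n cr z1 by (intro add_mono mult_mono) auto
    also have "\<dots> \<le> 100 * z ^ 7"
    proof -
      have "z \<le> z ^ 7" using power_increasing[of 1 7 z] z1 by simp
      moreover have "z * (48 * z ^ 6) = 48 * z ^ 7" by (simp add: eval_nat_numeral)
      moreover have "0 \<le> z ^ 7" using z1 by simp
      ultimately show ?thesis by linarith
    qed
    finally show "real (total_radius N) \<le> 100 * (a * (1 + ln (Y N))) ^ 7" by (simp add: z_def)
  qed
qed

text \<open>With \<open>u = sqrt (ln (Y N))\<close>, \<open>1 + u * u\<close> is at most
  \<open>(1 + u) * (1 + u)\<close>, hence at most \<open>exp (2 * u)\<close>, so the seventh power
  costs \<open>exp (14 * u)\<close>. The leading constant goes into the exponent because
  \<open>u\<close> is at least \<open>u0 > 0\<close>.\<close>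

lemma total_radius_bound:
  "\<exists>C>0. \<forall>N. real (total_radius N) \<le> exp (C * sqrt (ln (ln (real N + 3))))"
proof -
  obtain a where a: "1 \<le> a" "\<And>N. real (total_radius N) \<le> 100 * (a * (1 + ln (Y N))) ^ 7"
    using total_radius_poly by blast
  define u0 where "u0 = sqrt (ln (ln (3 :: real)))"
  have u0: "0 < u0" using ln3 by (simp add: u0_def)
  define w where "w = ln (100 * a ^ 7)"
  have a7: "1 \<le> a ^ 7" using a(1) by (rule one_le_power)
  have w: "0 \<le> w" using a7 by (simp add: w_def)
  show ?thesis
  proof (intro exI[of _ "14 + w / u0"] conjI allI)
    show "0 < 14 + w / u0" using w u0 by (intro add_pos_nonneg) auto
    fix N
    define u where "u = sqrt (ln (Y N))"
    have "ln (ln 3) \<le> ln (Y N)" using Y_gt_1[of N] ln3 by (subst ln_le_cancel_iff) auto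
    then have uu0: "u0 \<le> u" unfolding u_def u0_def by (rule real_sqrt_le_mono)
    have usq: "ln (Y N) = u * u" using Y_gt_1(2)[of N] by (simp add: u_def)
    have u: "0 \<le> u" using uu0 u0 by linarith
    have "1 + ln (Y N) \<le> (1 + u) * (1 + u)" using u unfolding usq by (simp add: algebra_simps)
    also have "\<dots> \<le> exp u * exp u" using u exp_ge_add_one_self[of u] by (intro mult_mono) auto
    also have "\<dots> = exp (2 * u)" by (simp add: exp_add[symmetric])
    finally have "(1 + ln (Y N)) ^ 7 \<le> exp (2 * u) ^ 7"
      using Y_gt_1(2)[of N] by (intro power_mono) auto
    also have "\<dots> = exp (14 * u)" by (simp add: exp_of_nat_mult[symmetric])
    finally have p: "(1 + ln (Y N)) ^ 7 \<le> exp (14 * u)" .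
    have "0 < 100 * a ^ 7" using a7 by linarith
    then have "100 * a ^ 7 = exp w" unfolding w_def by (rule exp_ln[symmetric])
    also have "\<dots> \<le> exp (w / u0 * u)"
    proof -
      have "w * u0 \<le> w * u" using uu0 w by (intro mult_left_mono) auto
      then show ?thesis using u0 by (simp add: field_simps)
    qed
    finally have q: "100 * a ^ 7 \<le> exp (w / u0 * u)" .
    have "real (total_radius N) \<le> (100 * a ^ 7) * (1 + ln (Y N)) ^ 7"
      using a(2)[of N] by (simp add: power_mult_distrib)
    also have "\<dots> \<le> exp (w / u0 * u) * exp (14 * u)"
      using p q Y_gt_1(2)[of N] by (intro mult_mono) auto
    also have "\<dots> = exp ((14 + w / u0) * u)" by (simp add: exp_add[symmetric] algebra_simps)
    finally show "real (total_radius N) \<le> exp ((14 + w / u0) * sqrt (ln (ln (real N + 3))))"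
      by (simp add: u_def Y_def)
  qed
qed

end

section \<open>The combined algorithm and its failure probability\<close>

definition start_round :: "mstate \<Rightarrow> (nat \<Rightarrow> nat) \<Rightarrow> dstate" where
  "start_round s x = (\<lambda>v. (alive s v, chosen s v, x v))"

definition shatter_cluster ::
  "nat \<Rightarrow> nat \<Rightarrow> nat \<Rightarrow> nat \<Rightarrow> nat \<Rightarrow> nat \<Rightarrow> (nat \<Rightarrow> nat \<Rightarrow> bool) \<Rightarrow> (nat \<Rightarrow> nat \<times> nat list) \<Rightarrow> nat \<Rightarrow> bool" where
  "shatter_cluster T n k m b K E z v = fst (snd ((cluster_iter k m b K E ^^ n)
     (start_round (mrun E T mstart (\<lambda>v. snd (z v))) (\<lambda>v. fst (z v))) v))"

lemma is_local_shatter_cluster: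
  "is_local (2 * T + n * cluster_radius b K) (\<lambda>E z. shatter_cluster T n k m b K E z)"
proof -
  have "is_local 0 (\<lambda>E (z :: nat \<Rightarrow> nat \<times> nat list) v. snd (z v))" by (rule is_local_pointwise)
  from is_local_comp[OF this is_local_mrun_start]
  have 1: "is_local (2 * T) (\<lambda>E (z :: nat \<Rightarrow> nat \<times> nat list). mrun E T mstart (\<lambda>v. snd (z v)))" by simp
  have 2: "is_local (2 * T) (\<lambda>E (z :: nat \<Rightarrow> nat \<times> nat list) v. fst (z v))"
    by (rule is_local_mono[OF is_local_pointwise]) simp
  from is_local_app[OF 1 2, where h = "\<lambda>(a, i, j) x. (a, i, x)"]
  have "is_local (2 * T) (\<lambda>E z. start_round (mrun E T mstart (\<lambda>v. snd (z v))) (\<lambda>v. fst (z v)))"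
    by (simp add: start_round_def alive_def chosen_def case_prod_unfold)
  from is_local_comp[OF this is_local_funpow[OF is_local_cluster_iter, of n]]
  have "is_local (2 * T + n * cluster_radius b K) (\<lambda>E z. (cluster_iter k m b K E ^^ n)
     (start_round (mrun E T mstart (\<lambda>v. snd (z v))) (\<lambda>v. fst (z v))))" .
  from is_local_comp[OF this is_local_pointwise[where f = "\<lambda>v y. fst (snd y)"]]
  show ?thesis by (simp add: shatter_cluster_def[abs_def])
qed

context polylog_params
begin

text \<open>Outside two bad events the run is deterministic and correct. Each event concerns only
  one component of the random input, so its probability is taken in the corresponding marginal
  \<open>m1\<close> or \<open>m2\<close>.\<close>

lemma shatter_cluster_prob:
  assumes adm: "admissible N D V E" "real D \<le> ln (real N + 2) ^ e"
    and P: "set_pmf P \<subseteq> {..<2 ^ id_bits N}" "\<And>i. pmf P i \<le> (1/2) ^ id_bits N"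
  shows "1 - 1 / (real N powr c) \<le> measure_pmf.prob
     (Pi_pmf V (d, replicate (mark_rounds N) 0) (\<lambda>_. pair_pmf P (replicate_pmf (mark_rounds N) (geo (mark_rounds N + 1)))))
     {z. maximal_independent_set V E {v \<in> V. shatter_cluster (mark_rounds N) (iters N) (id_bits N) (codelen N)
           (colbits N) (phase_len N) E z v}}"
proof -
  interpret graph_ctx V E using adm by unfold_locales (simp add: admissible_def)
  have card: "card V \<le> N" using adm by (simp add: admissible_def)
  have dg: "card {u. E v u} \<le> deg_bound N" for v
  proof (cases "v \<in> V")
    case True
    then have "card {u. E v u} \<le> D" using adm by (simp add: admissible_def neighbors_def)
    then show ?thesis using deg_bound_bounds(1)[OF adm(2)] by linarith
  next
    case False
    then have "{u. E v u} = {}" using EV by auto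
    then show ?thesis by simp
  qed
  let ?R = "replicate_pmf (mark_rounds N) (geo (mark_rounds N + 1))"
  let ?Q = "Pi_pmf V (d, replicate (mark_rounds N) 0) (\<lambda>_. pair_pmf P ?R)"
  have m1: "map_pmf (\<lambda>z v. fst (z v)) ?Q = Pi_pmf V d (\<lambda>_. P)"
    using Pi_pmf_map[OF finV, of fst "(d, replicate (mark_rounds N) 0)" d "\<lambda>_. pair_pmf P ?R"]
    by (simp add: map_fst_pair_pmf o_def)
  have m2: "map_pmf (\<lambda>z v. snd (z v)) ?Q = Pi_pmf V (replicate (mark_rounds N) 0) (\<lambda>_. ?R)"
    using Pi_pmf_map[OF finV, of snd "(d, replicate (mark_rounds N) 0)" "replicate (mark_rounds N) 0" "\<lambda>_. pair_pmf P ?R"]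
    by (simp add: map_snd_pair_pmf o_def)
  define U where "U = (\<lambda>z :: nat \<Rightarrow> nat \<times> nat list. {v \<in> V. alive (mrun E (mark_rounds N) mstart (\<lambda>v. snd (z v))) v})"
  define B1 where "B1 = {z. \<not> shattered (deg_bound N) (list_len N) (U z)}"
  define B2 where "B2 = {z :: nat \<Rightarrow> nat \<times> nat list. \<not> inj_on (\<lambda>v. fst (z v)) V}"
  define Good where "Good = {z. maximal_independent_set V E {v \<in> V. shatter_cluster (mark_rounds N) (iters N)
      (id_bits N) (codelen N) (colbits N) (phase_len N) E z v}}"
  have good: "z \<in> Good" if z: "z \<in> set_pmf ?Q" "z \<notin> B1" "z \<notin> B2" for z
  proof -
    let ?s = "mrun E (mark_rounds N) mstart (\<lambda>v. snd (z v))" and ?x = "\<lambda>v. fst (z v)"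
    have x: "?x v < 2 ^ id_bits N" if "v \<in> V" for v
    proof -
      have "z v \<in> set_pmf (pair_pmf P ?R)"
        using z(1) that unfolding set_Pi_pmf[OF finV] by (auto simp: PiE_dflt_def)
      then show ?thesis using P(1) by auto
    qed
    interpret cluster_ctx V E "U z" ?x "id_bits N" "codelen N" "colbits N" "phase_len N" "comp_bound N"
    proof unfold_locales
      show "U z \<subseteq> V" by (auto simp: U_def)
      show "card (reach E (U z) v) \<le> comp_bound N" if "v \<in> U z" for v
        using z(2) that by (auto simp: B1_def shattered_def comp_bound_def)
      show "?x v < 2 ^ id_bits N" if "v \<in> V" for v by (rule x[OF that])
      show "inj_on ?x V" using z(3) by (simp add: B2_def)
    qed (use id_bits_bounds(3) cluster_params in \<open>auto simp: codelen_def\<close>)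
    have "maximal_independent_set V E {v \<in> V. fst (snd ((cluster_iter (id_bits N) (codelen N) (colbits N)
        (phase_len N) E ^^ iters N) (start_round ?s ?x) v))}"
    proof (rule cluster_iterate)
      show "{v \<in> V. fst (start_round ?s ?x v)} = U z" by (simp add: start_round_def U_def)
      show "partial_mis V E (U z) {v \<in> V. fst (snd (start_round ?s ?x v))}"
        using mrun_mstart_partial_mis[of "mark_rounds N" "\<lambda>v. snd (z v)"] by (simp add: start_round_def U_def)
      show "snd (snd (start_round ?s ?x v)) = ?x v" for v by (simp add: start_round_def)
      show "comp_bound N < 2 ^ iters N" by (rule cluster_params(3))
    qed
    then show ?thesis by (simp add: Good_def shatter_cluster_def)
  qed
  have YN: "ln (real N + 2) \<le> Y N" by (simp add: Y_def)
  have "measure_pmf.prob ?Q B1 \<le> (1 / (real N powr c)) / 2"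
  proof -
    have "measure_pmf.prob ?Q B1 = measure_pmf.prob (map_pmf (\<lambda>z v. snd (z v)) ?Q)
        {y. \<not> shattered (deg_bound N) (list_len N) {v \<in> V. alive (mrun E (mark_rounds N) mstart y) v}}"
      by (simp add: vimage_def B1_def U_def)
    also have "\<dots> \<le> real (card V) * (2 * real (list_len N) * (real (deg_bound N) + 1) ^ 6 * decay ^ mark_rounds N) ^ Suc (list_len N)"
      unfolding m2 by (rule prob_not_shattered[OF dg _ list_len_bounds(3)]) simp
    also have "\<dots> \<le> real N * exp (- (c + 2)) ^ Suc (list_len N)"
    proof (rule mult_mono[OF _ power_mono])
      show "2 * real (list_len N) * (real (deg_bound N) + 1) ^ 6 * decay ^ mark_rounds N \<le> exp (- (c + 2))"
        by (rule shatter_params[OF list_len_bounds(3)]) (use time_bound_le(1)[of N] in \<open>simp only: time_bound_def\<close>)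
    qed (use card decay_bounds in auto)
    also have "exp (- (c + 2)) ^ Suc (list_len N) = exp (- ((c + 2) * real (Suc (list_len N))))"
      by (subst exp_of_nat_mult[symmetric]) (simp only: mult_ac mult_minus_right)
    also have "\<dots> \<le> exp (- ((c + 2) * ln (real N + 2)))"
      using c YN list_len_bounds(1)[of N] by simp
    also have "real N * exp (- ((c + 2) * ln (real N + 2))) \<le> (1 / (real N powr c)) / 2"
      by (rule tail_le_half(1)[OF c])
    finally show ?thesis by (simp add: mult_left_mono)
  qed
  moreover have "measure_pmf.prob ?Q B2 \<le> (1 / (real N powr c)) / 2"
  proof -
    have "measure_pmf.prob ?Q B2 = measure_pmf.prob (map_pmf (\<lambda>z v. fst (z v)) ?Q) {x. \<not> inj_on x V}"
      by (simp add: vimage_def B2_def)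
    also have "\<dots> \<le> (real (card V))\<^sup>2 * (1/2) ^ id_bits N"
      unfolding m1 by (rule prob_ids_collide[OF finV P(2)])
    also have "\<dots> \<le> (real N)\<^sup>2 * exp (- ((c + 3) * ln (real N + 2)))"
    proof (rule mult_mono)
      have "(c + 3) * ln (real N + 2) \<le> (c + 3) * Y N" using c YN by (intro mult_left_mono) auto
      also have "\<dots> \<le> real (id_bits N) * (2/3)" using id_bits_bounds(1)[of N] by (simp add: algebra_simps)
      also have "\<dots> \<le> real (id_bits N) * ln 2" by (rule mult_left_mono[OF ln2_ge_two_thirds]) simp
      finally have "exp (- (real (id_bits N) * ln 2)) \<le> exp (- ((c + 3) * ln (real N + 2)))" by simp
      also have "exp (- (real (id_bits N) * ln 2)) = (1/2) ^ id_bits N"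
        using exp_of_nat_mult[of "id_bits N" "- ln (2 :: real)"] by (simp add: exp_minus power_one_over inverse_eq_divide)
      finally show "(1/2) ^ id_bits N \<le> exp (- ((c + 3) * ln (real N + 2)))" .
    qed (use card in auto)
    also have "\<dots> \<le> (1 / (real N powr c)) / 2" by (rule tail_le_half(2)[OF c])
    finally show ?thesis .
  qed
  moreover have "measure_pmf.prob ?Q (UNIV - Good) \<le> measure_pmf.prob ?Q B1 + measure_pmf.prob ?Q B2"
  proof -
    \<comment> \<open>Identifiers are known to be in range only on the support, so the events are
      compared there.\<close>
    have "measure_pmf.prob ?Q (UNIV - Good) = measure_pmf.prob ?Q ((UNIV - Good) \<inter> set_pmf ?Q)"
      by (rule measure_Int_set_pmf[symmetric])
    also have "\<dots> \<le> measure_pmf.prob ?Q (B1 \<union> B2)"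
      by (rule measure_pmf.finite_measure_mono) (use good in auto)
    also have "\<dots> \<le> measure_pmf.prob ?Q B1 + measure_pmf.prob ?Q B2"
      by (rule measure_Un_le) auto
    finally show ?thesis .
  qed
  moreover have "measure_pmf.prob ?Q (UNIV - Good) = 1 - measure_pmf.prob ?Q Good"
    using measure_pmf.prob_compl[of Good ?Q] by simp
  ultimately show ?thesis unfolding Good_def[symmetric] by linarith
qed

end

theorem polylog_degree:
  fixes k :: nat and c :: real
  assumes c: "c > 0"
  shows "\<exists>(A::local_alg) (T::nat \<Rightarrow> nat \<Rightarrow> nat) (C::real). C > 0
     \<and> (\<forall>N D. real (T N D) \<le> exp (C * sqrt (ln (ln (real N + 3)))))
     \<and> (\<forall>N D V E. admissible N D V E \<and> real D \<le> (ln (real N + 2)) ^ k \<longrightarrow>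
           success_prob A N D (T N D) V E \<ge> 1 - 1 / (real N powr c))"
proof -
  interpret polylog_params c k by unfold_locales (rule c)
  have "\<forall>j. \<exists>d P. coin_gen d P \<and> set_pmf P \<subseteq> {..<2 ^ j :: nat} \<and> (\<forall>i. pmf P i \<le> (1/2) ^ j)"
    using id_pmf_exists by blast
  from choice[OF this] obtain d where
    "\<forall>j. \<exists>P. coin_gen (d j) P \<and> set_pmf P \<subseteq> {..<2 ^ j :: nat} \<and> (\<forall>i. pmf P i \<le> (1/2) ^ j)" ..
  from choice[OF this] obtain P where
    "\<forall>j. coin_gen (d j) (P j) \<and> set_pmf (P j) \<subseteq> {..<2 ^ j :: nat} \<and> (\<forall>i. pmf (P j) i \<le> (1/2) ^ j)" ..
  then have P: "\<And>j. coin_gen (d j) (P j)" "\<And>j. set_pmf (P j) \<subseteq> {..<2 ^ j :: nat}"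
      "\<And>j i. pmf (P j) i \<le> (1/2) ^ j" by simp_all
  let ?P = "\<lambda>N D. pair_pmf (P (id_bits N)) (replicate_pmf (mark_rounds N) (geo (mark_rounds N + 1)))"
  let ?d = "\<lambda>N D. (d (id_bits N), replicate (mark_rounds N) 0)"
  let ?F = "\<lambda>N D. shatter_cluster (mark_rounds N) (iters N) (id_bits N) (codelen N) (colbits N) (phase_len N)"
  let ?R = "\<lambda>N D :: nat. total_radius N"
  have gen: "coin_gen (?d N D) (?P N D)" for N D
    by (intro coin_gen_pair P(1) coin_gen_replicate coin_gen_geo)
  have loc: "is_local (?R N D) (?F N D)" for N D
    unfolding total_radius_def by (rule is_local_shatter_cluster)
  obtain A where A: "\<And>N D V E. simple_graph V E \<Longrightarrow> success_prob A N D (?R N D) V E =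
     measure_pmf.prob (Pi_pmf V (?d N D) (\<lambda>_. ?P N D))
       {z. maximal_independent_set V E {v \<in> V. ?F N D E z v}}"
    using local_computable[where P = ?P and d = ?d and F = ?F and R = ?R, OF gen loc] by blast
  obtain C where C: "C > 0" "\<And>N. real (total_radius N) \<le> exp (C * sqrt (ln (ln (real N + 3))))"
    using total_radius_bound by blast
  show ?thesis
  proof (intro exI[of _ A] exI[of _ ?R] exI[of _ C] conjI allI impI)
    fix N D V E assume adm: "admissible N D V E \<and> real D \<le> (ln (real N + 2)) ^ k"
    then have "simple_graph V E" by (simp add: admissible_def)
    then show "1 - 1 / (real N powr c) \<le> success_prob A N D (?R N D) V E"
      unfolding A[OF \<open>simple_graph V E\<close>]
      using shatter_cluster_prob[of N D V E "P (id_bits N)" "d (id_bits N)"] adm P(2,3) by blast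
  qed (use C in auto)
qed

theorem theorem6:
  shows "(\<forall>c::real. c > 0 \<longrightarrow>
           (\<exists>(A::local_alg) (T::nat \<Rightarrow> nat \<Rightarrow> nat) (C::real). C > 0
              \<and> (\<forall>N D. real (T N D) \<le> C * ln (real D + 2) * sqrt (ln (real N + 2)))
              \<and> (\<forall>N D V E. admissible N D V E \<longrightarrow>
                    success_prob A N D (T N D) V E \<ge> 1 - 1 / (real N powr c))))
       \<and> (\<forall>(k::nat) (c::real). c > 0 \<longrightarrow>
           (\<exists>(A::local_alg) (T::nat \<Rightarrow> nat \<Rightarrow> nat) (C::real). C > 0
              \<and> (\<forall>N D. real (T N D) \<le> exp (C * sqrt (ln (ln (real N + 3)))))
              \<and> (\<forall>N D V E. admissible N D V E \<and> real D \<le> (ln (real N + 2)) ^ k \<longrightarrow>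
                    success_prob A N D (T N D) V E \<ge> 1 - 1 / (real N powr c))))"
  by (intro conjI allI impI general_degree polylog_degree)

end
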